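(* Let $J\in\{I,J_1,J_+\}$, let $(X,c)$ be a closure space and $i$ the induced interior operator. Let $Z\subseteq A\subseteq X$ be such that $c(Z)\subseteq i(A)$. Then the inclusion $(X\setminus Z,A\setminus Z)\to(X,A)$ induces isomorphisms $$H^J_n(X\setminus Z,A\setminus Z)\cong H^J_n(X,A)\quad\text{and}\quad H^{(J,\times)}_n(X\setminus Z,A\setminus Z)\cong H^{(J,\times)}_n(X,A)$$ for all $n$. Equivalently, for every interior cover $\{A,B\}$ of $(X,c)$, the inclusion $(B,A\cap B)\to(X,A)$ induces isomorphisms $H^J_n(B,A\cap B)\cong H^J_n(X,A)$ and $H^{(J,\times)}_n(B,A\cap B)\cong H^{(J,\times)}_n(X,A)$ for all $n$.
   Context: A closure space $(X,c)$ is a set $X$ with a map $c:\mathcal P(X)\to\mathcal P(X)$ such that $c(\emptyset)=\emptyset$, $A\subseteq c(A)$, and $c(A\cup B)=c(A)\cup c(B)$. A subset $A\subseteq X$ carries the subspace closure $B\mapsto c(B)\cap A$. The interior operator is $i(A)=X\setminus c(X\setminus A)$, and $V$ is a neighborhood of $x$ if $x\in i(V)$. An interior cover of $X$ is a family $\mathcal U$ of subsets with $X=\bigcup_{U\in\mathcal U}i(U)$. A map $f:(X,c)\to(Y,d)$ is continuous if $f(c(A))\subseteq d(f(A))$ for all $A\subseteq X$. Topological spaces are closure spaces via the topological closure. The product $X\times Y$ is the set product with the closure for which the sets $U\times V$ ($U$ a neighborhood of $x$, $V$ of $y$) form a neighborhood base at $(x,y)$. Spaces: $I=[0,1]$ with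 the usual topology; $J_1=\{0,1\}$ with the indiscrete closure; $J_+=\{0,1\}$ with $c(\{0\})=\{0,1\}$, $c(\{1\})=\{1\}$. Singular simplices: $|\Delta^n|^{I}$ is the standard topological $n$-simplex; $|\Delta^n|^{J_1}$ is $\{0,\dots,n\}$ with the indiscrete closure; $|\Delta^n|^{J_+}$ is $\{0,\dots,n\}$ with $c(\{i\})=\{j: j\ge i\}$. $C^J_n(X)$ is the free abelian group on continuous maps $\sigma:|\Delta^n|^J\to X$, with $\partial\sigma=\sum_{i=0}^n(-1)^i\sigma\circ d^i$, $d^i$ the $i$-th face inclusion. Singular cubes: $J^{\times n}$ is the $n$-fold product (a point if $n=0$). Let $Q_n(X)$ be the free abelian group on continuous maps $\sigma:J^{\times n}\to X$ and $D_n(X)$ the subgroup generated by the degenerate $\sigma$, i.e. those that do not depend on their $i$-th coordinate for some $1\le i\le n$. Then $C^{(J,\times)}_n(X)=Q_n(X)/D_n(X)$, with $\partial\sigma=\sum_{i=1}^n(-1)^i(A_i\sigma-B_i\sigma)$, where $A_i\sigma$ (resp. $B_i\sigma$) is $\sigma$ with $0$ (resp. $1$) inserted in the $i$-th coordinate. For a subspace $A\subseteq X$: $H^J_n(X,A)$ and $H^{(J,\times)}_n(X,A)$ are the homology groups of the quotient complexes $C^J_\bullet(X)/C^J_\bullet(A)$ and $C^{(J,\times)}_\bullet(X)/C^{(J,\times)}_\bullet(A)$. *)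

theory Defs
  imports "HOL-Homology.Homology"
begin

section \<open>Closure spaces\<close>

text \<open>
  The closure operator is only meaningful on subsets of the point set; its values on other
  sets are irrelevant everywhere below.
\<close>

record 'a clspace =
  pts :: "'a set"
  cl :: "'a set \<Rightarrow> 'a set"

definition closure_space :: "'a clspace \<Rightarrow> bool" where
  "closure_space X \<longleftrightarrow>
     (\<forall>A. A \<subseteq> pts X \<longrightarrow> cl X A \<subseteq> pts X) \<and>
     cl X {} = {} \<and>
     (\<forall>A. A \<subseteq> pts X \<longrightarrow> A \<subseteq> cl X A) \<and>
     (\<forall>A B. A \<subseteq> pts X \<longrightarrow> B \<subseteq> pts X \<longrightarrow> cl X (A \<union> B) = cl X A \<union> cl X B)"

definition cl_subspace :: "'a clspace \<Rightarrow> 'a set \<Rightarrow> 'a clspace" where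
  "cl_subspace X A = \<lparr>pts = A, cl = (\<lambda>B. cl X B \<inter> A)\<rparr>"

definition cl_interior :: "'a clspace \<Rightarrow> 'a set \<Rightarrow> 'a set" where
  "cl_interior X A = pts X - cl X (pts X - A)"

definition cl_nbhd :: "'a clspace \<Rightarrow> 'a \<Rightarrow> 'a set \<Rightarrow> bool" where
  "cl_nbhd X x V \<longleftrightarrow> V \<subseteq> pts X \<and> x \<in> cl_interior X V"

definition interior_cover :: "'a clspace \<Rightarrow> 'a set set \<Rightarrow> bool" where
  "interior_cover X \<U> \<longleftrightarrow> (\<forall>U\<in>\<U>. U \<subseteq> pts X) \<and> pts X = (\<Union>U\<in>\<U>. cl_interior X U)"

definition cl_continuous :: "'a clspace \<Rightarrow> 'b clspace \<Rightarrow> ('a \<Rightarrow> 'b) \<Rightarrow> bool" where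
  "cl_continuous X Y f \<longleftrightarrow>
     f ` pts X \<subseteq> pts Y \<and> (\<forall>A. A \<subseteq> pts X \<longrightarrow> f ` cl X A \<subseteq> cl Y (f ` A))"

definition clspace_of_topology :: "'a topology \<Rightarrow> 'a clspace" where
  "clspace_of_topology T = \<lparr>pts = topspace T, cl = (\<lambda>A. T closure_of A)\<rparr>"

definition indiscrete_clspace :: "'a set \<Rightarrow> 'a clspace" where
  "indiscrete_clspace S = \<lparr>pts = S, cl = (\<lambda>A. if A = {} then {} else S)\<rparr>"

text \<open>
  The \<open>n\<close>-fold product, on extensional functions on \<open>{1..n}\<close>.  The boxes of neighbourhoods form
  a neighbourhood base, so a point lies in the closure of \<open>S\<close> iff every such box around it meets
  \<open>S\<close>.  For \<open>n = 0\<close> this is a single point.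
\<close>

definition cl_power :: "'j clspace \<Rightarrow> nat \<Rightarrow> (nat \<Rightarrow> 'j) clspace" where
  "cl_power J n =
     \<lparr>pts = {1..n} \<rightarrow>\<^sub>E pts J,
      cl = (\<lambda>S. {x \<in> {1..n} \<rightarrow>\<^sub>E pts J.
               \<forall>V. (\<forall>i\<in>{1..n}. cl_nbhd J (x i) (V i)) \<longrightarrow> ({1..n} \<rightarrow>\<^sub>E pts J) \<inter> Pi {1..n} V \<inter> S \<noteq> {}})\<rparr>"


section \<open>The intervals and the simplices\<close>

definition I_space :: "real clspace" where
  "I_space = clspace_of_topology (top_of_set {0..1})"

definition J1_space :: "nat clspace" where
  "J1_space = indiscrete_clspace {0, 1}"

definition Jp_space :: "nat clspace" where
  "Jp_space = \<lparr>pts = {0, 1}, cl = (\<lambda>A. if 0 \<in> A then {0, 1} else A)\<rparr>"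

record 's simplex_model =
  simplex :: "nat \<Rightarrow> 's clspace"
  coface :: "nat \<Rightarrow> 's \<Rightarrow> 's"

definition I_simplices :: "(nat \<Rightarrow> real) simplex_model" where
  "I_simplices =
     \<lparr>simplex = (\<lambda>n. clspace_of_topology (subtopology (powertop_real UNIV) (standard_simplex n))),
      coface = simplical_face\<rparr>"

definition vertex_coface :: "nat \<Rightarrow> nat \<Rightarrow> nat" where
  "vertex_coface i k = (if k < i then k else Suc k)"

definition J1_simplices :: "nat simplex_model" where
  "J1_simplices = \<lparr>simplex = (\<lambda>n. indiscrete_clspace {0..n}), coface = vertex_coface\<rparr>"

text \<open>Additivity of the closure determines it from its values \<open>{i..n}\<close> on the singletons \<open>{i}\<close>.\<close>

definition Jp_simplices :: "nat simplex_model" where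
  "Jp_simplices =
     \<lparr>simplex = (\<lambda>n. \<lparr>pts = {0..n}, cl = (\<lambda>A. \<Union>i\<in>A. {i..n})\<rparr>), coface = vertex_coface\<rparr>"


section \<open>Chain complexes, quotient complexes and homology\<close>

text \<open>
  \<open>bdry C n\<close> is the differential from degree \<open>n\<close> to degree \<open>n - 1\<close>.  Complexes are
  concentrated in non-negative degrees; \<open>bdry C 0\<close> is a trivial endomorphism of
  degree \<open>0\<close>, so that every \<open>0\<close>-chain is a cycle.
\<close>

record 'c chain_cx =
  grp :: "nat \<Rightarrow> 'c monoid"
  bdry :: "nat \<Rightarrow> 'c \<Rightarrow> 'c"

text \<open>
  If \<open>f\<close> is a homomorphism from \<open>G\<close> to \<open>H\<close> that takes a normal subgroup \<open>N\<close> into the normal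
  subgroup \<open>M\<close>, then \<open>quot_map H M f\<close> is the induced map from \<open>G Mod N\<close> to \<open>H Mod M\<close>: it takes
  the coset of \<open>x\<close> to the coset of \<open>f x\<close>.
\<close>

definition quot_map :: "'d monoid \<Rightarrow> 'd set \<Rightarrow> ('c \<Rightarrow> 'd) \<Rightarrow> 'c set \<Rightarrow> 'd set" where
  "quot_map H M f K = M <#>\<^bsub>H\<^esub> (f ` K)"

definition quot_cx :: "'c chain_cx \<Rightarrow> (nat \<Rightarrow> 'c set) \<Rightarrow> 'c set chain_cx" where
  "quot_cx C S =
     \<lparr>grp = (\<lambda>n. grp C n Mod S n),
      bdry = (\<lambda>n. quot_map (grp C (n - 1)) (S (n - 1)) (bdry C n))\<rparr>"

definition cycle_group :: "nat \<Rightarrow> 'c chain_cx \<Rightarrow> 'c monoid" where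
  "cycle_group n C = (grp C n)\<lparr>carrier := kernel (grp C n) (grp C (n - 1)) (bdry C n)\<rparr>"

definition boundaries :: "nat \<Rightarrow> 'c chain_cx \<Rightarrow> 'c set" where
  "boundaries n C = bdry C (Suc n) ` carrier (grp C (Suc n))"

definition homology :: "nat \<Rightarrow> 'c chain_cx \<Rightarrow> 'c set monoid" where
  "homology n C = cycle_group n C Mod boundaries n C"

text \<open>The map into the homology of \<open>D\<close> induced by a chain map \<open>f\<close> (in degree \<open>n\<close>) into \<open>D\<close>.\<close>

definition homology_map :: "nat \<Rightarrow> 'd chain_cx \<Rightarrow> ('c \<Rightarrow> 'd) \<Rightarrow> 'c set \<Rightarrow> 'd set" where
  "homology_map n D f = quot_map (cycle_group n D) (boundaries n D) f"


section \<open>Singular simplicial homology\<close>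

text \<open>Maps are taken to be extensional so that functions represent maps uniquely.\<close>

definition sing_simplices :: "'s simplex_model \<Rightarrow> nat \<Rightarrow> 'a clspace \<Rightarrow> ('s \<Rightarrow> 'a) set" where
  "sing_simplices \<Delta> n X =
     {\<sigma>. cl_continuous (simplex \<Delta> n) X \<sigma> \<and> \<sigma> \<in> extensional (pts (simplex \<Delta> n))}"

definition sing_bdry :: "'s simplex_model \<Rightarrow> nat \<Rightarrow> (('s \<Rightarrow> 'a) \<Rightarrow>\<^sub>0 int) \<Rightarrow> (('s \<Rightarrow> 'a) \<Rightarrow>\<^sub>0 int)" where
  "sing_bdry \<Delta> n =
     (if n = 0 then (\<lambda>_. 0)
      else frag_extend (\<lambda>\<sigma>. \<Sum>i=0..n. frag_cmul ((-1) ^ i)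
             (frag_of (restrict (\<sigma> \<circ> coface \<Delta> i) (pts (simplex \<Delta> (n - 1)))))))"

definition sing_cx :: "'s simplex_model \<Rightarrow> 'a clspace \<Rightarrow> (('s \<Rightarrow> 'a) \<Rightarrow>\<^sub>0 int) chain_cx" where
  "sing_cx \<Delta> X = \<lparr>grp = (\<lambda>n. free_Abelian_group (sing_simplices \<Delta> n X)), bdry = sing_bdry \<Delta>\<rparr>"

definition sing_chain_map ::
    "'s simplex_model \<Rightarrow> nat \<Rightarrow> ('a \<Rightarrow> 'b) \<Rightarrow> (('s \<Rightarrow> 'a) \<Rightarrow>\<^sub>0 int) \<Rightarrow> (('s \<Rightarrow> 'b) \<Rightarrow>\<^sub>0 int)" where
  "sing_chain_map \<Delta> n f = frag_extend (\<lambda>\<sigma>. frag_of (restrict (f \<circ> \<sigma>) (pts (simplex \<Delta> n))))"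

text \<open>The image in degree \<open>n\<close> of the chains of the subspace \<open>A\<close> under the inclusion.\<close>

definition sing_sub :: "'s simplex_model \<Rightarrow> 'a clspace \<Rightarrow> 'a set \<Rightarrow> nat \<Rightarrow> (('s \<Rightarrow> 'a) \<Rightarrow>\<^sub>0 int) set" where
  "sing_sub \<Delta> X A n = sing_chain_map \<Delta> n (\<lambda>x. x) ` carrier (grp (sing_cx \<Delta> (cl_subspace X A)) n)"

definition sing_rel_cx ::
    "'s simplex_model \<Rightarrow> 'a clspace \<Rightarrow> 'a set \<Rightarrow> (('s \<Rightarrow> 'a) \<Rightarrow>\<^sub>0 int) set chain_cx" where
  "sing_rel_cx \<Delta> X A = quot_cx (sing_cx \<Delta> X) (sing_sub \<Delta> X A)"

definition sing_homology ::
    "'s simplex_model \<Rightarrow> nat \<Rightarrow> 'a clspace \<Rightarrow> 'a set \<Rightarrow> (('s \<Rightarrow> 'a) \<Rightarrow>\<^sub>0 int) set set monoid" where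
  "sing_homology \<Delta> n X A = homology n (sing_rel_cx \<Delta> X A)"

text \<open>
  The map induced on relative homology by a map of pairs \<open>f\<close> into \<open>(Y, B)\<close>.  As for
  \<open>quot_map\<close>, the source pair enters only through the domain.
\<close>

definition sing_homology_map ::
    "'s simplex_model \<Rightarrow> nat \<Rightarrow> 'b clspace \<Rightarrow> 'b set \<Rightarrow> ('a \<Rightarrow> 'b) \<Rightarrow>
     (('s \<Rightarrow> 'a) \<Rightarrow>\<^sub>0 int) set set \<Rightarrow> (('s \<Rightarrow> 'b) \<Rightarrow>\<^sub>0 int) set set" where
  "sing_homology_map \<Delta> n Y B f =
     homology_map n (sing_rel_cx \<Delta> Y B)
       (quot_map (grp (sing_cx \<Delta> Y) n) (sing_sub \<Delta> Y B n) (sing_chain_map \<Delta> n f))"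


section \<open>Singular cubical homology\<close>

definition sing_cubes :: "'j clspace \<Rightarrow> nat \<Rightarrow> 'a clspace \<Rightarrow> ((nat \<Rightarrow> 'j) \<Rightarrow> 'a) set" where
  "sing_cubes J n X =
     {\<sigma>. cl_continuous (cl_power J n) X \<sigma> \<and> \<sigma> \<in> extensional (pts (cl_power J n))}"

definition degenerate_cube :: "'j clspace \<Rightarrow> nat \<Rightarrow> ((nat \<Rightarrow> 'j) \<Rightarrow> 'a) \<Rightarrow> bool" where
  "degenerate_cube J n \<sigma> \<longleftrightarrow>
     (\<exists>i\<in>{1..n}. \<forall>x\<in>pts (cl_power J n). \<forall>y\<in>pts (cl_power J n).
        (\<forall>k\<in>{1..n}. k \<noteq> i \<longrightarrow> x k = y k) \<longrightarrow> \<sigma> x = \<sigma> y)"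

definition cube_insert :: "nat \<Rightarrow> nat \<Rightarrow> 'j \<Rightarrow> (nat \<Rightarrow> 'j) \<Rightarrow> nat \<Rightarrow> 'j" where
  "cube_insert n i t x =
     (\<lambda>k\<in>{1..n}. if k < i then x k else if k = i then t else x (k - 1))"

definition cube_face ::
    "'j clspace \<Rightarrow> nat \<Rightarrow> nat \<Rightarrow> 'j \<Rightarrow> ((nat \<Rightarrow> 'j) \<Rightarrow> 'a) \<Rightarrow> (nat \<Rightarrow> 'j) \<Rightarrow> 'a" where
  "cube_face J n i t \<sigma> = restrict (\<sigma> \<circ> cube_insert n i t) (pts (cl_power J (n - 1)))"

definition cube_bdry ::
    "'j::zero_neq_one clspace \<Rightarrow> nat \<Rightarrow> (((nat \<Rightarrow> 'j) \<Rightarrow> 'a) \<Rightarrow>\<^sub>0 int) \<Rightarrow> (((nat \<Rightarrow> 'j) \<Rightarrow> 'a) \<Rightarrow>\<^sub>0 int)" where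
  "cube_bdry J n =
     frag_extend (\<lambda>\<sigma>. \<Sum>i=1..n. frag_cmul ((-1) ^ i)
       (frag_of (cube_face J n i 0 \<sigma>) - frag_of (cube_face J n i 1 \<sigma>)))"

definition all_cubes_cx ::
    "'j::zero_neq_one clspace \<Rightarrow> 'a clspace \<Rightarrow> (((nat \<Rightarrow> 'j) \<Rightarrow> 'a) \<Rightarrow>\<^sub>0 int) chain_cx" where
  "all_cubes_cx J X = \<lparr>grp = (\<lambda>n. free_Abelian_group (sing_cubes J n X)), bdry = cube_bdry J\<rparr>"

definition degenerate_chains ::
    "'j::zero_neq_one clspace \<Rightarrow> 'a clspace \<Rightarrow> nat \<Rightarrow> (((nat \<Rightarrow> 'j) \<Rightarrow> 'a) \<Rightarrow>\<^sub>0 int) set" where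
  "degenerate_chains J X n =
     generate (grp (all_cubes_cx J X) n)
       (frag_of ` {\<sigma> \<in> sing_cubes J n X. degenerate_cube J n \<sigma>})"

definition cube_cx ::
    "'j::zero_neq_one clspace \<Rightarrow> 'a clspace \<Rightarrow> (((nat \<Rightarrow> 'j) \<Rightarrow> 'a) \<Rightarrow>\<^sub>0 int) set chain_cx" where
  "cube_cx J X = quot_cx (all_cubes_cx J X) (degenerate_chains J X)"

definition cube_chain_map ::
    "'j::zero_neq_one clspace \<Rightarrow> nat \<Rightarrow> 'b clspace \<Rightarrow> ('a \<Rightarrow> 'b) \<Rightarrow>
     (((nat \<Rightarrow> 'j) \<Rightarrow> 'a) \<Rightarrow>\<^sub>0 int) set \<Rightarrow> (((nat \<Rightarrow> 'j) \<Rightarrow> 'b) \<Rightarrow>\<^sub>0 int) set" where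
  "cube_chain_map J n Y f =
     quot_map (grp (all_cubes_cx J Y) n) (degenerate_chains J Y n)
       (frag_extend (\<lambda>\<sigma>. frag_of (restrict (f \<circ> \<sigma>) (pts (cl_power J n)))))"

text \<open>
  The image in degree \<open>n\<close> of the chains of the subspace \<open>A\<close> under the map induced by the inclusion.
  This map is injective, since a cube in \<open>A\<close> is degenerate iff it is so as a cube in \<open>X\<close>.
\<close>

definition cube_sub ::
    "'j::zero_neq_one clspace \<Rightarrow> 'a clspace \<Rightarrow> 'a set \<Rightarrow> nat \<Rightarrow> (((nat \<Rightarrow> 'j) \<Rightarrow> 'a) \<Rightarrow>\<^sub>0 int) set set" where
  "cube_sub J X A n = cube_chain_map J n X (\<lambda>x. x) ` carrier (grp (cube_cx J (cl_subspace X A)) n)"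

definition cube_rel_cx ::
    "'j::zero_neq_one clspace \<Rightarrow> 'a clspace \<Rightarrow> 'a set \<Rightarrow> (((nat \<Rightarrow> 'j) \<Rightarrow> 'a) \<Rightarrow>\<^sub>0 int) set set chain_cx" where
  "cube_rel_cx J X A = quot_cx (cube_cx J X) (cube_sub J X A)"

definition cube_homology ::
    "'j::zero_neq_one clspace \<Rightarrow> nat \<Rightarrow> 'a clspace \<Rightarrow> 'a set \<Rightarrow>
     (((nat \<Rightarrow> 'j) \<Rightarrow> 'a) \<Rightarrow>\<^sub>0 int) set set set monoid" where
  "cube_homology J n X A = homology n (cube_rel_cx J X A)"

definition cube_homology_map ::
    "'j::zero_neq_one clspace \<Rightarrow> nat \<Rightarrow> 'b clspace \<Rightarrow> 'b set \<Rightarrow> ('a \<Rightarrow> 'b) \<Rightarrow>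
     (((nat \<Rightarrow> 'j) \<Rightarrow> 'a) \<Rightarrow>\<^sub>0 int) set set set \<Rightarrow> (((nat \<Rightarrow> 'j) \<Rightarrow> 'b) \<Rightarrow>\<^sub>0 int) set set set" where
  "cube_homology_map J n Y B f =
     homology_map n (cube_rel_cx J Y B)
       (quot_map (grp (cube_cx J Y) n) (cube_sub J Y B n) (cube_chain_map J n Y f))"


section \<open>Isomorphisms induced by an inclusion of pairs\<close>

definition sing_inclusion_iso ::
    "'s simplex_model \<Rightarrow> nat \<Rightarrow> 'a clspace \<Rightarrow> 'a set \<Rightarrow> 'a clspace \<Rightarrow> 'a set \<Rightarrow> bool" where
  "sing_inclusion_iso \<Delta> n X A Y B \<longleftrightarrow>
     sing_homology_map \<Delta> n Y B (\<lambda>x. x) \<in> iso (sing_homology \<Delta> n X A) (sing_homology \<Delta> n Y B)"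

definition cube_inclusion_iso ::
    "'j::zero_neq_one clspace \<Rightarrow> nat \<Rightarrow> 'a clspace \<Rightarrow> 'a set \<Rightarrow> 'a clspace \<Rightarrow> 'a set \<Rightarrow> bool" where
  "cube_inclusion_iso J n X A Y B \<longleftrightarrow>
     cube_homology_map J n Y B (\<lambda>x. x) \<in> iso (cube_homology J n X A) (cube_homology J n Y B)"

end

theory Submission
  imports Defs
begin

text \<open>
  Excision follows formally once every chain of \<open>X\<close> can be subdivided, by a chain map that preserves
  subspaces and is naturally homotopic to the identity modulo degenerate chains, into cells that lie in
  \<open>A\<close> or in \<open>B\<close>.  For \<open>J\<^sub>1\<close> and \<open>J\<^sub>+\<close> no subdivision is needed: some vertex lies in the closure of every
  other one, so a cell lies in whichever of \<open>A\<close>, \<open>B\<close> is a neighbourhood of the image of that vertex.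
  For \<open>I\<close> the interior cover pulls back along a cell to an open cover of a compact space, and one
  takes iterated barycentric subdivision of simplices, respectively subdivision of cubes into a
  sufficiently fine grid.  The homotopies are built on the universal cells: the barycentric one is the
  library's, the one for grids is a cone construction by induction on the dimension.
\<close>

section \<open>Presentations of homology groups\<close>

text \<open>Chain groups are given by supports, that is by sets of cells, so their sums and
  intersections are read off from unions and intersections of these sets. No complex of small chains
  is needed: surjectivity and injectivity each concern a single chain, and the subdivision may be
  chosen for that chain.

  The obstacle is in the cubical case. The cone from the origin over a cube has a constant bottom
  face, which is removed by dividing out degenerate cubes, so the homotopy identity for the grid is
  obtained modulo degenerate cubes. It then has to be shown that the homotopy itself carries
  degenerate chains to degenerate chains. This explains the choice of the origin as cone point: a
  cube that ignores coordinate \<open>i\<close> factors through the projection setting this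
  coordinate to 0, and that projection is linear and fixes the origin, hence commutes with the cone.

  Simplices are covered by the same excision argument, with an empty set of degenerate
  cells.\<close>

text \<open>
  The homology groups consist of cosets of cosets of chains.  A presentation \<open>\<pi>\<close> of \<open>G\<close>, a
  surjective homomorphism with kernel \<open>N\<close> from a group \<open>Z\<close> of chains, lets all arguments take place in \<open>Z\<close>.
\<close>

definition presents :: "'x::ab_group_add set \<Rightarrow> 'x set \<Rightarrow> ('x \<Rightarrow> 'c) \<Rightarrow> 'c monoid \<Rightarrow> bool" where
  "presents Z N \<pi> G \<longleftrightarrow>
     comm_group G \<and> 0 \<in> Z \<and> (\<forall>x\<in>Z. \<forall>y\<in>Z. x - y \<in> Z) \<and> \<pi> ` Z = carrier G \<and>
     (\<forall>x\<in>Z. \<forall>y\<in>Z. \<pi> (x + y) = \<pi> x \<otimes>\<^bsub>G\<^esub> \<pi> y) \<and> N = {x \<in> Z. \<pi> x = \<one>\<^bsub>G\<^esub>}"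

lemma presentsD:
  assumes "presents Z N \<pi> G"
  shows "comm_group G" "0 \<in> Z" "\<And>x y. x \<in> Z \<Longrightarrow> y \<in> Z \<Longrightarrow> x - y \<in> Z"
    "\<And>x. x \<in> Z \<Longrightarrow> - x \<in> Z" "\<And>x y. x \<in> Z \<Longrightarrow> y \<in> Z \<Longrightarrow> x + y \<in> Z"
    "\<pi> ` Z = carrier G" "\<And>x. x \<in> Z \<Longrightarrow> \<pi> x \<in> carrier G"
    "\<And>x y. x \<in> Z \<Longrightarrow> y \<in> Z \<Longrightarrow> \<pi> (x + y) = \<pi> x \<otimes>\<^bsub>G\<^esub> \<pi> y"
    "\<pi> 0 = \<one>\<^bsub>G\<^esub>"
    "\<And>x. x \<in> Z \<Longrightarrow> \<pi> (- x) = inv\<^bsub>G\<^esub> (\<pi> x)"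
    "\<And>x y. x \<in> Z \<Longrightarrow> y \<in> Z \<Longrightarrow> \<pi> (x - y) = \<pi> x \<otimes>\<^bsub>G\<^esub> inv\<^bsub>G\<^esub> (\<pi> y)"
    "\<And>x. x \<in> Z \<Longrightarrow> \<pi> x = \<one>\<^bsub>G\<^esub> \<longleftrightarrow> x \<in> N" "N \<subseteq> Z"
    "\<And>x y. x \<in> Z \<Longrightarrow> y \<in> Z \<Longrightarrow> \<pi> x = \<pi> y \<longleftrightarrow> x - y \<in> N"
proof -
  interpret G: comm_group G
    using assms by (simp add: presents_def)
  show "comm_group G" by unfold_locales
  show Z0: "0 \<in> Z" and Zd: "\<And>x y. x \<in> Z \<Longrightarrow> y \<in> Z \<Longrightarrow> x - y \<in> Z"
    and im: "\<pi> ` Z = carrier G"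
    and mult: "\<And>x y. x \<in> Z \<Longrightarrow> y \<in> Z \<Longrightarrow> \<pi> (x + y) = \<pi> x \<otimes>\<^bsub>G\<^esub> \<pi> y"
    and ker: "\<And>x. x \<in> Z \<Longrightarrow> \<pi> x = \<one>\<^bsub>G\<^esub> \<longleftrightarrow> x \<in> N" and "N \<subseteq> Z"
    using assms by (auto simp: presents_def)
  show Zm: "- x \<in> Z" if "x \<in> Z" for x
    using Zd[OF Z0 that] by simp
  show "x + y \<in> Z" if "x \<in> Z" "y \<in> Z" for x y
    using Zd[OF that(1) Zm[OF that(2)]] by simp
  show car: "\<pi> x \<in> carrier G" if "x \<in> Z" for x
    using im that by blast
  show one: "\<pi> 0 = \<one>\<^bsub>G\<^esub>"
    using mult[OF Z0 Z0] car[OF Z0] by (simp add: G.l_cancel_one')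
  show inv: "\<pi> (- x) = inv\<^bsub>G\<^esub> (\<pi> x)" if "x \<in> Z" for x
    using mult[OF Zm[OF that] that] one by (simp add: G.inv_equality car that Zm)
  show diff: "\<pi> (x - y) = \<pi> x \<otimes>\<^bsub>G\<^esub> inv\<^bsub>G\<^esub> (\<pi> y)" if "x \<in> Z" "y \<in> Z" for x y
    using mult[OF that(1) Zm[OF that(2)]] inv that by simp
  show "\<pi> x = \<pi> y \<longleftrightarrow> x - y \<in> N" if "x \<in> Z" "y \<in> Z" for x y
    using diff[OF that] ker[OF Zd[OF that]] car that
    by (metis G.inv_closed G.inv_equality G.inv_inv G.r_inv)
qed

text \<open>The group laws of \<open>G\<close> are images of those in \<open>Z\<close> under the
  surjective additive map; this is how every quotient, cycle group and homology group below is seen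
  to be commutative.\<close>

lemma presentsI:
  fixes Z :: "'x::ab_group_add set"
  assumes "0 \<in> Z" "\<And>x y. x \<in> Z \<Longrightarrow> y \<in> Z \<Longrightarrow> x - y \<in> Z" "\<pi> ` Z = carrier G"
    and mult: "\<And>x y. x \<in> Z \<Longrightarrow> y \<in> Z \<Longrightarrow> \<pi> (x + y) = \<pi> x \<otimes>\<^bsub>G\<^esub> \<pi> y"
    and one: "\<pi> 0 = \<one>\<^bsub>G\<^esub>" and ker: "\<And>x. x \<in> N \<longleftrightarrow> x \<in> Z \<and> \<pi> x = \<one>\<^bsub>G\<^esub>"
  shows "presents Z N \<pi> G"
proof -
  have Zm: "- x \<in> Z" if "x \<in> Z" for x
    using assms(2)[OF assms(1) that] by simp
  have Zp: "x + y \<in> Z" if "x \<in> Z" "y \<in> Z" for x y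
    using assms(2)[OF that(1) Zm[OF that(2)]] by simp
  have car: "\<And>g. g \<in> carrier G \<longleftrightarrow> (\<exists>x\<in>Z. g = \<pi> x)"
    using assms(3) by auto
  have "comm_group G"
  proof (rule comm_groupI)
    show "x \<otimes>\<^bsub>G\<^esub> y \<in> carrier G" if "x \<in> carrier G" "y \<in> carrier G" for x y
      using that Zp by (metis car mult)
    show "\<one>\<^bsub>G\<^esub> \<in> carrier G"
      using assms(1) one car by metis
    show "x \<otimes>\<^bsub>G\<^esub> y \<otimes>\<^bsub>G\<^esub> z = x \<otimes>\<^bsub>G\<^esub> (y \<otimes>\<^bsub>G\<^esub> z)"
      if "x \<in> carrier G" "y \<in> carrier G" "z \<in> carrier G" for x y z
      using that unfolding car by (auto simp: Zp add.assoc simp flip: mult)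
    show "x \<otimes>\<^bsub>G\<^esub> y = y \<otimes>\<^bsub>G\<^esub> x" if "x \<in> carrier G" "y \<in> carrier G" for x y
      using that unfolding car by (auto simp: add.commute simp flip: mult)
    show "\<one>\<^bsub>G\<^esub> \<otimes>\<^bsub>G\<^esub> x = x" if "x \<in> carrier G" for x
      using that unfolding car by (auto simp: assms(1) simp flip: mult one)
    show "\<exists>y\<in>carrier G. y \<otimes>\<^bsub>G\<^esub> x = \<one>\<^bsub>G\<^esub>" if "x \<in> carrier G" for x
    proof -
      obtain a where a: "a \<in> Z" "x = \<pi> a" using \<open>x \<in> carrier G\<close> car by auto
      then have "\<pi> (- a) \<otimes>\<^bsub>G\<^esub> x = \<one>\<^bsub>G\<^esub>"
        using mult[OF Zm[OF a(1)] a(1)] one by simp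
      then show ?thesis using car Zm a by blast
    qed
  qed
  then show ?thesis
    using assms by (auto simp: presents_def)
qed

lemma subgroup_image_presents:
  assumes p: "presents Z N \<pi> G" and N': "N' \<subseteq> Z" "0 \<in> N'" "\<And>x y. x \<in> N' \<Longrightarrow> y \<in> N' \<Longrightarrow> x - y \<in> N'"
  shows "subgroup (\<pi> ` N') G"
proof -
  interpret G: comm_group G
    using p by (rule presentsD)
  show ?thesis
  proof (rule G.subgroupI)
    show "\<pi> ` N' \<subseteq> carrier G" using presentsD(7)[OF p] N' by auto
    show "\<pi> ` N' \<noteq> {}" using N' by auto
    have m: "- x \<in> N'" if "x \<in> N'" for x using N'(3)[OF N'(2) that] by simp
    show "inv\<^bsub>G\<^esub> a \<in> \<pi> ` N'" if "a \<in> \<pi> ` N'" for a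
      using that presentsD(10)[OF p] m N'(1) by (metis image_iff subsetD)
    show "a \<otimes>\<^bsub>G\<^esub> b \<in> \<pi> ` N'" if ab: "a \<in> \<pi> ` N'" "b \<in> \<pi> ` N'" for a b
    proof -
      obtain x y where xy: "x \<in> N'" "y \<in> N'" "a = \<pi> x" "b = \<pi> y" using ab by blast
      then have "a \<otimes>\<^bsub>G\<^esub> b = \<pi> (x + y)" using presentsD(8)[OF p] N'(1) by (simp add: subset_iff)
      moreover have "x + y \<in> N'" using N'(3)[OF xy(1) m[OF xy(2)]] by simp
      ultimately show ?thesis by blast
    qed
  qed
qed

text \<open>An \<open>N'\<close> containing the kernel \<open>N\<close> is the full preimage of its
  image, so passing to the quotient only enlarges the kernel, while \<open>Z\<close> stays. Iterated
  quotients are thus handled without cosets of cosets.\<close>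

lemma presents_Mod:
  assumes p: "presents Z N \<pi> G" and NN': "N \<subseteq> N'"
    and N': "N' \<subseteq> Z" "0 \<in> N'" "\<And>x y. x \<in> N' \<Longrightarrow> y \<in> N' \<Longrightarrow> x - y \<in> N'"
  shows "presents Z N' (\<lambda>x. \<pi> ` N' #>\<^bsub>G\<^esub> \<pi> x) (G Mod \<pi> ` N')"
proof -
  interpret G: comm_group G
    using p by (rule presentsD)
  have sub: "subgroup (\<pi> ` N') G"
    by (rule subgroup_image_presents[OF p N'])
  interpret K: normal "\<pi> ` N'" G
    by (rule G.subgroup_imp_normal[OF sub])
  show ?thesis
  proof (rule presentsI)
    show "(\<lambda>x. \<pi> ` N' #>\<^bsub>G\<^esub> \<pi> x) ` Z = carrier (G Mod \<pi> ` N')"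
      unfolding carrier_FactGroup presentsD(6)[OF p, symmetric] by auto
    show "\<pi> ` N' #>\<^bsub>G\<^esub> \<pi> (x + y) =
        (\<pi> ` N' #>\<^bsub>G\<^esub> \<pi> x) \<otimes>\<^bsub>G Mod \<pi> ` N'\<^esub> (\<pi> ` N' #>\<^bsub>G\<^esub> \<pi> y)" if "x \<in> Z" "y \<in> Z" for x y
      by (simp add: presentsD[OF p] K.rcos_sum that)
    show "\<pi> ` N' #>\<^bsub>G\<^esub> \<pi> 0 = \<one>\<^bsub>G Mod \<pi> ` N'\<^esub>"
      by (simp add: presentsD[OF p] G.coset_join2 sub K.subset)
    show "x \<in> N' \<longleftrightarrow> x \<in> Z \<and> \<pi> ` N' #>\<^bsub>G\<^esub> \<pi> x = \<one>\<^bsub>G Mod \<pi> ` N'\<^esub>" for x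
    proof
      assume "x \<in> N'"
      then show "x \<in> Z \<and> \<pi> ` N' #>\<^bsub>G\<^esub> \<pi> x = \<one>\<^bsub>G Mod \<pi> ` N'\<^esub>"
        using G.coset_join2[OF _ sub, of "\<pi> x"] presentsD(7)[OF p] N'(1) by auto
    next
      assume x: "x \<in> Z \<and> \<pi> ` N' #>\<^bsub>G\<^esub> \<pi> x = \<one>\<^bsub>G Mod \<pi> ` N'\<^esub>"
      then have "\<pi> x \<in> \<pi> ` N'"
        using G.coset_join1[OF _ _ sub, of "\<pi> x"] presentsD(7)[OF p] by auto
      then obtain y where y: "y \<in> N'" "\<pi> x = \<pi> y" by auto
      then have "x - y \<in> N'" using presentsD(14)[OF p] x N'(1) NN' by blast
      then show "x \<in> N'" using N'(3)[of "x - y" "- y"] N'(3)[OF N'(2) y(1)] by simp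
    qed
  qed (use presentsD(2,3)[OF p] in auto)
qed

text \<open>The kernel of \<open>d\<close> pulls back to the relative cycles: the boundary of a
  representative has to land in \<open>N'\<close>, not to vanish. That \<open>bd\<close> maps
  \<open>N\<close> into \<open>N'\<close> follows because \<open>\<rho> (bd x)\<close> depends only
  on \<open>\<pi> x\<close>.\<close>

lemma presents_kernel:
  assumes p: "presents Z N \<pi> G" and q: "presents Z' N' \<rho> H"
    and bd: "\<And>x. x \<in> Z \<Longrightarrow> bd x \<in> Z'" "\<And>x. x \<in> Z \<Longrightarrow> d (\<pi> x) = \<rho> (bd x)"
    and add: "\<And>x y. x \<in> Z \<Longrightarrow> y \<in> Z \<Longrightarrow> bd (x - y) = bd x - bd y"
  shows "presents {x \<in> Z. bd x \<in> N'} N \<pi> (G\<lparr>carrier := kernel G H d\<rparr>)"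
proof -
  have 0: "bd 0 = 0" using add[of 0 0] presentsD(2)[OF p] by simp
  have N'd: "x - y \<in> N'" if "x \<in> N'" "y \<in> N'" for x y
    using presentsD(13,14,12,9)[OF q] that
    by (metis (no_types, opaque_lifting) subsetD)
  have N'0: "0 \<in> N'"
    using presentsD(2,9,12)[OF q] by blast
  show ?thesis
  proof (rule presentsI)
    show "\<pi> ` {x \<in> Z. bd x \<in> N'} = carrier (G\<lparr>carrier := kernel G H d\<rparr>)"
    proof -
      have "\<pi> x \<in> kernel G H d \<longleftrightarrow> bd x \<in> N'" if "x \<in> Z" for x
        using presentsD(7)[OF p that] presentsD(12)[OF q bd(1)[OF that]] bd(2)[OF that]
        by (simp add: kernel_def)
      moreover have "kernel G H d \<subseteq> \<pi> ` Z"
        unfolding presentsD(6)[OF p] by (auto simp: kernel_def)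
      ultimately show ?thesis by auto
    qed
    show "x \<in> N \<longleftrightarrow> x \<in> {x \<in> Z. bd x \<in> N'} \<and> \<pi> x = \<one>\<^bsub>G\<lparr>carrier := kernel G H d\<rparr>\<^esub>" for x
    proof -
      have "bd x \<in> N'" if "x \<in> N"
      proof -
        have "x \<in> Z" using presentsD(13)[OF p] that by blast
        then have "\<pi> x = \<pi> 0" using presentsD(9,12)[OF p] that by auto
        then have "\<rho> (bd x) = \<rho> (bd 0)" using bd(2) \<open>x \<in> Z\<close> presentsD(2)[OF p] by metis
        then show ?thesis
          using presentsD(9,12)[OF q] bd(1) \<open>x \<in> Z\<close> 0 by metis
      qed
      then show ?thesis using presentsD(12,13)[OF p] by auto
    qed
    show "x - y \<in> {x \<in> Z. bd x \<in> N'}" if "x \<in> {x \<in> Z. bd x \<in> N'}" "y \<in> {x \<in> Z. bd x \<in> N'}" for x y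
      using that add presentsD(3)[OF p] N'd by simp
  qed (use presentsD[OF p] N'0 0 in auto)
qed

text \<open>Here a statement on groups turns into one on chains. For a map induced by an inclusion
  of chain groups, injectivity means that an element of \<open>Z'\<close> trivial in
  \<open>Z\<close> is already trivial, and surjectivity that every element of \<open>Z\<close> is
  congruent modulo \<open>N\<close> to one of \<open>Z'\<close>.\<close>

lemma presents_iso:
  assumes p: "presents Z N \<pi> G" and q: "presents Z' N' \<rho> H"
    and "Z' \<subseteq> Z" and f: "\<And>x. x \<in> Z' \<Longrightarrow> f (\<rho> x) = \<pi> x"
    and inj: "N \<inter> Z' \<subseteq> N'" and surj: "\<And>x. x \<in> Z \<Longrightarrow> \<exists>y\<in>Z'. x - y \<in> N"
  shows "f \<in> iso H G"
proof -
  interpret G: comm_group G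
    using p by (rule presentsD)
  interpret H: comm_group H
    using q by (rule presentsD)
  have car: "h \<in> carrier H \<longleftrightarrow> (\<exists>x\<in>Z'. h = \<rho> x)" for h
    using presentsD(6)[OF q] by auto
  have hom: "f \<in> hom H G"
    by (rule homI) (use presentsD(7,8)[OF p] \<open>Z' \<subseteq> Z\<close> f presentsD(5,8)[OF q]
        in \<open>auto simp: car subset_iff simp flip: presentsD(8)[OF q]\<close>)
  have "inj_on f (carrier H)"
  proof (rule inj_onI)
    fix g h assume gh: "g \<in> carrier H" "h \<in> carrier H" "f g = f h"
    then obtain x y where xy: "x \<in> Z'" "y \<in> Z'" "g = \<rho> x" "h = \<rho> y" using car by auto
    then have "x - y \<in> N" using presentsD(14)[OF p] gh f \<open>Z' \<subseteq> Z\<close> by (metis subsetD)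
    then show "g = h"
      using inj presentsD(3,14)[OF q] xy by blast
  qed
  moreover have "f ` carrier H = carrier G"
  proof
    show "f ` carrier H \<subseteq> carrier G" using hom by (auto simp: hom_def)
    show "carrier G \<subseteq> f ` carrier H"
    proof
      fix g assume "g \<in> carrier G"
      then obtain x where x: "x \<in> Z" "g = \<pi> x" using presentsD(6)[OF p] by auto
      then obtain y where y: "y \<in> Z'" "x - y \<in> N" using surj by blast
      then have "\<pi> x = \<pi> y" using presentsD(14)[OF p] x(1) \<open>Z' \<subseteq> Z\<close> by blast
      then show "g \<in> f ` carrier H" using f y(1) x(2) car by (metis imageI)
    qed
  qed
  ultimately show ?thesis
    using hom by (simp add: iso_def bij_betw_def)
qed

text \<open>From a complex to its quotients only the kernels \<open>N\<close> and the projections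
  \<open>\<pi>\<close> change; \<open>Z\<close> and \<open>bd\<close> stay fixed. In degree 0 the
  truncated \<open>n - 1\<close> is 0, which fits the convention that \<open>bdry C 0\<close> is an
  endomorphism.\<close>

definition cx_presents ::
    "(nat \<Rightarrow> 'x::ab_group_add set) \<Rightarrow> (nat \<Rightarrow> 'x set) \<Rightarrow> (nat \<Rightarrow> 'x \<Rightarrow> 'x) \<Rightarrow> (nat \<Rightarrow> 'x \<Rightarrow> 'c) \<Rightarrow>
     'c chain_cx \<Rightarrow> bool" where
  "cx_presents Z N bd \<pi> C \<longleftrightarrow>
     (\<forall>n. presents (Z n) (N n) (\<pi> n) (grp C n) \<and>
       (\<forall>x\<in>Z n. bd n x \<in> Z (n - 1) \<and> bdry C n (\<pi> n x) = \<pi> (n - 1) (bd n x)) \<and>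
       (\<forall>x\<in>Z n. \<forall>y\<in>Z n. bd n (x - y) = bd n x - bd n y))"

lemma cx_presentsD:
  assumes "cx_presents Z N bd \<pi> C"
  shows "presents (Z n) (N n) (\<pi> n) (grp C n)"
    "\<And>x. x \<in> Z n \<Longrightarrow> bd n x \<in> Z (n - 1)"
    "\<And>x. x \<in> Z n \<Longrightarrow> bdry C n (\<pi> n x) = \<pi> (n - 1) (bd n x)"
    "\<And>x y. x \<in> Z n \<Longrightarrow> y \<in> Z n \<Longrightarrow> bd n (x - y) = bd n x - bd n y"
  using assms by (auto simp: cx_presents_def)

text \<open>In additive notation the set product defining \<open>quot_map\<close> is
  \<open>L + g K + g x\<close>, which collapses to \<open>L + g x\<close> because \<open>g\<close>
  sends \<open>K\<close> into the subgroup \<open>L\<close>.\<close>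

lemma quot_map_coset:
  assumes p: "presents Z N \<pi> G" and q: "presents Z' N' \<rho> H"
    and K: "K \<subseteq> Z" "0 \<in> K"
    and L: "L \<subseteq> Z'" "0 \<in> L" "\<And>x y. x \<in> L \<Longrightarrow> y \<in> L \<Longrightarrow> x - y \<in> L"
    and g: "\<And>x. x \<in> Z \<Longrightarrow> g x \<in> Z'" "\<And>x. x \<in> K \<Longrightarrow> g x \<in> L"
      "\<And>x y. x \<in> Z \<Longrightarrow> y \<in> Z \<Longrightarrow> g (x - y) = g x - g y"
    and f: "\<And>x. x \<in> Z \<Longrightarrow> f (\<pi> x) = \<rho> (g x)" and x: "x \<in> Z"
  shows "quot_map H (\<rho> ` L) f (\<pi> ` K #>\<^bsub>G\<^esub> \<pi> x) = \<rho> ` L #>\<^bsub>H\<^esub> \<rho> (g x)"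
proof -
  have g0: "g 0 = 0" using g(3)[of 0 0] presentsD(2)[OF p] by simp
  have gm: "g (- y) = - g y" if "y \<in> Z" for y
    using g(3)[of 0 y] g0 presentsD(2)[OF p] that by simp
  have gp: "g (y + z) = g y + g z" if "y \<in> Z" "z \<in> Z" for y z
    using g(3)[of y "- z"] gm presentsD(4)[OF p] that by simp
  have Lm: "- y \<in> L" if "y \<in> L" for y using L(3)[OF L(2) that] by simp
  have Lp: "y + z \<in> L" if "y \<in> L" "z \<in> L" for y z using L(3)[OF that(1) Lm[OF that(2)]] by simp
  have 1: "f (\<pi> k \<otimes>\<^bsub>G\<^esub> \<pi> x) = \<rho> (g k + g x)" if "k \<in> K" for k
    using presentsD(5,8)[OF p, of k x] f[of "k + x"] gp[of k x] K(1) x that by (metis subsetD)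
  have 2: "\<rho> l \<otimes>\<^bsub>H\<^esub> \<rho> (g k + g x) = \<rho> (l + g k) \<otimes>\<^bsub>H\<^esub> \<rho> (g x)" if "k \<in> K" "l \<in> L" for k l
  proof -
    have *: "l \<in> Z'" "g k \<in> Z'" "g x \<in> Z'" using that L(1) K(1) g(1) x by auto
    then have "\<rho> l \<otimes>\<^bsub>H\<^esub> \<rho> (g k + g x) = \<rho> ((l + g k) + g x)"
      using presentsD(5,8)[OF q] by (simp add: add.assoc)
    then show ?thesis using presentsD(5,8)[OF q] * by simp
  qed
  have "quot_map H (\<rho> ` L) f (\<pi> ` K #>\<^bsub>G\<^esub> \<pi> x) = {\<rho> l \<otimes>\<^bsub>H\<^esub> f (\<pi> k \<otimes>\<^bsub>G\<^esub> \<pi> x) |k l. k \<in> K \<and> l \<in> L}"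
    by (fastforce simp: quot_map_def r_coset_def set_mult_def)
  also have "\<dots> = {\<rho> (l + g k) \<otimes>\<^bsub>H\<^esub> \<rho> (g x) |k l. k \<in> K \<and> l \<in> L}"
    using 1 2 by (intro Collect_cong) metis
  also have "\<dots> = {\<rho> l \<otimes>\<^bsub>H\<^esub> \<rho> (g x) |l. l \<in> L}"
  proof -
    have "\<exists>k l'. l = l' + g k \<and> k \<in> K \<and> l' \<in> L" if "l \<in> L" for l
      using that K(2) g0 by (intro exI[of _ 0] exI[of _ l]) simp
    then show ?thesis using Lp g(2) by blast
  qed
  also have "\<dots> = \<rho> ` L #>\<^bsub>H\<^esub> \<rho> (g x)"
    by (auto simp: r_coset_def)
  finally show ?thesis .
qed

text \<open>Only the kernel grows, from \<open>N\<close> to \<open>N'\<close>. Simplicial chains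
  need this once, for the subspace; cubical chains need it twice, for the degenerate cubes and then
  for the subspace.\<close>

lemma cx_presents_quot:
  assumes C: "cx_presents Z N bd \<pi> C"
    and N': "\<And>n. N n \<subseteq> N' n" "\<And>n. N' n \<subseteq> Z n" "\<And>n. 0 \<in> N' n"
      "\<And>n x y. x \<in> N' n \<Longrightarrow> y \<in> N' n \<Longrightarrow> x - y \<in> N' n"
      "\<And>n x. x \<in> N' n \<Longrightarrow> bd n x \<in> N' (n - 1)"
    and S: "S = (\<lambda>n. \<pi> n ` N' n)"
  shows "cx_presents Z N' bd (\<lambda>n x. S n #>\<^bsub>grp C n\<^esub> \<pi> n x) (quot_cx C S)"
  unfolding cx_presents_def S
proof (intro allI conjI ballI)
  fix n
  show "presents (Z n) (N' n) (\<lambda>x. \<pi> n ` N' n #>\<^bsub>grp C n\<^esub> \<pi> n x) (grp (quot_cx C (\<lambda>n. \<pi> n ` N' n)) n)"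
    using presents_Mod[OF cx_presentsD(1)[OF C] N'(1-4)] by (simp add: quot_cx_def)
  fix x assume x: "x \<in> Z n"
  show "bdry (quot_cx C (\<lambda>n. \<pi> n ` N' n)) n (\<pi> n ` N' n #>\<^bsub>grp C n\<^esub> \<pi> n x) =
      \<pi> (n - 1) ` N' (n - 1) #>\<^bsub>grp C (n - 1)\<^esub> \<pi> (n - 1) (bd n x)"
    using quot_map_coset[where f = "bdry C n", OF cx_presentsD(1)[OF C] cx_presentsD(1)[OF C]
        N'(2) N'(3) N'(2) N'(3) N'(4) cx_presentsD(2)[OF C] N'(5) cx_presentsD(4)[OF C]
        cx_presentsD(3)[OF C] x]
    by (simp add: quot_cx_def)
qed (use cx_presentsD[OF C] in auto)

section \<open>Relative cycles, relative boundaries and homology\<close>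

lemma presents_cycle_group:
  assumes "cx_presents Z N bd \<pi> C"
  shows "presents {x \<in> Z n. bd n x \<in> N (n - 1)} (N n) (\<pi> n) (cycle_group n C)"
  unfolding cycle_group_def
  by (rule presents_kernel[OF cx_presentsD(1)[OF assms] cx_presentsD(1)[OF assms] cx_presentsD(2)[OF assms]
      cx_presentsD(3)[OF assms] cx_presentsD(4)[OF assms]])

text \<open>The relative boundaries. Allowing an error in \<open>N\<close> makes this set contain
  the kernel, as \<open>presents_Mod\<close> requires.\<close>

definition bounding_chains :: "(nat \<Rightarrow> 'x::ab_group_add set) \<Rightarrow> (nat \<Rightarrow> 'x set) \<Rightarrow> (nat \<Rightarrow> 'x \<Rightarrow> 'x) \<Rightarrow> nat \<Rightarrow> 'x set" where
  "bounding_chains Z N bd n = {x \<in> Z n. \<exists>e\<in>Z (Suc n). x - bd (Suc n) e \<in> N n}"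

lemma bounding_chains_subgroup:
  assumes C: "cx_presents Z N bd \<pi> C"
  shows "0 \<in> bounding_chains Z N bd n" "N n \<subseteq> bounding_chains Z N bd n"
    "x \<in> bounding_chains Z N bd n \<Longrightarrow> y \<in> bounding_chains Z N bd n \<Longrightarrow> x - y \<in> bounding_chains Z N bd n"
proof -
  note p = presentsD[OF cx_presentsD(1)[OF C]]
  have bd0: "bd m 0 = 0" for m
    using cx_presentsD(4)[OF C, of 0 m 0] p(2) by simp
  have N0: "0 \<in> N n" using p(2,9,12) by blast
  have Nd: "a - b \<in> N n" if "a \<in> N n" "b \<in> N n" for a b
    using p(13,14,12,9) that by (metis (no_types, opaque_lifting) subsetD)
  show N: "N n \<subseteq> bounding_chains Z N bd n"
    using p(2,13) bd0 unfolding bounding_chains_def by (smt (verit) diff_0_right mem_Collect_eq subsetD subsetI)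
  show "0 \<in> bounding_chains Z N bd n" using N N0 by blast
  show "x - y \<in> bounding_chains Z N bd n" if xy: "x \<in> bounding_chains Z N bd n" "y \<in> bounding_chains Z N bd n"
  proof -
    obtain e e' where e: "e \<in> Z (Suc n)" "x - bd (Suc n) e \<in> N n" "e' \<in> Z (Suc n)" "y - bd (Suc n) e' \<in> N n"
      using xy by (auto simp: bounding_chains_def)
    have eq: "(x - y) - bd (Suc n) (e - e') = (x - bd (Suc n) e) - (y - bd (Suc n) e')"
      by (simp add: cx_presentsD(4)[OF C] e)
    have "(x - y) - bd (Suc n) (e - e') \<in> N n" using Nd[OF e(2,4)] unfolding eq .
    then show ?thesis
      using xy p(3) e(1,3) unfolding bounding_chains_def by blast
  qed
qed

lemma boundaries_eq_bounding_chains: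
  assumes C: "cx_presents Z N bd \<pi> C"
  shows "boundaries n C = \<pi> n ` bounding_chains Z N bd n"
proof -
  note p = presentsD[OF cx_presentsD(1)[OF C]]
  have "boundaries n C = (\<lambda>e. \<pi> n (bd (Suc n) e)) ` Z (Suc n)"
    using cx_presentsD(3)[OF C, of _ "Suc n"] by (force simp: boundaries_def simp flip: p(6))
  also have "\<dots> = \<pi> n ` bounding_chains Z N bd n"
  proof -
    have "\<pi> n x = \<pi> n (bd (Suc n) e)" if "x \<in> Z n" "e \<in> Z (Suc n)" "x - bd (Suc n) e \<in> N n" for x e
      using p(14) cx_presentsD(2)[OF C, of e "Suc n"] that by simp
    moreover have "bd (Suc n) e \<in> bounding_chains Z N bd n" if "e \<in> Z (Suc n)" for e
    proof -
      have "0 \<in> N n" using p(2,9,12) by blast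
      then show ?thesis
        using that cx_presentsD(2)[OF C, of e "Suc n"] unfolding bounding_chains_def
        by (metis (mono_tags, lifting) One_nat_def cancel_comm_monoid_add_class.diff_cancel
            diff_Suc_1 mem_Collect_eq)
    qed
    ultimately show ?thesis unfolding bounding_chains_def by blast
  qed
  finally show ?thesis .
qed

text \<open>Relative boundaries are relative cycles because \<open>bd (bd e)\<close> is zero on
  chains and \<open>bd\<close> sends \<open>N\<close> into \<open>N\<close>; homology is then one
  more quotient.\<close>

lemma presents_homology:
  assumes C: "cx_presents Z N bd \<pi> C"
    and bdbd: "\<And>n x. x \<in> Z (Suc n) \<Longrightarrow> bd n (bd (Suc n) x) = 0"
  shows "bounding_chains Z N bd n \<subseteq> {x \<in> Z n. bd n x \<in> N (n - 1)}"
    and "presents {x \<in> Z n. bd n x \<in> N (n - 1)} (bounding_chains Z N bd n)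
          (\<lambda>x. boundaries n C #>\<^bsub>cycle_group n C\<^esub> \<pi> n x) (homology n C)"
proof -
  note p = presentsD[OF cx_presentsD(1)[OF C]]
  show *: "bounding_chains Z N bd n \<subseteq> {x \<in> Z n. bd n x \<in> N (n - 1)}"
  proof -
    have bdN: "bd n a \<in> N (n - 1)" if "a \<in> N n" for a
      using presentsD(13)[OF presents_cycle_group[OF C]] that by blast
    have "bd n x \<in> N (n - 1)" if "x \<in> Z n" "e \<in> Z (Suc n)" "x - bd (Suc n) e \<in> N n" for x e
    proof -
      have "bd n (x - bd (Suc n) e) = bd n x"
        using cx_presentsD(4)[OF C, of x n] cx_presentsD(2)[OF C, of e "Suc n"] bdbd that by simp
      then show ?thesis using bdN[OF that(3)] by simp
    qed
    then show ?thesis by (auto simp: bounding_chains_def)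
  qed
  show "presents {x \<in> Z n. bd n x \<in> N (n - 1)} (bounding_chains Z N bd n)
          (\<lambda>x. boundaries n C #>\<^bsub>cycle_group n C\<^esub> \<pi> n x) (homology n C)"
    unfolding homology_def boundaries_eq_bounding_chains[OF C]
    by (rule presents_Mod[OF presents_cycle_group[OF C] bounding_chains_subgroup(2)[OF C] * bounding_chains_subgroup(1)[OF C]
          bounding_chains_subgroup(3)[OF C]])
qed

text \<open>Both complexes share the boundary \<open>bd\<close>, so all that remains are the
  conditions \<open>inj\<close> and \<open>surj\<close> on chains: a relative cycle of
  \<open>Z'\<close> that bounds in \<open>Z\<close> bounds in \<open>Z'\<close>, and every relative
  cycle of \<open>Z\<close> can be moved into \<open>Z'\<close>.\<close>

lemma homology_map_iso:
  assumes C: "cx_presents Z N bd \<pi> C" and C': "cx_presents Z' N' bd \<pi>' C'"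
    and sub: "\<And>n. Z' n \<subseteq> Z n" "\<And>n. N' n \<subseteq> N n"
    and bdbd: "\<And>n x. x \<in> Z (Suc n) \<Longrightarrow> bd n (bd (Suc n) x) = 0"
    and f: "\<And>x. x \<in> Z' n \<Longrightarrow> f (\<pi>' n x) = \<pi> n x"
    and inj: "\<And>x e. x \<in> Z' n \<Longrightarrow> bd n x \<in> N' (n - 1) \<Longrightarrow> e \<in> Z (Suc n) \<Longrightarrow> x - bd (Suc n) e \<in> N n
      \<Longrightarrow> \<exists>e'\<in>Z' (Suc n). x - bd (Suc n) e' \<in> N' n"
    and surj: "\<And>x. x \<in> Z n \<Longrightarrow> bd n x \<in> N (n - 1)
      \<Longrightarrow> \<exists>y\<in>Z' n. bd n y \<in> N' (n - 1) \<and> (\<exists>e\<in>Z (Suc n). x - y - bd (Suc n) e \<in> N n)"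
  shows "homology_map n C f \<in> iso (homology n C') (homology n C)"
proof -
  have bdbd': "bd m (bd (Suc m) x) = 0" if "x \<in> Z' (Suc m)" for m x
    using bdbd sub(1) that by blast
  note h = presents_homology[where n = n, OF C bdbd] and h' = presents_homology[where n = n, OF C' bdbd']
  note c = presents_cycle_group[where n = n, OF C] and c' = presents_cycle_group[where n = n, OF C']
  have cyc: "{x \<in> Z' n. bd n x \<in> N' (n - 1)} \<subseteq> {x \<in> Z n. bd n x \<in> N (n - 1)}"
    using sub by blast
  have bnd: "bounding_chains Z' N' bd n \<subseteq> bounding_chains Z N bd n"
    unfolding bounding_chains_def using sub by blast
  show ?thesis
  proof (rule presents_iso[OF h(2) h'(2) cyc])
    fix x assume x: "x \<in> {x \<in> Z' n. bd n x \<in> N' (n - 1)}"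
    have "quot_map (cycle_group n C) (\<pi> n ` bounding_chains Z N bd n) f
        (\<pi>' n ` bounding_chains Z' N' bd n #>\<^bsub>cycle_group n C'\<^esub> \<pi>' n x) =
        \<pi> n ` bounding_chains Z N bd n #>\<^bsub>cycle_group n C\<^esub> \<pi> n x"
      by (rule quot_map_coset[where g = "\<lambda>x. x", OF c' c h'(1) bounding_chains_subgroup(1)[OF C']
            h(1) bounding_chains_subgroup(1)[OF C] bounding_chains_subgroup(3)[OF C]])
        (use x cyc bnd f in auto)
    then show "homology_map n C f (boundaries n C' #>\<^bsub>cycle_group n C'\<^esub> \<pi>' n x)
        = boundaries n C #>\<^bsub>cycle_group n C\<^esub> \<pi> n x"
      by (simp add: homology_map_def boundaries_eq_bounding_chains[OF C] boundaries_eq_bounding_chains[OF C'])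
  next
    show "bounding_chains Z N bd n \<inter> {x \<in> Z' n. bd n x \<in> N' (n - 1)} \<subseteq> bounding_chains Z' N' bd n"
      using inj by (auto simp: bounding_chains_def)
  next
    fix x assume x: "x \<in> {x \<in> Z n. bd n x \<in> N (n - 1)}"
    then obtain y e where y: "y \<in> Z' n" "bd n y \<in> N' (n - 1)" "e \<in> Z (Suc n)" "x - y - bd (Suc n) e \<in> N n"
      using surj by blast
    then have "x - y \<in> bounding_chains Z N bd n"
      unfolding bounding_chains_def using x sub presentsD(3)[OF cx_presentsD(1)[OF C]] by blast
    then show "\<exists>y\<in>{x \<in> Z' n. bd n x \<in> N' (n - 1)}. x - y \<in> bounding_chains Z N bd n"
      using y by blast
  qed
qed

section \<open>Excision for chains on cells\<close>

text \<open>The carrier of the free abelian group on \<open>U\<close>, placed in one type for all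
  \<open>U\<close>, so that inclusions of chain groups are inclusions of sets.\<close>

definition frags :: "'b set \<Rightarrow> ('b \<Rightarrow>\<^sub>0 int) set" where
  "frags U = {c. Poly_Mapping.keys c \<subseteq> U}"

lemma frags_0 [simp]: "0 \<in> frags U"
  by (simp add: frags_def)

lemma frags_diff: "c \<in> frags U \<Longrightarrow> c' \<in> frags U \<Longrightarrow> c - c' \<in> frags U"
  using keys_diff[of c c'] by (auto simp: frags_def)

lemma frags_add: "c \<in> frags U \<Longrightarrow> c' \<in> frags U \<Longrightarrow> c + c' \<in> frags U"
  using Poly_Mapping.keys_add[of c c'] by (auto simp: frags_def)

lemma frags_minus: "c \<in> frags U \<Longrightarrow> - c \<in> frags U"
  by (simp add: frags_def)

lemma frags_cmul: "c \<in> frags U \<Longrightarrow> frag_cmul k c \<in> frags U"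
  using keys_cmul[of k c] by (auto simp: frags_def)

lemma frags_sum: "(\<And>i. i \<in> I \<Longrightarrow> f i \<in> frags U) \<Longrightarrow> sum f I \<in> frags U"
  using keys_sum[of f I] by (fastforce simp: frags_def)

lemma frags_frag_of [simp]: "frag_of x \<in> frags U \<longleftrightarrow> x \<in> U"
  by (simp add: frags_def)

lemma frags_mono: "c \<in> frags U \<Longrightarrow> U \<subseteq> V \<Longrightarrow> c \<in> frags V"
  by (auto simp: frags_def)

lemma frags_Int: "c \<in> frags (U \<inter> V) \<longleftrightarrow> c \<in> frags U \<and> c \<in> frags V"
  by (auto simp: frags_def)

lemma frags_frag_extend:
  "c \<in> frags U \<Longrightarrow> (\<And>x. x \<in> U \<Longrightarrow> f x \<in> frags V) \<Longrightarrow> frag_extend f c \<in> frags V"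
  using keys_frag_extend[of f c] by (fastforce simp: frags_def)

lemma frags_induct [consumes 1, case_names zero one diff]:
  assumes "c \<in> frags U" "P 0" "\<And>x. x \<in> U \<Longrightarrow> P (frag_of x)" "\<And>a b. P a \<Longrightarrow> P b \<Longrightarrow> P (a - b)"
  shows "P c"
  using frag_induction[of c U P] assms by (simp add: frags_def)

text \<open>The splitting is a difference because the additivity of all operators is recorded for
  differences.\<close>

lemma frags_Un_split:
  assumes "c \<in> frags (U \<union> V)"
  obtains a b where "a \<in> frags U" "b \<in> frags V" "c = a - b"
proof -
  obtain d e where "Poly_Mapping.keys d \<subseteq> U" "Poly_Mapping.keys e \<subseteq> V" "d + e = c"
    using assms frag_split[of c U V] by (auto simp: frags_def)
  then show ?thesis
    using that[of d "- e"] by (simp add: frags_def)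
qed

text \<open>The map \<open>s\<close> is a chain map and \<open>t\<close> a homotopy between it and
  the identity, up to an error in \<open>D\<close>; both respect the families in
  \<open>\<U>\<close>. At \<open>m = 0\<close> the term \<open>t (m - 1) (bd m x)\<close> has the
  wrong degree, but it vanishes when \<open>bd 0\<close> does, since \<open>t\<close> is
  additive.\<close>

definition subdivision ::
    "(nat \<Rightarrow> 'x set) set \<Rightarrow> (nat \<Rightarrow> 'x set) \<Rightarrow> (nat \<Rightarrow> 'x set) \<Rightarrow> (nat \<Rightarrow> ('x \<Rightarrow>\<^sub>0 int) \<Rightarrow> ('x \<Rightarrow>\<^sub>0 int)) \<Rightarrow>
     (nat \<Rightarrow> ('x \<Rightarrow>\<^sub>0 int) \<Rightarrow> ('x \<Rightarrow>\<^sub>0 int)) \<Rightarrow> (nat \<Rightarrow> ('x \<Rightarrow>\<^sub>0 int) \<Rightarrow> ('x \<Rightarrow>\<^sub>0 int)) \<Rightarrow> bool" where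
  "subdivision \<U> S D bd s t \<longleftrightarrow>
     (\<forall>m x y. s m (x - y) = s m x - s m y \<and> t m (x - y) = t m x - t m y) \<and>
     (\<forall>U\<in>\<U>. \<forall>m. \<forall>x\<in>frags (U m). s m x \<in> frags (U m) \<and> t m x \<in> frags (U (Suc m))) \<and>
     (\<forall>m. \<forall>x\<in>frags (S m). bd m (s m x) = s (m - 1) (bd m x) \<and>
       s m x - x - bd (Suc m) (t m x) - t (m - 1) (bd m x) \<in> frags (D m))"

text \<open>\<open>S\<close> stands for the cells of \<open>X\<close>, \<open>A\<close> and
  \<open>B\<close> for those of the two subspaces, \<open>D\<close> for the degenerate ones. The
  subdivision may depend on the chain \<open>c\<close>, since in general no fixed amount of cutting
  makes all cells small.\<close>

locale excisive_cells =
  fixes S A B D :: "nat \<Rightarrow> 'x set" and bd :: "nat \<Rightarrow> ('x \<Rightarrow>\<^sub>0 int) \<Rightarrow> ('x \<Rightarrow>\<^sub>0 int)"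
  assumes sub: "A n \<subseteq> S n" "B n \<subseteq> S n" "D n \<subseteq> S n"
    and bd_diff: "bd n (x - y) = bd n x - bd n y"
    and bd_0: "bd 0 x = 0"
    and bd_frags: "U \<in> {S, A, B, D} \<Longrightarrow> x \<in> frags (U n) \<Longrightarrow> bd n x \<in> frags (U (n - 1))"
    and bd_bd: "x \<in> frags (S (Suc n)) \<Longrightarrow> bd n (bd (Suc n) x) = 0"
    and subdivision: "c \<in> frags (S n) \<Longrightarrow>
      \<exists>s t. subdivision {S, A, B, D} S D bd s t \<and> s n c \<in> frags (A n \<union> B n)"
begin

lemma bd_minus: "bd n (- x) = - bd n x"
  using bd_diff[of n 0 x] bd_diff[of n 0 0] by simp

lemma frags_Un_additive:
  assumes f: "\<And>x y. f (x - y) = f x - f y"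
    and "\<And>x. x \<in> frags U \<Longrightarrow> f x \<in> frags U'" "\<And>x. x \<in> frags V \<Longrightarrow> f x \<in> frags V'"
    and x: "x \<in> frags (U \<union> V)"
  shows "f x \<in> frags (U' \<union> V')"
proof -
  obtain a d where "a \<in> frags U" "d \<in> frags V" "x = a - d"
    using x by (rule frags_Un_split)
  then have "f a \<in> frags U'" "f d \<in> frags V'" "f x = f a - f d"
    using assms by auto
  then show ?thesis
    by (metis Un_upper1 Un_upper2 frags_diff frags_mono)
qed

lemma bd_frags_Un:
  "x \<in> frags (A n \<union> D n) \<Longrightarrow> bd n x \<in> frags (A (n - 1) \<union> D (n - 1))"
  by (rule frags_Un_additive[where U = "A n" and V = "D n"]) (use bd_frags in \<open>auto simp: bd_diff\<close>)

text \<open>For \<open>n = 0\<close> the truncated index \<open>n - 1\<close> would give a chain of the wrong degree.\<close>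

definition homotopy_term :: "(nat \<Rightarrow> ('x \<Rightarrow>\<^sub>0 int) \<Rightarrow> 'y::zero) \<Rightarrow> nat \<Rightarrow> ('x \<Rightarrow>\<^sub>0 int) \<Rightarrow> 'y" where
  "homotopy_term t n x = (if n = 0 then 0 else t (n - 1) x)"

lemma subdivisionD:
  assumes st: "subdivision {S, A, B, D} S D bd s t"
  shows "s m (x - y) = s m x - s m y"
    "U \<in> {S, A, B} \<Longrightarrow> x \<in> frags (U m) \<Longrightarrow> s m x \<in> frags (U m)"
    "U \<in> {S, A, B} \<Longrightarrow> x \<in> frags (U m) \<Longrightarrow> t m x \<in> frags (U (Suc m))"
    "x \<in> frags (A m \<union> D m) \<Longrightarrow> s m x \<in> frags (A m \<union> D m)"
    "x \<in> frags (A (m - 1) \<union> D (m - 1)) \<Longrightarrow> homotopy_term t m x \<in> frags (A m \<union> D m)"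
    "x \<in> frags (B (m - 1)) \<Longrightarrow> homotopy_term t m x \<in> frags (B m)"
    "x \<in> frags (S m) \<Longrightarrow> bd m (s m x) = s (m - 1) (bd m x)"
    "x \<in> frags (S m) \<Longrightarrow> s m x - x - bd (Suc m) (t m x) - homotopy_term t m (bd m x) \<in> frags (D m)"
proof -
  note st' = st[unfolded subdivision_def]
  have diff: "s m (x - y) = s m x - s m y" "t m (x - y) = t m x - t m y" for m x y
    using st' by blast+
  have pres: "s m x \<in> frags (U m)" "t m x \<in> frags (U (Suc m))"
    if "U \<in> {S, A, B, D}" "x \<in> frags (U m)" for U m x
    using st' that by blast+
  have t0: "t m 0 = 0" for m using diff(2)[of m 0 0] by simp
  show "s m (x - y) = s m x - s m y" by (rule diff)
  show "s m x \<in> frags (U m)" "t m x \<in> frags (U (Suc m))" if "U \<in> {S, A, B}" "x \<in> frags (U m)" for U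
    using pres that by auto
  show "s m x \<in> frags (A m \<union> D m)" if x: "x \<in> frags (A m \<union> D m)"
    by (rule frags_Un_additive[OF diff(1) _ _ x]) (use pres in auto)
  show "homotopy_term t m x \<in> frags (A m \<union> D m)" if x: "x \<in> frags (A (m - 1) \<union> D (m - 1))"
  proof (cases m)
    case (Suc k)
    have "t k x \<in> frags (A (Suc k) \<union> D (Suc k))"
      by (rule frags_Un_additive[OF diff(2), where U = "A k" and V = "D k"]) (use pres x Suc in auto)
    then show ?thesis by (simp add: homotopy_term_def Suc)
  qed (simp add: homotopy_term_def)
  show "homotopy_term t m x \<in> frags (B m)" if "x \<in> frags (B (m - 1))"
    using pres(2)[of B x "m - 1"] that by (cases m) (simp_all add: homotopy_term_def)
  show "bd m (s m x) = s (m - 1) (bd m x)" if "x \<in> frags (S m)"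
    using st' that by blast
  show "s m x - x - bd (Suc m) (t m x) - homotopy_term t m (bd m x) \<in> frags (D m)" if "x \<in> frags (S m)"
  proof -
    have "homotopy_term t m (bd m x) = t (m - 1) (bd m x)"
      by (cases m) (simp_all add: homotopy_term_def bd_0 t0)
    then show ?thesis using st' that by simp
  qed
qed

text \<open>The required relative cycle is minus the \<open>B\<close>-part of the subdivided chain.
  Its boundary differs from that of \<open>s n x\<close> by the boundary of the
  \<open>A\<close>-part, and so stays in \<open>A \<union> D\<close> together with
  \<open>bd n x\<close>.\<close>

lemma excision_surj:
  assumes x: "x \<in> frags (S n)" and bdx: "bd n x \<in> frags (A (n - 1) \<union> D (n - 1))"
  shows "\<exists>y\<in>frags (B n). bd n y \<in> frags (B (n - 1) \<inter> (A (n - 1) \<union> D (n - 1))) \<and>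
    (\<exists>e\<in>frags (S (Suc n)). x - y - bd (Suc n) e \<in> frags (A n \<union> D n))"
proof -
  obtain s t where sub_st: "subdivision {S, A, B, D} S D bd s t" and small: "s n x \<in> frags (A n \<union> B n)"
    using subdivision[OF x] by blast
  note st = subdivisionD[OF sub_st]
  obtain a b where ab: "a \<in> frags (A n)" "b \<in> frags (B n)" "s n x = a - b"
    using small by (rule frags_Un_split)
  have "bd n b = bd n a - s (n - 1) (bd n x)"
    using st(7)[OF x] ab(3) by (simp add: bd_diff algebra_simps)
  moreover have "bd n a \<in> frags (A (n - 1) \<union> D (n - 1))"
    by (rule bd_frags_Un) (use ab frags_mono in blast)
  ultimately have "bd n b \<in> frags (B (n - 1) \<inter> (A (n - 1) \<union> D (n - 1)))"
    unfolding frags_Int using st(4)[OF bdx] bd_frags[of B b n] ab(2) by (simp add: frags_diff)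
  then have 1: "bd n (- b) \<in> frags (B (n - 1) \<inter> (A (n - 1) \<union> D (n - 1)))"
    using frags_minus by (simp add: bd_minus)
  \<comment> \<open>Subdividing moves \<open>x\<close> by the boundary of \<open>t n x\<close>, up
    to the homotopy on \<open>bd n x\<close> and an error in \<open>D\<close>. Both are trivial
    relative to \<open>A \<union> D\<close>, as is the \<open>A\<close>-part
    \<open>a\<close>.\<close>
  have "x - (- b) - bd (Suc n) (0 - t n x) =
      a - homotopy_term t n (bd n x) - (s n x - x - bd (Suc n) (t n x) - homotopy_term t n (bd n x))"
    by (simp add: bd_minus ab(3) algebra_simps)
  moreover have "a \<in> frags (A n \<union> D n)"
    "s n x - x - bd (Suc n) (t n x) - homotopy_term t n (bd n x) \<in> frags (A n \<union> D n)"
    using ab(1) st(8)[OF x] frags_mono by blast+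
  ultimately have "x - (- b) - bd (Suc n) (0 - t n x) \<in> frags (A n \<union> D n)"
    using st(5)[OF bdx] frags_diff by metis
  moreover have "0 - t n x \<in> frags (S (Suc n))"
    using st(3)[of S x n] x by (simp add: frags_minus)
  ultimately show ?thesis
    using 1 ab(2) frags_minus by blast
qed

text \<open>If \<open>e\<close> bounds \<open>x\<close> in \<open>X\<close>, then the
  \<open>B\<close>-part of the subdivided \<open>e\<close> bounds \<open>s n x\<close> relative to
  \<open>A\<close>. The homotopy \<open>t n x\<close>, which stays in \<open>B\<close> because
  \<open>x\<close> does, leads back from \<open>s n x\<close> to \<open>x\<close>.\<close>

lemma excision_inj:
  assumes x: "x \<in> frags (B n)" and bdx: "bd n x \<in> frags (B (n - 1) \<inter> (A (n - 1) \<union> D (n - 1)))"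
    and e: "e \<in> frags (S (Suc n))" and xe: "x - bd (Suc n) e \<in> frags (A n \<union> D n)"
  shows "\<exists>e'\<in>frags (B (Suc n)). x - bd (Suc n) e' \<in> frags (B n \<inter> (A n \<union> D n))"
proof -
  obtain s t where sub_st: "subdivision {S, A, B, D} S D bd s t" and small: "s (Suc n) e \<in> frags (A (Suc n) \<union> B (Suc n))"
    using subdivision[OF e] by blast
  note st = subdivisionD[OF sub_st]
  obtain a b where ab: "a \<in> frags (A (Suc n))" "b \<in> frags (B (Suc n))" "s (Suc n) e = a - b"
    using small by (rule frags_Un_split)
  have xS: "x \<in> frags (S n)" using x sub(2) frags_mono by blast
  let ?h = "homotopy_term t n (bd n x)"
  have tB: "t n x \<in> frags (B (Suc n))" using st(3) x by blast
  have bdxA: "bd n x \<in> frags (A (n - 1) \<union> D (n - 1))" using bdx by (simp add: frags_Int)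
  have "bd (Suc n) (- b) = s n (bd (Suc n) e) - bd (Suc n) a"
    using st(7)[OF e] ab(3) by (simp add: bd_diff bd_minus algebra_simps)
  \<comment> \<open>The bounding chain is \<open>- b - t n x\<close>: the first summand accounts for
    \<open>s n x\<close>, the second for the passage to \<open>x\<close>.\<close>
  then have "x - bd (Suc n) (- b - t n x) =
     (s n (x - bd (Suc n) e) + bd (Suc n) a) - (s n x - x - bd (Suc n) (t n x) - ?h) - ?h"
    by (simp add: bd_diff st(1))
  moreover have "bd (Suc n) a \<in> frags (A n \<union> D n)"
    using bd_frags[of A a "Suc n"] ab(1) frags_mono[of _ "A n" "A n \<union> D n"] by auto
  moreover have "s n x - x - bd (Suc n) (t n x) - ?h \<in> frags (A n \<union> D n)"
    using st(8)[OF xS] frags_mono by blast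
  ultimately have "x - bd (Suc n) (- b - t n x) \<in> frags (A n \<union> D n)"
    using st(4)[OF xe] st(5)[OF bdxA] by (metis frags_add frags_diff)
  moreover have bt: "- b - t n x \<in> frags (B (Suc n))"
    using ab(2) tB frags_diff frags_minus by blast
  moreover have "x - bd (Suc n) (- b - t n x) \<in> frags (B n)"
    using bd_frags[of B _ "Suc n"] bt x frags_diff by fastforce
  ultimately show ?thesis
    by (auto simp: frags_Int)
qed

text \<open>The kernel for the pair \<open>(B, A \<inter> B)\<close> is cut out of
  \<open>frags (B n)\<close> by the kernel for \<open>(X, A)\<close>, which is the situation of
  \<open>excision_surj\<close> and \<open>excision_inj\<close>.\<close>

proposition homology_map_iso_excisive:
  assumes C: "cx_presents (\<lambda>n. frags (S n)) (\<lambda>n. frags (A n \<union> D n)) bd \<pi> C"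
    and C': "cx_presents (\<lambda>n. frags (B n)) (\<lambda>n. frags (B n \<inter> (A n \<union> D n))) bd \<pi>' C'"
    and f: "\<And>x. x \<in> frags (B n) \<Longrightarrow> f (\<pi>' n x) = \<pi> n x"
  shows "homology_map n C f \<in> iso (homology n C') (homology n C)"
proof (rule homology_map_iso[OF C C'])
  show "frags (B m) \<subseteq> frags (S m)" for m
    using sub(2) frags_mono by blast
  show "frags (B m \<inter> (A m \<union> D m)) \<subseteq> frags (A m \<union> D m)" for m
    unfolding frags_Int subset_iff by blast
qed (fact bd_bd f excision_inj excision_surj)+

end

section \<open>Relative homology in terms of cells\<close>

text \<open>The common form of singular simplices and singular cubes, so that subspaces, composition
  and naturality are treated once.\<close>

definition cells :: "'s clspace \<Rightarrow> 'a clspace \<Rightarrow> ('s \<Rightarrow> 'a) set" where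
  "cells K X = {\<sigma>. cl_continuous K X \<sigma> \<and> \<sigma> \<in> extensional (pts K)}"

abbreviation simplices :: "'s simplex_model \<Rightarrow> 'a clspace \<Rightarrow> nat \<Rightarrow> ('s \<Rightarrow> 'a) set" where
  "simplices \<Delta> X \<equiv> \<lambda>n. cells (simplex \<Delta> n) X"

abbreviation cubes :: "'j clspace \<Rightarrow> 'a clspace \<Rightarrow> nat \<Rightarrow> ((nat \<Rightarrow> 'j) \<Rightarrow> 'a) set" where
  "cubes J X \<equiv> \<lambda>n. cells (cl_power J n) X"

lemma sing_simplices_eq_cells: "sing_simplices \<Delta> n X = simplices \<Delta> X n"
  by (simp add: sing_simplices_def cells_def)

lemma sing_cubes_eq_cells: "sing_cubes J n X = cubes J X n"
  by (simp add: sing_cubes_def cells_def)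

lemma pts_cl_subspace [simp]: "pts (cl_subspace X A) = A"
  by (simp add: cl_subspace_def)

lemma cl_cl_subspace: "cl (cl_subspace X A) B = cl X B \<inter> A"
  by (simp add: cl_subspace_def)

abbreviation small_chains :: "'s clspace \<Rightarrow> 'a clspace \<Rightarrow> 'a set \<Rightarrow> 'a set \<Rightarrow> (('s \<Rightarrow> 'a) \<Rightarrow>\<^sub>0 int) set" where
  "small_chains K X A B \<equiv> frags (cells K (cl_subspace X A) \<union> cells K (cl_subspace X B))"

text \<open>Closures in \<open>K\<close> consist of points of \<open>K\<close>, so a bound on the
  image of a cell also bounds the images of closures.\<close>

lemma cells_subspace:
  assumes "closure_space K" "A \<subseteq> pts X"
  shows "cells K (cl_subspace X A) = {\<sigma> \<in> cells K X. \<sigma> ` pts K \<subseteq> A}"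
proof -
  have "cl_continuous K (cl_subspace X A) \<sigma> \<longleftrightarrow> cl_continuous K X \<sigma> \<and> \<sigma> ` pts K \<subseteq> A" for \<sigma>
  proof -
    have *: "\<sigma> ` cl K B \<subseteq> A" if "\<sigma> ` pts K \<subseteq> A" "B \<subseteq> pts K" for B
    proof -
      have "cl K B \<subseteq> pts K"
        using assms(1) that(2) by (simp add: closure_space_def)
      then show ?thesis using that(1) by blast
    qed
    show ?thesis
    proof
      show "cl_continuous K X \<sigma> \<and> \<sigma> ` pts K \<subseteq> A" if "cl_continuous K (cl_subspace X A) \<sigma>"
        using that assms(2) by (auto simp: cl_continuous_def cl_cl_subspace)
      show "cl_continuous K (cl_subspace X A) \<sigma>" if "cl_continuous K X \<sigma> \<and> \<sigma> ` pts K \<subseteq> A"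
        using that * by (simp add: cl_continuous_def cl_cl_subspace)
    qed
  qed
  then show ?thesis
    by (auto simp: cells_def)
qed

lemma cells_subspace_subspace:
  assumes "closure_space K" "A \<subseteq> pts X" "B \<subseteq> pts X"
  shows "cells K (cl_subspace (cl_subspace X B) (A \<inter> B)) = cells K (cl_subspace X A) \<inter> cells K (cl_subspace X B)"
  using assms by (auto simp: cells_subspace)

text \<open>Cells are extensional and the chains of a subspace lie in the same type, so the chain
  map of an inclusion is literally the identity.\<close>

lemma frag_extend_restrict_id:
  assumes "c \<in> frags (cells K X)"
  shows "frag_extend (\<lambda>\<sigma>. frag_of (restrict ((\<lambda>x. x) \<circ> \<sigma>) (pts K))) c = c"
  using assms
proof (induction rule: frags_induct)
  case (one \<sigma>)
  then have "restrict ((\<lambda>x. x) \<circ> \<sigma>) (pts K) = \<sigma>"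
    by (auto simp: cells_def extensional_def)
  then show ?case by (simp only: frag_extend_of)
qed (simp_all add: frag_extend_diff)

section \<open>Relative simplicial chains\<close>

lemma presents_free_Abelian_group: "presents (frags U) {0} (\<lambda>x. x) (free_Abelian_group U)"
  by (rule presentsI) (auto simp: frags_diff, auto simp: free_Abelian_group_def frags_def)

text \<open>The image under the identity is kept to match the form in which
  \<open>cx_presents_quot\<close> takes a subcomplex: the identity is the projection presenting
  \<open>sing_cx\<close>.\<close>

lemma sing_sub_eq:
  assumes "closure_space (simplex \<Delta> n)" "A \<subseteq> pts X"
  shows "sing_sub \<Delta> X A n = (\<lambda>x. x) ` frags (simplices \<Delta> (cl_subspace X A) n)"
proof -
  have "carrier (grp (sing_cx \<Delta> (cl_subspace X A)) n) = frags (simplices \<Delta> (cl_subspace X A) n)"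
    by (auto simp: sing_cx_def sing_simplices_eq_cells frags_def)
  then show ?thesis
    using frag_extend_restrict_id[of _ "simplex \<Delta> n" "cl_subspace X A"]
    by (auto simp: sing_sub_def sing_chain_map_def)
qed

lemma cx_presents_sing_cx:
  fixes X :: "'a clspace" and \<Delta> :: "'s simplex_model"
  assumes "\<And>n x. x \<in> frags (simplices \<Delta> X n) \<Longrightarrow> sing_bdry \<Delta> n x \<in> frags (simplices \<Delta> X (n - 1))"
    and "\<And>n (x :: ('s \<Rightarrow> 'a) \<Rightarrow>\<^sub>0 int) y. sing_bdry \<Delta> n (x - y) = sing_bdry \<Delta> n x - sing_bdry \<Delta> n y"
  shows "cx_presents (\<lambda>n. frags (simplices \<Delta> X n)) (\<lambda>n. {0}) (sing_bdry \<Delta>) (\<lambda>n x. x) (sing_cx \<Delta> X)"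
  using assms by (auto simp: cx_presents_def sing_cx_def sing_simplices_eq_cells presents_free_Abelian_group)

lemma cx_presents_sing_rel_cx:
  fixes X :: "'a clspace" and \<Delta> :: "'s simplex_model"
  assumes clo: "\<And>n. closure_space (simplex \<Delta> n)" and A: "A \<subseteq> pts X"
    and bd: "\<And>n x. x \<in> frags (simplices \<Delta> X n) \<Longrightarrow> sing_bdry \<Delta> n x \<in> frags (simplices \<Delta> X (n - 1))"
      "\<And>n x. x \<in> frags (simplices \<Delta> (cl_subspace X A) n) \<Longrightarrow>
        sing_bdry \<Delta> n x \<in> frags (simplices \<Delta> (cl_subspace X A) (n - 1))"
      "\<And>n (x :: ('s \<Rightarrow> 'a) \<Rightarrow>\<^sub>0 int) y. sing_bdry \<Delta> n (x - y) = sing_bdry \<Delta> n x - sing_bdry \<Delta> n y"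
  shows "cx_presents (\<lambda>n. frags (simplices \<Delta> X n)) (\<lambda>n. frags (simplices \<Delta> (cl_subspace X A) n))
    (sing_bdry \<Delta>) (\<lambda>n x. sing_sub \<Delta> X A n #>\<^bsub>grp (sing_cx \<Delta> X) n\<^esub> x) (sing_rel_cx \<Delta> X A)"
  unfolding sing_rel_cx_def
proof (rule cx_presents_quot[OF cx_presents_sing_cx[OF bd(1,3)]])
  show "frags (simplices \<Delta> (cl_subspace X A) n) \<subseteq> frags (simplices \<Delta> X n)" for n
    unfolding frags_def by (auto simp: cells_subspace[OF clo A])
  show "sing_sub \<Delta> X A = (\<lambda>n. (\<lambda>x. x) ` frags (simplices \<Delta> (cl_subspace X A) n))"
    using sing_sub_eq[OF clo A] by (rule ext)
qed (use bd frags_diff in auto)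

proposition sing_inclusion_iso_of_excisive:
  fixes X :: "'a clspace" and \<Delta> :: "'s simplex_model"
  assumes clo: "\<And>n. closure_space (simplex \<Delta> n)" and A: "A \<subseteq> pts X" and B: "B \<subseteq> pts X"
    and ex: "excisive_cells (simplices \<Delta> X) (simplices \<Delta> (cl_subspace X A))
      (simplices \<Delta> (cl_subspace X B)) (\<lambda>_. {}) (sing_bdry \<Delta>)"
  shows "sing_inclusion_iso \<Delta> n (cl_subspace X B) (A \<inter> B) X A"
proof -
  let ?XA = "cl_subspace X A" and ?XB = "cl_subspace X B"
  interpret excisive_cells "simplices \<Delta> X" "simplices \<Delta> ?XA"
      "simplices \<Delta> ?XB" "\<lambda>_. {}" "sing_bdry \<Delta>"
    by (rule ex)
  note bdX = bd_frags[OF insertI1] and bdA = bd_frags[OF insertI2[OF insertI1]]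
    and bdB = bd_frags[OF insertI2[OF insertI2[OF insertI1]]]
  note AB = cells_subspace_subspace[OF clo A B]
  have cxX: "cx_presents (\<lambda>n. frags (simplices \<Delta> X n)) (\<lambda>n. frags (simplices \<Delta> ?XA n))
    (sing_bdry \<Delta>) (\<lambda>n x. sing_sub \<Delta> X A n #>\<^bsub>grp (sing_cx \<Delta> X) n\<^esub> x) (sing_rel_cx \<Delta> X A)"
    by (rule cx_presents_sing_rel_cx[OF clo A bdX bdA bd_diff])
  have "cx_presents (\<lambda>n. frags (simplices \<Delta> ?XB n))
    (\<lambda>n. frags (simplices \<Delta> (cl_subspace ?XB (A \<inter> B)) n)) (sing_bdry \<Delta>)
    (\<lambda>n x. sing_sub \<Delta> ?XB (A \<inter> B) n #>\<^bsub>grp (sing_cx \<Delta> ?XB) n\<^esub> x)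
    (sing_rel_cx \<Delta> ?XB (A \<inter> B))"
    by (rule cx_presents_sing_rel_cx[OF clo _ bdB _ bd_diff]) (use bdA bdB in \<open>auto simp: AB frags_Int\<close>)
  then have cxB: "cx_presents (\<lambda>n. frags (simplices \<Delta> ?XB n))
    (\<lambda>n. frags (simplices \<Delta> ?XA n \<inter> simplices \<Delta> ?XB n)) (sing_bdry \<Delta>)
    (\<lambda>n x. sing_sub \<Delta> ?XB (A \<inter> B) n #>\<^bsub>grp (sing_cx \<Delta> ?XB) n\<^esub> x)
    (sing_rel_cx \<Delta> ?XB (A \<inter> B))"
    by (simp add: AB)
  show ?thesis
    unfolding sing_inclusion_iso_def sing_homology_def sing_homology_map_def
  proof (rule homology_map_iso_excisive)
    show "cx_presents (\<lambda>n. frags (simplices \<Delta> X n)) (\<lambda>n. frags (simplices \<Delta> ?XA n \<union> {}))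
      (sing_bdry \<Delta>) (\<lambda>n x. sing_sub \<Delta> X A n #>\<^bsub>grp (sing_cx \<Delta> X) n\<^esub> x) (sing_rel_cx \<Delta> X A)"
      using cxX by simp
    show "cx_presents (\<lambda>n. frags (simplices \<Delta> ?XB n))
      (\<lambda>n. frags (simplices \<Delta> ?XB n \<inter> (simplices \<Delta> ?XA n \<union> {}))) (sing_bdry \<Delta>)
      (\<lambda>n x. sing_sub \<Delta> ?XB (A \<inter> B) n #>\<^bsub>grp (sing_cx \<Delta> ?XB) n\<^esub> x)
      (sing_rel_cx \<Delta> ?XB (A \<inter> B))"
      using cxB by (simp add: Int_commute)
    fix x assume x: "x \<in> frags (simplices \<Delta> ?XB n)"
    have 1: "sing_sub \<Delta> X A n = (\<lambda>x. x) ` frags (simplices \<Delta> ?XA n)"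
      by (rule sing_sub_eq[OF clo A])
    have 2: "sing_sub \<Delta> ?XB (A \<inter> B) n =
        (\<lambda>x. x) ` frags (simplices \<Delta> ?XA n \<inter> simplices \<Delta> ?XB n)"
      using sing_sub_eq[OF clo, of "A \<inter> B" "cl_subspace X B"] by (simp add: AB)
    show "quot_map (grp (sing_cx \<Delta> X) n) (sing_sub \<Delta> X A n) (sing_chain_map \<Delta> n (\<lambda>x. x))
          (sing_sub \<Delta> ?XB (A \<inter> B) n #>\<^bsub>grp (sing_cx \<Delta> ?XB) n\<^esub> x) =
         sing_sub \<Delta> X A n #>\<^bsub>grp (sing_cx \<Delta> X) n\<^esub> x"
      unfolding 1 2
    proof (rule quot_map_coset[where g = "\<lambda>x. x", OF _ _ _ _ _ _ _ _ _ _ _ x])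
      show "presents (frags (simplices \<Delta> ?XB n)) {0} (\<lambda>x. x) (grp (sing_cx \<Delta> ?XB) n)"
        "presents (frags (simplices \<Delta> X n)) {0} (\<lambda>x. x) (grp (sing_cx \<Delta> X) n)"
        by (simp_all add: sing_cx_def sing_simplices_eq_cells presents_free_Abelian_group)
      show "frags (simplices \<Delta> ?XA n) \<subseteq> frags (simplices \<Delta> X n)"
        using sub(1) frags_mono by blast
      show "sing_chain_map \<Delta> n (\<lambda>x. x) x = x" if "x \<in> frags (simplices \<Delta> ?XB n)" for x
        unfolding sing_chain_map_def by (rule frag_extend_restrict_id[OF that])
      show "x \<in> frags (simplices \<Delta> X n)" if "x \<in> frags (simplices \<Delta> ?XB n)" for x
        using that sub(2) frags_mono by blast
    qed (auto simp: frags_Int intro: frags_diff)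
  qed
qed

section \<open>Relative cubical chains modulo degenerate cubes\<close>

definition deg_cells :: "'j clspace \<Rightarrow> 'a clspace \<Rightarrow> nat \<Rightarrow> ((nat \<Rightarrow> 'j) \<Rightarrow> 'a) set" where
  "deg_cells J X n = {\<sigma> \<in> cubes J X n. degenerate_cube J n \<sigma>}"

lemma generate_frag_of:
  assumes "U \<subseteq> V"
  shows "generate (free_Abelian_group V) (frag_of ` U) = frags U"
proof -
  interpret group "free_Abelian_group V" by simp
  have sub: "subgroup (generate (free_Abelian_group V) (frag_of ` U)) (free_Abelian_group V)"
    using assms by (intro generate_is_subgroup) auto
  show ?thesis
  proof
    have "subgroup (frags U) (free_Abelian_group V)"
      by (rule subgroupI) (use assms in \<open>auto simp: frags_def dest: subsetD[OF Poly_Mapping.keys_add]\<close>)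
    then show "generate (free_Abelian_group V) (frag_of ` U) \<subseteq> frags U"
      by (intro generate_subgroup_incl) auto
    show "frags U \<subseteq> generate (free_Abelian_group V) (frag_of ` U)"
    proof
      fix c assume "c \<in> frags U"
      then show "c \<in> generate (free_Abelian_group V) (frag_of ` U)"
      proof (induction rule: frags_induct)
        case zero
        show ?case using subgroup.one_closed[OF sub] by simp
      next
        case (one x)
        then show ?case by (blast intro: generate.incl)
      next
        case (diff a b)
        have "b \<in> carrier (free_Abelian_group V)" using diff(2) subgroup.subset[OF sub] by blast
        then have "inv\<^bsub>free_Abelian_group V\<^esub> b = - b" by simp
        then show ?case
          using subgroup.m_closed[OF sub diff(1) subgroup.m_inv_closed[OF sub diff(2)]]
          by (simp del: inv_free_Abelian_group)
      qed
    qed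
  qed
qed

lemma degenerate_chains_eq:
  "degenerate_chains J X n = (\<lambda>x. x) ` frags (deg_cells J X n)"
  unfolding degenerate_chains_def
  using generate_frag_of[of "deg_cells J X n" "cubes J X n"]
  by (auto simp: all_cubes_cx_def sing_cubes_eq_cells deg_cells_def)

lemma deg_cells_sub: "deg_cells J X n \<subseteq> cubes J X n"
  by (auto simp: deg_cells_def)

text \<open>Degeneracy is a property of the map alone and does not see the space it maps
  into.\<close>

lemma deg_cells_subspace:
  assumes "cubes J Y n \<subseteq> cubes J X n"
  shows "deg_cells J Y n = cubes J Y n \<inter> deg_cells J X n"
  using assms by (auto simp: deg_cells_def)

abbreviation cube_proj :: "'j::zero_neq_one clspace \<Rightarrow> 'a clspace \<Rightarrow> nat \<Rightarrow> (((nat \<Rightarrow> 'j) \<Rightarrow> 'a) \<Rightarrow>\<^sub>0 int) \<Rightarrow>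
    (((nat \<Rightarrow> 'j) \<Rightarrow> 'a) \<Rightarrow>\<^sub>0 int) set" where
  "cube_proj J X n \<equiv> (\<lambda>x. degenerate_chains J X n #>\<^bsub>grp (all_cubes_cx J X) n\<^esub> x)"

lemma presents_all_cubes:
  "presents (frags (cubes J X n)) {0} (\<lambda>x. x) (grp (all_cubes_cx J X) n)"
  by (simp add: all_cubes_cx_def sing_cubes_eq_cells presents_free_Abelian_group)

lemma cx_presents_cube_cx:
  fixes X :: "'a clspace" and J :: "'j::zero_neq_one clspace"
  assumes bd: "\<And>n x. x \<in> frags (cubes J X n) \<Longrightarrow> cube_bdry J n x \<in> frags (cubes J X (n - 1))"
    "\<And>n x. x \<in> frags (deg_cells J X n) \<Longrightarrow> cube_bdry J n x \<in> frags (deg_cells J X (n - 1))"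
    "\<And>n (x :: ((nat \<Rightarrow> 'j) \<Rightarrow> 'a) \<Rightarrow>\<^sub>0 int) y. cube_bdry J n (x - y) = cube_bdry J n x - cube_bdry J n y"
  shows "cx_presents (\<lambda>n. frags (cubes J X n)) (\<lambda>n. frags (deg_cells J X n)) (cube_bdry J)
    (cube_proj J X) (cube_cx J X)"
  unfolding cube_cx_def
proof (rule cx_presents_quot)
  show "cx_presents (\<lambda>n. frags (cubes J X n)) (\<lambda>n. {0}) (cube_bdry J) (\<lambda>n x. x) (all_cubes_cx J X)"
    using bd(1,3) presents_all_cubes by (auto simp: cx_presents_def all_cubes_cx_def)
  show "degenerate_chains J X = (\<lambda>n. (\<lambda>x. x) ` frags (deg_cells J X n))"
    by (rule ext) (rule degenerate_chains_eq)
  show "frags (deg_cells J X n) \<subseteq> frags (cubes J X n)" for n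
    using frags_mono[OF _ deg_cells_sub] by blast
qed (use bd frags_diff in auto)

lemma cube_chain_map_proj:
  assumes "cubes J Y n \<subseteq> cubes J X n" and x: "x \<in> frags (cubes J Y n)"
  shows "cube_chain_map J n X (\<lambda>x. x) (cube_proj J Y n x) = cube_proj J X n x"
  unfolding cube_chain_map_def degenerate_chains_eq
proof (rule quot_map_coset[where g = "\<lambda>x. x", OF presents_all_cubes presents_all_cubes _ _ _ _ _ _ _ _ _ x])
  show "frags (deg_cells J Y n) \<subseteq> frags (cubes J Y n)"
    "frags (deg_cells J X n) \<subseteq> frags (cubes J X n)"
    using frags_mono[OF _ deg_cells_sub] by blast+
  show "z \<in> frags (cubes J X n)" if "z \<in> frags (cubes J Y n)" for z
    using that assms(1) frags_mono by blast
  show "z \<in> frags (deg_cells J X n)" if "z \<in> frags (deg_cells J Y n)" for z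
    using that frags_mono[of z _ "deg_cells J X n"] by (simp add: deg_cells_subspace[OF assms(1)])
  show "frag_extend (\<lambda>\<sigma>. frag_of (restrict ((\<lambda>x. x) \<circ> \<sigma>) (pts (cl_power J n)))) z = z"
    if "z \<in> frags (cubes J Y n)" for z
    by (rule frag_extend_restrict_id[OF that])
qed (auto intro: frags_diff)

text \<open>Modulo degenerate cubes it makes no difference to adjoin all degenerate cubes of
  \<open>X\<close> to the cubes in \<open>A\<close>. The larger set of chains contains the kernel of
  the projection, which makes it usable as the next kernel.\<close>

lemma cube_sub_eq:
  fixes X :: "'a clspace" and J :: "'j::zero_neq_one clspace"
  assumes sub: "cubes J (cl_subspace X A) n \<subseteq> cubes J X n"
    and pX: "presents (frags (cubes J X n)) (frags (deg_cells J X n)) (cube_proj J X n) (grp (cube_cx J X) n)"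
    and pA: "presents (frags (cubes J (cl_subspace X A) n)) (frags (deg_cells J (cl_subspace X A) n))
      (cube_proj J (cl_subspace X A) n) (grp (cube_cx J (cl_subspace X A)) n)"
  shows "cube_sub J X A n =
    cube_proj J X n ` frags (cubes J (cl_subspace X A) n \<union> deg_cells J X n)"
proof -
  let ?XA = "cl_subspace X A"
  have "cube_sub J X A n = cube_proj J X n ` frags (cubes J ?XA n)"
    unfolding cube_sub_def presentsD(6)[OF pA, symmetric] image_image
    using cube_chain_map_proj[OF sub] by (intro image_cong) auto
  also have "\<dots> = cube_proj J X n ` frags (cubes J ?XA n \<union> deg_cells J X n)"
  proof
    show "cube_proj J X n ` frags (cubes J ?XA n \<union> deg_cells J X n)
        \<subseteq> cube_proj J X n ` frags (cubes J ?XA n)"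
    proof (rule image_subsetI)
      fix x assume "x \<in> frags (cubes J ?XA n \<union> deg_cells J X n)"
      then obtain a d where ad: "a \<in> frags (cubes J ?XA n)"
        "d \<in> frags (deg_cells J X n)" "x = a - d"
        by (rule frags_Un_split)
      moreover have "x \<in> frags (cubes J X n)" "a \<in> frags (cubes J X n)"
        using ad sub deg_cells_sub[of J X n] by (auto intro!: frags_diff elim!: frags_mono)
      moreover have "x - a = - d" using ad by simp
      ultimately have "cube_proj J X n x = cube_proj J X n a"
        using presentsD(14)[OF pX, of x a] frags_minus by metis
      then show "cube_proj J X n x \<in> cube_proj J X n ` frags (cubes J ?XA n)"
        using ad(1) by blast
    qed
  qed (intro image_mono, auto intro: frags_mono)
  finally show ?thesis .
qed

lemma cx_presents_cube_rel_cx: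
  fixes X :: "'a clspace" and J :: "'j::zero_neq_one clspace"
  assumes sub: "\<And>n. cubes J (cl_subspace X A) n \<subseteq> cubes J X n"
    and bd: "\<And>n x. x \<in> frags (cubes J X n) \<Longrightarrow> cube_bdry J n x \<in> frags (cubes J X (n - 1))"
    "\<And>n x. x \<in> frags (cubes J (cl_subspace X A) n) \<Longrightarrow>
       cube_bdry J n x \<in> frags (cubes J (cl_subspace X A) (n - 1))"
    "\<And>n x. x \<in> frags (deg_cells J X n) \<Longrightarrow> cube_bdry J n x \<in> frags (deg_cells J X (n - 1))"
    "\<And>n (x :: ((nat \<Rightarrow> 'j) \<Rightarrow> 'a) \<Rightarrow>\<^sub>0 int) y. cube_bdry J n (x - y) = cube_bdry J n x - cube_bdry J n y"
  shows "cx_presents (\<lambda>n. frags (cubes J X n))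
    (\<lambda>n. frags (cubes J (cl_subspace X A) n \<union> deg_cells J X n)) (cube_bdry J)
    (\<lambda>n x. cube_sub J X A n #>\<^bsub>grp (cube_cx J X) n\<^esub> cube_proj J X n x) (cube_rel_cx J X A)"
  unfolding cube_rel_cx_def
proof -
  let ?XA = "cl_subspace X A"
  have cxX: "cx_presents (\<lambda>n. frags (cubes J X n)) (\<lambda>n. frags (deg_cells J X n)) (cube_bdry J)
    (cube_proj J X) (cube_cx J X)"
    by (rule cx_presents_cube_cx[OF bd(1,3,4)])
  have bdD: "cube_bdry J n x \<in> frags (deg_cells J ?XA (n - 1))"
    if "x \<in> frags (deg_cells J ?XA n)" for n x
    using that bd(2,3)[of x n] by (simp add: deg_cells_subspace[OF sub] frags_Int)
  have cxA: "cx_presents (\<lambda>n. frags (cubes J ?XA n))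
    (\<lambda>n. frags (deg_cells J ?XA n)) (cube_bdry J)
    (cube_proj J ?XA) (cube_cx J ?XA)"
    by (rule cx_presents_cube_cx[OF bd(2) bdD bd(4)])
  show "cx_presents (\<lambda>n. frags (cubes J X n))
    (\<lambda>n. frags (cubes J ?XA n \<union> deg_cells J X n)) (cube_bdry J)
    (\<lambda>n x. cube_sub J X A n #>\<^bsub>grp (cube_cx J X) n\<^esub> cube_proj J X n x) (quot_cx (cube_cx J X) (cube_sub J X A))"
  proof (rule cx_presents_quot[OF cxX])
    fix n
    show "frags (deg_cells J X n) \<subseteq> frags (cubes J ?XA n \<union> deg_cells J X n)"
      by (auto intro: frags_mono)
    show "frags (cubes J ?XA n \<union> deg_cells J X n) \<subseteq> frags (cubes J X n)"
      using sub[of n] deg_cells_sub[of J X n] by (auto elim!: frags_mono)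
    show "cube_bdry J n x \<in> frags (cubes J ?XA (n - 1) \<union> deg_cells J X (n - 1))"
      if x: "x \<in> frags (cubes J ?XA n \<union> deg_cells J X n)" for x
    proof -
      obtain a d where ad: "a \<in> frags (cubes J ?XA n)"
        "d \<in> frags (deg_cells J X n)" "x = a - d"
        using x by (rule frags_Un_split)
      then show ?thesis
        using bd(2)[OF ad(1)] bd(3)[OF ad(2)] by (auto simp: bd(4) intro!: frags_diff elim!: frags_mono)
    qed
    show "cube_sub J X A = (\<lambda>n. cube_proj J X n ` frags (cubes J ?XA n \<union> deg_cells J X n))"
      using cube_sub_eq[OF sub cx_presentsD(1)[OF cxX] cx_presentsD(1)[OF cxA]] by (rule ext)
  qed (auto intro: frags_diff)
qed

text \<open>The relative complexes are quotients by images of other quotients, so the absolute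
  complexes of \<open>X\<close>, \<open>A\<close>, \<open>B\<close> and \<open>A \<inter> B\<close>
  all have to be presented in order to identify \<open>cube_sub\<close> on both sides.\<close>

proposition cube_inclusion_iso_of_excisive:
  fixes X :: "'a clspace" and J :: "'j::zero_neq_one clspace"
  assumes clo: "\<And>n. closure_space (cl_power J n)" and A: "A \<subseteq> pts X" and B: "B \<subseteq> pts X"
    and ex: "excisive_cells (cubes J X) (cubes J (cl_subspace X A))
      (cubes J (cl_subspace X B)) (deg_cells J X) (cube_bdry J)"
  shows "cube_inclusion_iso J n (cl_subspace X B) (A \<inter> B) X A"
proof -
  let ?XA = "cl_subspace X A" and ?XB = "cl_subspace X B"
  interpret excisive_cells "cubes J X" "cubes J ?XA"
      "cubes J ?XB" "deg_cells J X" "cube_bdry J"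
    by (rule ex)
  note bdX = bd_frags[OF insertI1] and bdA = bd_frags[OF insertI2[OF insertI1]]
    and bdB = bd_frags[OF insertI2[OF insertI2[OF insertI1]]]
    and bdD = bd_frags[OF insertI2[OF insertI2[OF insertI2[OF insertI1]]]]
  note AB = cells_subspace_subspace[OF clo A B]
  have DB: "deg_cells J ?XB m = cubes J ?XB m \<inter> deg_cells J X m" for m
    using deg_cells_subspace[OF sub(2)] .
  \<comment> \<open>A cube in \<open>B\<close> is killed if it lies in \<open>A\<close> or is
    degenerate, and degeneracy in \<open>B\<close> agrees with degeneracy in \<open>X\<close>. This
    brings the kernel of the smaller pair into the form used by excision.\<close>
  have AB': "cubes J (cl_subspace ?XB (A \<inter> B)) m \<union> deg_cells J ?XB m
      = cubes J ?XB m \<inter> (cubes J ?XA m \<union> deg_cells J X m)" for m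
    by (auto simp: AB DB)
  have cxX: "cx_presents (\<lambda>n. frags (cubes J X n))
    (\<lambda>n. frags (cubes J ?XA n \<union> deg_cells J X n)) (cube_bdry J)
    (\<lambda>n x. cube_sub J X A n #>\<^bsub>grp (cube_cx J X) n\<^esub> cube_proj J X n x) (cube_rel_cx J X A)"
    by (rule cx_presents_cube_rel_cx[OF sub(1) bdX bdA bdD bd_diff])
  have cxB: "cx_presents (\<lambda>n. frags (cubes J ?XB n))
    (\<lambda>n. frags (cubes J ?XB n \<inter>
      (cubes J ?XA n \<union> deg_cells J X n))) (cube_bdry J)
    (\<lambda>n x. cube_sub J ?XB (A \<inter> B) n #>\<^bsub>grp (cube_cx J ?XB) n\<^esub> cube_proj J ?XB n x)
    (cube_rel_cx J ?XB (A \<inter> B))"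
    unfolding AB'[symmetric]
    by (rule cx_presents_cube_rel_cx[OF _ bdB _ _ bd_diff]) (use bdA bdB bdD in \<open>auto simp: AB DB frags_Int\<close>)
  have qX: "cx_presents (\<lambda>n. frags (cubes J X n)) (\<lambda>n. frags (deg_cells J X n)) (cube_bdry J)
    (cube_proj J X) (cube_cx J X)"
    by (rule cx_presents_cube_cx[OF bdX bdD bd_diff])
  have qB: "cx_presents (\<lambda>n. frags (cubes J ?XB n))
    (\<lambda>n. frags (deg_cells J ?XB n)) (cube_bdry J)
    (cube_proj J ?XB) (cube_cx J ?XB)"
    by (rule cx_presents_cube_cx[OF bdB _ bd_diff]) (use bdB bdD in \<open>auto simp: DB frags_Int\<close>)
  have qA: "cx_presents (\<lambda>n. frags (cubes J ?XA n))
    (\<lambda>n. frags (deg_cells J ?XA n)) (cube_bdry J)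
    (cube_proj J ?XA) (cube_cx J ?XA)"
    by (rule cx_presents_cube_cx[OF bdA _ bd_diff])
      (use bdA bdD in \<open>auto simp: deg_cells_subspace[OF sub(1)] frags_Int\<close>)
  have qAB: "cx_presents (\<lambda>n. frags (cubes J (cl_subspace ?XB (A \<inter> B)) n))
    (\<lambda>n. frags (deg_cells J (cl_subspace ?XB (A \<inter> B)) n)) (cube_bdry J)
    (cube_proj J (cl_subspace ?XB (A \<inter> B))) (cube_cx J (cl_subspace ?XB (A \<inter> B)))"
  proof (rule cx_presents_cube_cx[OF _ _ bd_diff])
    have "deg_cells J (cl_subspace ?XB (A \<inter> B)) m =
        cubes J ?XA m \<inter> cubes J ?XB m \<inter> deg_cells J X m" for m
      using sub(1)[of m] by (auto simp: deg_cells_def AB)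
    then show "cube_bdry J m x \<in> frags (deg_cells J (cl_subspace ?XB (A \<inter> B)) (m - 1))"
      if "x \<in> frags (deg_cells J (cl_subspace ?XB (A \<inter> B)) m)" for m x
      using bdA[of x m] bdB[of x m] bdD[of x m] that by (auto simp: frags_Int)
  qed (use bdA bdB in \<open>auto simp: AB frags_Int\<close>)
  show ?thesis
    unfolding cube_inclusion_iso_def cube_homology_def cube_homology_map_def
  proof (rule homology_map_iso_excisive[OF cxX cxB])
    fix x assume x: "x \<in> frags (cubes J ?XB n)"
    have 1: "cube_sub J X A n = cube_proj J X n ` frags (cubes J ?XA n \<union> deg_cells J X n)"
      by (rule cube_sub_eq[OF sub(1) cx_presentsD(1)[OF qX] cx_presentsD(1)[OF qA]])
    have 2: "cube_sub J ?XB (A \<inter> B) n = cube_proj J ?XB n `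
        frags (cubes J ?XB n \<inter> (cubes J ?XA n \<union> deg_cells J X n))"
      unfolding AB'[symmetric]
      by (rule cube_sub_eq[OF _ cx_presentsD(1)[OF qB] cx_presentsD(1)[OF qAB]]) (simp add: AB)
    show "quot_map (grp (cube_cx J X) n) (cube_sub J X A n) (cube_chain_map J n X (\<lambda>x. x))
          (cube_sub J ?XB (A \<inter> B) n #>\<^bsub>grp (cube_cx J ?XB) n\<^esub> cube_proj J ?XB n x) =
         cube_sub J X A n #>\<^bsub>grp (cube_cx J X) n\<^esub> cube_proj J X n x"
      unfolding 1 2
    proof (rule quot_map_coset[where g = "\<lambda>x. x", OF cx_presentsD(1)[OF qB] cx_presentsD(1)[OF qX] _ _ _ _ _ _ _ _ _ x])
      show "frags (cubes J ?XA n \<union> deg_cells J X n) \<subseteq> frags (cubes J X n)"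
        using sub(1,3)[of n] by (auto elim!: frags_mono)
      show "z \<in> frags (cubes J X n)" if "z \<in> frags (cubes J ?XB n)" for z
        using that sub(2) frags_mono by blast
      show "cube_chain_map J n X (\<lambda>x. x) (cube_proj J ?XB n z) = cube_proj J X n z"
        if "z \<in> frags (cubes J ?XB n)" for z
        by (rule cube_chain_map_proj[OF sub(2) that])
    qed (auto simp: frags_Int intro: frags_diff)
  qed
qed

section \<open>Cells and their boundaries\<close>

text \<open>The terms with \<open>j < i\<close> cancel those with \<open>i \<le> j\<close> under
  \<open>(i, j) \<mapsto> (j, i - 1)\<close>, which keeps the value of \<open>F\<close> and lowers
  the exponent of the sign by one. Simplicial and cubical boundaries both square to zero by
  this.\<close>

lemma alternating_double_sum_eq_0:
  fixes F :: "nat \<Rightarrow> nat \<Rightarrow> 'b \<Rightarrow>\<^sub>0 int"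
  assumes F: "\<And>i j. j < i \<Longrightarrow> i \<le> Suc n \<Longrightarrow> F i j = F j (i - 1)"
  shows "(\<Sum>i\<le>Suc n. \<Sum>j\<le>n. frag_cmul ((-1) ^ (i + j)) (F i j)) = 0"
proof -
  let ?f = "\<lambda>(i, j). frag_cmul ((-1) ^ (i + j)) (F i j)"
  let ?P = "{(i, j). j < i \<and> i \<le> Suc n}" and ?Q = "{(i, j). i \<le> j \<and> j \<le> n}"
  have PQ: "{..Suc n} \<times> {..n} = ?P \<union> ?Q" "?P \<inter> ?Q = {}" by auto
  have fin: "finite ?P" "finite ?Q"
    by (rule finite_subset[of _ "{..Suc n} \<times> {..n}"]; auto)+
  have "sum ?f ?P = (\<Sum>p\<in>?Q. - ?f p)"
  proof (rule sum.reindex_bij_witness[where j = "\<lambda>(i, j). (j, i - 1)" and i = "\<lambda>(i, j). (Suc j, i)"])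
    fix p assume "p \<in> ?P"
    then obtain i j where p: "p = (Suc i, j)" "j \<le> i" "i \<le> n"
      by (cases p) (auto, metis less_Suc_eq_0_disj less_Suc_eq_le not_less_eq old.nat.exhaust)
    then show "- ?f (case p of (i, j) \<Rightarrow> (j, i - 1)) = ?f p"
      using F[of j "Suc i"] by (simp add: add.commute)
  qed auto
  then have "sum ?f (?P \<union> ?Q) = 0"
    by (simp add: sum.union_disjoint[OF fin PQ(2)] sum_negf)
  then show ?thesis
    by (simp add: sum.cartesian_product flip: PQ(1))
qed

lemma frags_empty: "x \<in> frags {} \<longleftrightarrow> x = 0"
  by (simp add: frags_def)

lemma frag_cmul_diff: "frag_cmul k (x - y) = frag_cmul k x - frag_cmul k y"
  by (rule poly_mapping_eqI) (simp add: lookup_minus right_diff_distrib)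

section \<open>Composition of cells and the simplicial boundary\<close>

lemma closure_spaceD:
  assumes "closure_space X"
  shows "\<And>A. A \<subseteq> pts X \<Longrightarrow> cl X A \<subseteq> pts X" "cl X {} = {}" "\<And>A. A \<subseteq> pts X \<Longrightarrow> A \<subseteq> cl X A"
    "\<And>A B. A \<subseteq> pts X \<Longrightarrow> B \<subseteq> pts X \<Longrightarrow> cl X (A \<union> B) = cl X A \<union> cl X B"
    "\<And>A B. A \<subseteq> B \<Longrightarrow> B \<subseteq> pts X \<Longrightarrow> cl X A \<subseteq> cl X B"
proof -
  show *: "\<And>A B. A \<subseteq> pts X \<Longrightarrow> B \<subseteq> pts X \<Longrightarrow> cl X (A \<union> B) = cl X A \<union> cl X B"
    using assms by (simp add: closure_space_def)
  show "cl X A \<subseteq> cl X B" if "A \<subseteq> B" "B \<subseteq> pts X" for A B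
    using *[of A B] that by (metis Un_upper1 order_trans sup.absorb2)
qed (use assms in \<open>simp_all add: closure_space_def\<close>)

lemma cells_compose:
  assumes \<sigma>: "\<sigma> \<in> cells L X" and g: "cl_continuous K L g" and K: "closure_space K"
  shows "restrict (\<sigma> \<circ> g) (pts K) \<in> cells K X"
proof -
  have "restrict (\<sigma> \<circ> g) (pts K) ` cl K S \<subseteq> cl X (restrict (\<sigma> \<circ> g) (pts K) ` S)" if S: "S \<subseteq> pts K" for S
  proof -
    have "restrict (\<sigma> \<circ> g) (pts K) ` cl K S = \<sigma> ` g ` cl K S"
      using closure_spaceD(1)[OF K S] by (auto simp: image_comp)
    also have "\<dots> \<subseteq> \<sigma> ` cl L (g ` S)"
      using g S by (intro image_mono) (simp add: cl_continuous_def)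
    also have "\<dots> \<subseteq> cl X (\<sigma> ` g ` S)"
    proof -
      have "g ` S \<subseteq> pts L" using g S by (auto simp: cl_continuous_def)
      then show ?thesis using \<sigma> by (simp add: cells_def cl_continuous_def)
    qed
    also have "\<sigma> ` g ` S = restrict (\<sigma> \<circ> g) (pts K) ` S"
      using S by (auto simp: image_comp)
    finally show ?thesis .
  qed
  moreover have "restrict (\<sigma> \<circ> g) (pts K) ` pts K \<subseteq> pts X"
    using \<sigma> g by (auto simp: cells_def cl_continuous_def)
  ultimately show ?thesis
    by (simp add: cells_def cl_continuous_def)
qed

lemma cl_continuous_restrict:
  assumes "closure_space K"
  shows "cl_continuous K X (restrict f (pts K)) \<longleftrightarrow> cl_continuous K X f"
proof -
  have "restrict f (pts K) ` cl K S = f ` cl K S" "restrict f (pts K) ` S = f ` S" if "S \<subseteq> pts K" for S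
    using closure_spaceD(1)[OF assms that] that by auto
  then show ?thesis by (simp add: cl_continuous_def)
qed

text \<open>What the three families of simplices share: continuous cofaces and the cosimplicial
  identity. The boundary then squares to zero and is natural for all of them at once.\<close>

locale coface_model =
  fixes \<Delta> :: "'s simplex_model"
  assumes closure_simplex: "closure_space (simplex \<Delta> n)"
    and coface_continuous: "i \<le> Suc n \<Longrightarrow> cl_continuous (simplex \<Delta> n) (simplex \<Delta> (Suc n)) (coface \<Delta> i)"
    and coface_coface: "j < i \<Longrightarrow> i \<le> Suc (Suc n) \<Longrightarrow> x \<in> pts (simplex \<Delta> n) \<Longrightarrow>
      coface \<Delta> i (coface \<Delta> j x) = coface \<Delta> j (coface \<Delta> (i - 1) x)"
begin

definition face :: "nat \<Rightarrow> nat \<Rightarrow> ('s \<Rightarrow> 'a) \<Rightarrow> 's \<Rightarrow> 'a" where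
  "face n i \<sigma> = restrict (\<sigma> \<circ> coface \<Delta> i) (pts (simplex \<Delta> n))"

lemma sing_bdry_Suc: "sing_bdry \<Delta> (Suc n) (frag_of \<sigma>) = (\<Sum>i\<le>Suc n. frag_cmul ((-1) ^ i) (frag_of (face n i \<sigma>)))"
  by (simp add: sing_bdry_def face_def atLeast0AtMost del: sum.atMost_Suc)

lemma sing_bdry_0: "sing_bdry \<Delta> 0 c = 0"
  by (simp add: sing_bdry_def)

lemma sing_bdry_zero: "sing_bdry \<Delta> n 0 = 0"
  by (simp add: sing_bdry_def)

lemma sing_bdry_diff: "sing_bdry \<Delta> n (x - y) = sing_bdry \<Delta> n x - sing_bdry \<Delta> n y"
  by (simp add: sing_bdry_def frag_extend_diff)

lemma sing_bdry_cells:
  assumes "x \<in> frags (simplices \<Delta> X n)"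
  shows "sing_bdry \<Delta> n x \<in> frags (simplices \<Delta> X (n - 1))"
proof (cases n)
  case (Suc m)
  from assms show ?thesis
  proof (induction rule: frags_induct)
    case (one \<sigma>)
    have "face m i \<sigma> \<in> simplices \<Delta> X m" if "i \<le> Suc m" for i
      unfolding face_def using cells_compose[OF _ coface_continuous[OF that] closure_simplex] one Suc by simp
    then show ?case
      unfolding Suc sing_bdry_Suc by (auto intro!: frags_sum frags_cmul simp del: sum.atMost_Suc)
  qed (auto simp: sing_bdry_diff frags_diff sing_bdry_zero)
qed (simp add: sing_bdry_0)

lemma sing_bdry_sum: "finite I \<Longrightarrow> sing_bdry \<Delta> n (sum f I) = (\<Sum>i\<in>I. sing_bdry \<Delta> n (f i))"
  by (induction I rule: finite_induct) (auto simp: sing_bdry_def frag_extend_add)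

lemma sing_bdry_cmul: "sing_bdry \<Delta> n (frag_cmul k x) = frag_cmul k (sing_bdry \<Delta> n x)"
  by (simp add: sing_bdry_def frag_extend_cmul)

lemma face_face:
  assumes "j < i" "i \<le> Suc (Suc n)"
  shows "face n j (face (Suc n) i \<sigma>) = face n (i - 1) (face (Suc n) j \<sigma>)"
proof -
  have "coface \<Delta> k x \<in> pts (simplex \<Delta> (Suc n))" if "x \<in> pts (simplex \<Delta> n)" "k \<le> Suc n" for k x
    using coface_continuous[OF that(2)] that(1) by (auto simp: cl_continuous_def)
  then show ?thesis
    using assms coface_coface[OF assms] by (auto simp: face_def fun_eq_iff restrict_def)
qed

lemma sing_bdry_bdry: "sing_bdry \<Delta> n (sing_bdry \<Delta> (Suc n) x) = 0"
proof (cases n)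
  case (Suc m)
  have "x \<in> frags UNIV" by (simp add: frags_def)
  then show ?thesis
  proof (induction rule: frags_induct)
    case (one \<sigma>)
    have "sing_bdry \<Delta> n (sing_bdry \<Delta> (Suc n) (frag_of \<sigma>)) =
      (\<Sum>i\<le>Suc (Suc m). \<Sum>j\<le>Suc m. frag_cmul ((-1) ^ (i + j)) (frag_of (face m j (face (Suc m) i \<sigma>))))"
      unfolding Suc sing_bdry_Suc
      by (simp add: sing_bdry_sum sing_bdry_cmul sing_bdry_Suc frag_cmul_sum power_add del: sum.atMost_Suc)
    also have "\<dots> = 0"
      by (rule alternating_double_sum_eq_0) (simp add: face_face)
    finally show ?case .
  qed (auto simp: sing_bdry_diff sing_bdry_zero)
qed (simp add: sing_bdry_0)

lemma excisive_cellsI: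
  fixes X :: "'a clspace"
  assumes A: "A \<subseteq> pts X" and B: "B \<subseteq> pts X"
    and sub: "\<And>c n. c \<in> frags (simplices \<Delta> X n) \<Longrightarrow> \<exists>s t.
      subdivision {simplices \<Delta> X, simplices \<Delta> (cl_subspace X A),
          simplices \<Delta> (cl_subspace X B), \<lambda>_. {}}
        (simplices \<Delta> X) (\<lambda>_. {}) (sing_bdry \<Delta>) s t \<and>
      s n c \<in> small_chains (simplex \<Delta> n) X A B"
  shows "excisive_cells (simplices \<Delta> X) (simplices \<Delta> (cl_subspace X A))
      (simplices \<Delta> (cl_subspace X B)) (\<lambda>_. {}) (sing_bdry \<Delta>)"
proof
  show "simplices \<Delta> (cl_subspace X A) n \<subseteq> simplices \<Delta> X n"
    "simplices \<Delta> (cl_subspace X B) n \<subseteq> simplices \<Delta> X n" for n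
    using cells_subspace[OF closure_simplex A] cells_subspace[OF closure_simplex B] by auto
  show "sing_bdry \<Delta> n x \<in> frags (U (n - 1))" if "U \<in> {simplices \<Delta> X, simplices \<Delta> (cl_subspace X A),
      simplices \<Delta> (cl_subspace X B), \<lambda>_. {}}" "x \<in> frags (U n)" for U n x
    using that sing_bdry_cells[of x n X] sing_bdry_cells[of x n "cl_subspace X A"]
      sing_bdry_cells[of x n "cl_subspace X B"] sing_bdry_zero by (auto simp: frags_empty)
qed (rule sub, assumption | simp add: sing_bdry_diff sing_bdry_0 sing_bdry_bdry)+

end

text \<open>A cell with a point that adheres to every other point is trapped in any neighbourhood of that point.\<close>

lemma cells_interior_cover:
  assumes X: "closure_space X" and cov: "interior_cover X {A, B}" and K: "closure_space K"
    and p: "p \<in> pts K" "\<And>q. q \<in> pts K \<Longrightarrow> p \<in> cl K {q}"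
  shows "cells K X \<subseteq> cells K (cl_subspace X A) \<union> cells K (cl_subspace X B)"
proof
  fix \<sigma> assume \<sigma>: "\<sigma> \<in> cells K X"
  then have cont: "\<sigma> ` pts K \<subseteq> pts X" "\<And>S. S \<subseteq> pts K \<Longrightarrow> \<sigma> ` cl K S \<subseteq> cl X (\<sigma> ` S)"
    by (auto simp: cells_def cl_continuous_def)
  have AB: "A \<subseteq> pts X" "B \<subseteq> pts X"
    using cov by (auto simp: interior_cover_def)
  have *: "\<sigma> ` pts K \<subseteq> U" if U: "\<sigma> p \<in> cl_interior X U" for U
  proof (rule image_subsetI, rule ccontr)
    fix q assume q: "q \<in> pts K" "\<sigma> q \<notin> U"
    have "\<sigma> p \<in> cl X {\<sigma> q}"
      using cont(2)[of "{q}"] p(2)[OF q(1)] q(1) by auto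
    moreover have "cl X {\<sigma> q} \<subseteq> cl X (pts X - U)"
      using q cont(1) by (intro closure_spaceD(5)[OF X]) auto
    ultimately show False
      using U by (auto simp: cl_interior_def)
  qed
  have "\<sigma> p \<in> pts X" using cont(1) p(1) by blast
  then have "\<sigma> p \<in> cl_interior X A \<or> \<sigma> p \<in> cl_interior X B"
    using cov by (auto simp: interior_cover_def)
  then show "\<sigma> \<in> cells K (cl_subspace X A) \<union> cells K (cl_subspace X B)"
    using * \<sigma> by (auto simp: cells_subspace[OF K AB(1)] cells_subspace[OF K AB(2)])
qed

text \<open>By \<open>cells_interior_cover\<close> every simplex is already small, so the identity
  is a subdivision, with zero homotopy.\<close>

proposition (in coface_model) sing_inclusion_iso_dominated:
  assumes X: "closure_space X" and cov: "interior_cover X {A, B}"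
    and p: "\<And>n. \<exists>p\<in>pts (simplex \<Delta> n). \<forall>q\<in>pts (simplex \<Delta> n). p \<in> cl (simplex \<Delta> n) {q}"
  shows "sing_inclusion_iso \<Delta> n (cl_subspace X B) (A \<inter> B) X A"
proof (rule sing_inclusion_iso_of_excisive[OF closure_simplex])
  show AB: "A \<subseteq> pts X" "B \<subseteq> pts X"
    using cov by (auto simp: interior_cover_def)
  have "simplices \<Delta> X n \<subseteq> simplices \<Delta> (cl_subspace X A) n \<union> simplices \<Delta> (cl_subspace X B) n" for n
    using p[of n] cells_interior_cover[OF X cov closure_simplex] by blast
  then show "excisive_cells (simplices \<Delta> X) (simplices \<Delta> (cl_subspace X A))
     (simplices \<Delta> (cl_subspace X B)) (\<lambda>_. {}) (sing_bdry \<Delta>)"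
    by (intro excisive_cellsI[OF AB] exI[of _ "\<lambda>_ x. x"] exI[of _ "\<lambda>_ x. 0"])
      (simp add: subdivision_def sing_bdry_zero frags_mono)
qed

section \<open>Simplicial excision for \<open>J_1\<close> and \<open>J_+\<close>\<close>

lemma coface_model_J1: "coface_model J1_simplices"
proof
  show "closure_space (simplex J1_simplices n)" for n
    by (auto simp: closure_space_def J1_simplices_def indiscrete_clspace_def)
  show "cl_continuous (simplex J1_simplices n) (simplex J1_simplices (Suc n)) (coface J1_simplices i)" if "i \<le> Suc n" for i n
    using that by (auto simp: cl_continuous_def J1_simplices_def indiscrete_clspace_def vertex_coface_def)
qed (auto simp: J1_simplices_def vertex_coface_def)

lemma coface_model_Jp: "coface_model Jp_simplices"
proof
  show "closure_space (simplex Jp_simplices n)" for n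
    by (fastforce simp: closure_space_def Jp_simplices_def)
  show "cl_continuous (simplex Jp_simplices n) (simplex Jp_simplices (Suc n)) (coface Jp_simplices i)" if "i \<le> Suc n" for i n
    using that by (force simp: cl_continuous_def Jp_simplices_def vertex_coface_def)
qed (auto simp: Jp_simplices_def vertex_coface_def)

lemma sing_inclusion_iso_J1:
  assumes "closure_space X" "interior_cover X {A, B}"
  shows "sing_inclusion_iso J1_simplices n (cl_subspace X B) (A \<inter> B) X A"
  by (rule coface_model.sing_inclusion_iso_dominated[OF coface_model_J1 assms])
    (auto simp: J1_simplices_def indiscrete_clspace_def)

lemma sing_inclusion_iso_Jp:
  assumes "closure_space X" "interior_cover X {A, B}"
  shows "sing_inclusion_iso Jp_simplices n (cl_subspace X B) (A \<inter> B) X A"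
proof (rule coface_model.sing_inclusion_iso_dominated[OF coface_model_Jp assms])
  show "\<exists>p\<in>pts (simplex Jp_simplices n). \<forall>q\<in>pts (simplex Jp_simplices n). p \<in> cl (simplex Jp_simplices n) {q}" for n
    \<comment> \<open>The closure of vertex \<open>i\<close> consists of the vertices from
      \<open>i\<close> on, so the last vertex adheres to every vertex.\<close>
    by (rule bexI[of _ n]) (auto simp: Jp_simplices_def)
qed

section \<open>Cubes\<close>

lemma cl_nbhdD:
  assumes J: "closure_space J" and V: "cl_nbhd J x V"
  shows "V \<subseteq> pts J" "x \<in> V"
proof -
  show "V \<subseteq> pts J" using V by (simp add: cl_nbhd_def)
  show "x \<in> V"
    using V closure_spaceD(3)[OF J, of "pts J - V"] by (auto simp: cl_nbhd_def cl_interior_def)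
qed

lemma cl_nbhd_Int:
  assumes J: "closure_space J" and "cl_nbhd J x V" "cl_nbhd J x W"
  shows "cl_nbhd J x (V \<inter> W)"
  using assms(2,3) closure_spaceD(4)[OF J, of "pts J - V" "pts J - W"]
  by (auto simp: cl_nbhd_def cl_interior_def Diff_Int)

lemma cl_nbhd_pts: "closure_space J \<Longrightarrow> x \<in> pts J \<Longrightarrow> cl_nbhd J x (pts J)"
  by (simp add: cl_nbhd_def cl_interior_def closure_spaceD)

lemma pts_cl_power [simp]: "pts (cl_power J n) = {1..n} \<rightarrow>\<^sub>E pts J"
  by (simp add: cl_power_def)

lemma mem_cl_power:
  "x \<in> cl (cl_power J n) S \<longleftrightarrow> x \<in> {1..n} \<rightarrow>\<^sub>E pts J \<and>
     (\<forall>V. (\<forall>i\<in>{1..n}. cl_nbhd J (x i) (V i)) \<longrightarrow> (\<exists>y\<in>S. y \<in> {1..n} \<rightarrow>\<^sub>E pts J \<and> (\<forall>i\<in>{1..n}. y i \<in> V i)))"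
proof -
  have "({1..n} \<rightarrow>\<^sub>E pts J) \<inter> Pi {1..n} V \<inter> S \<noteq> {} \<longleftrightarrow>
      (\<exists>y\<in>S. y \<in> {1..n} \<rightarrow>\<^sub>E pts J \<and> (\<forall>i\<in>{1..n}. y i \<in> V i))" for V
    by (simp only: ex_in_conv[symmetric] Int_iff Pi_iff Bex_def) blast
  then show ?thesis
    by (simp add: cl_power_def)
qed

lemma cl_power_mono: "S \<subseteq> T \<Longrightarrow> cl (cl_power J n) S \<subseteq> cl (cl_power J n) T"
  unfolding cl_power_def by (simp only: clspace.simps) (intro Collect_mono conj_mono all_mono imp_mono imp_refl, blast)

text \<open>Additivity rests on neighbourhoods being closed under intersection: a box missing
  \<open>A\<close> and a box missing \<open>B\<close> meet in a box missing both.\<close>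

lemma closure_space_cl_power:
  assumes J: "closure_space J"
  shows "closure_space (cl_power J n)"
  unfolding closure_space_def
proof (intro conjI allI impI)
  show "cl (cl_power J n) A \<subseteq> pts (cl_power J n)" for A
    by (rule subsetI) (simp only: mem_cl_power pts_cl_power)
  show "cl (cl_power J n) {} = {}"
  proof (rule equals0I)
    fix x assume "x \<in> cl (cl_power J n) {}"
    then have x: "x \<in> {1..n} \<rightarrow>\<^sub>E pts J" "\<not> (\<forall>i\<in>{1..n}. cl_nbhd J (x i) (pts J))"
      unfolding mem_cl_power by (blast, metis empty_iff)
    then show False using cl_nbhd_pts[OF J] PiE_mem[OF x(1)] by metis
  qed
  show "A \<subseteq> cl (cl_power J n) A" if "A \<subseteq> pts (cl_power J n)" for A
  proof (rule subsetI)
      fix x assume x: "x \<in> A"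
      then have "x \<in> {1..n} \<rightarrow>\<^sub>E pts J" using that by auto
      then show "x \<in> cl (cl_power J n) A"
        unfolding mem_cl_power using x cl_nbhdD(2)[OF J] by blast
    qed
  show "cl (cl_power J n) (A \<union> B) = cl (cl_power J n) A \<union> cl (cl_power J n) B" for A B
  proof
    show "cl (cl_power J n) (A \<union> B) \<subseteq> cl (cl_power J n) A \<union> cl (cl_power J n) B"
    proof (rule subsetI, rule ccontr)
      fix x assume x: "x \<in> cl (cl_power J n) (A \<union> B)" "x \<notin> cl (cl_power J n) A \<union> cl (cl_power J n) B"
      have xP: "x \<in> {1..n} \<rightarrow>\<^sub>E pts J"
        using x(1) unfolding mem_cl_power by (rule conjunct1)
      have *: "\<exists>V. (\<forall>i\<in>{1..n}. cl_nbhd J (x i) (V i)) \<and>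
          \<not> (\<exists>y\<in>C. y \<in> {1..n} \<rightarrow>\<^sub>E pts J \<and> (\<forall>i\<in>{1..n}. y i \<in> V i))"
        if "x \<notin> cl (cl_power J n) C" for C
        using that by (simp only: mem_cl_power xP simp_thms not_all not_imp)
      obtain V where V: "\<forall>i\<in>{1..n}. cl_nbhd J (x i) (V i)"
          "\<not> (\<exists>y\<in>A. y \<in> {1..n} \<rightarrow>\<^sub>E pts J \<and> (\<forall>i\<in>{1..n}. y i \<in> V i))"
        using *[of A] x(2) by blast
      obtain W where W: "\<forall>i\<in>{1..n}. cl_nbhd J (x i) (W i)"
          "\<not> (\<exists>y\<in>B. y \<in> {1..n} \<rightarrow>\<^sub>E pts J \<and> (\<forall>i\<in>{1..n}. y i \<in> W i))"
        using *[of B] x(2) by blast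
      have "\<forall>i\<in>{1..n}. cl_nbhd J (x i) (V i \<inter> W i)"
        using V(1) W(1) cl_nbhd_Int[OF J] by blast
      then obtain y where "y \<in> A \<union> B" "y \<in> {1..n} \<rightarrow>\<^sub>E pts J" "\<forall>i\<in>{1..n}. y i \<in> V i \<inter> W i"
        using x(1)[unfolded mem_cl_power, THEN conjunct2, rule_format, of "\<lambda>i. V i \<inter> W i"] by blast
      then show False using V(2) W(2) by blast
    qed
    show "cl (cl_power J n) A \<union> cl (cl_power J n) B \<subseteq> cl (cl_power J n) (A \<union> B)"
      using cl_power_mono[of A "A \<union> B" J n] cl_power_mono[of B "A \<union> B" J n] by simp
  qed
qed

lemma cube_insert_mem:
  assumes x: "x \<in> {1..n} \<rightarrow>\<^sub>E P" and t: "t \<in> P" and i: "i \<in> {1..Suc n}"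
  shows "cube_insert (Suc n) i t x \<in> {1..Suc n} \<rightarrow>\<^sub>E P"
proof (rule PiE_I)
  show "cube_insert (Suc n) i t x k \<in> P" if k: "k \<in> {1..Suc n}" for k
  proof -
    have "x k \<in> P" if "k < i" using PiE_mem[OF x, of k] k i that by auto
    moreover have "x (k - 1) \<in> P" if "i < k"
    proof (rule PiE_mem[OF x])
      show "k - 1 \<in> {1..n}" using k i that unfolding atLeastAtMost_iff by linarith
    qed
    ultimately show ?thesis using t k by (auto simp: cube_insert_def)
  qed
qed (simp only: cube_insert_def restrict_apply if_False)

text \<open>Dropping factor \<open>i\<close> turns a box around the image of \<open>x\<close> into a
  box around \<open>x\<close>. A point of \<open>S\<close> in the latter is sent into the former,
  because the neighbourhood of \<open>t\<close> in factor \<open>i\<close> contains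
  \<open>t\<close>.\<close>

lemma cube_insert_continuous:
  assumes J: "closure_space J" and t: "t \<in> pts J" and i: "i \<in> {1..Suc n}"
  shows "cl_continuous (cl_power J n) (cl_power J (Suc n)) (cube_insert (Suc n) i t)"
  unfolding cl_continuous_def
proof (intro conjI allI impI)
  show "cube_insert (Suc n) i t ` pts (cl_power J n) \<subseteq> pts (cl_power J (Suc n))"
    unfolding pts_cl_power using cube_insert_mem[OF _ t i] by blast
  fix S assume S: "S \<subseteq> pts (cl_power J n)"
  show "cube_insert (Suc n) i t ` cl (cl_power J n) S \<subseteq> cl (cl_power J (Suc n)) (cube_insert (Suc n) i t ` S)"
  proof (rule image_subsetI)
    fix x assume x: "x \<in> cl (cl_power J n) S"
    have "\<exists>z\<in>cube_insert (Suc n) i t ` S. z \<in> {1..Suc n} \<rightarrow>\<^sub>E pts J \<and> (\<forall>k\<in>{1..Suc n}. z k \<in> V k)"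
      if V: "\<forall>k\<in>{1..Suc n}. cl_nbhd J (cube_insert (Suc n) i t x k) (V k)" for V
    proof -
      have "\<forall>k\<in>{1..n}. cl_nbhd J (x k) (if k < i then V k else V (Suc k))"
      proof
        fix k assume k: "k \<in> {1..n}"
        show "cl_nbhd J (x k) (if k < i then V k else V (Suc k))"
          using V[rule_format, of k] V[rule_format, of "Suc k"] k by (auto simp: cube_insert_def)
      qed
      then obtain y where y: "y \<in> S" "y \<in> {1..n} \<rightarrow>\<^sub>E pts J" "\<forall>k\<in>{1..n}. y k \<in> (if k < i then V k else V (Suc k))"
        using x[unfolded mem_cl_power, THEN conjunct2, rule_format, of "\<lambda>k. if k < i then V k else V (Suc k)"] by blast
      have "cube_insert (Suc n) i t y k \<in> V k" if k: "k \<in> {1..Suc n}" for k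
      proof -
        consider "k < i" | "k = i" | "i < k" by linarith
        then show ?thesis
        proof cases
          case 1
          then show ?thesis using y(3)[rule_format, of k] k i by (auto simp: cube_insert_def)
        next
          case 2
          then show ?thesis using cl_nbhdD(2)[OF J V[rule_format, OF k]] k by (auto simp: cube_insert_def)
        next
          case 3
          then have "k - 1 \<in> {1..n}" "\<not> k - 1 < i" "Suc (k - 1) = k"
            using k i unfolding atLeastAtMost_iff by linarith+
          then show ?thesis using y(3)[rule_format, of "k - 1"] k 3 by (simp add: cube_insert_def)
        qed
      qed
      then show ?thesis using y(1) cube_insert_mem[OF y(2) t i] by blast
    qed
    then show "cube_insert (Suc n) i t x \<in> cl (cl_power J (Suc n)) (cube_insert (Suc n) i t ` S)"
      using cube_insert_mem[OF _ t i, of x] x by (simp add: mem_cl_power)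
  qed
qed

lemma cube_insert_insert:
  assumes "1 \<le> j" "j < i" "i \<le> Suc (Suc n)"
  shows "cube_insert (Suc (Suc n)) i t (cube_insert (Suc n) j s x) =
    cube_insert (Suc (Suc n)) j s (cube_insert (Suc n) (i - 1) t x)"
proof
  fix k
  obtain i' where i: "i = Suc i'" using assms by (cases i) auto
  show "cube_insert (Suc (Suc n)) i t (cube_insert (Suc n) j s x) k =
    cube_insert (Suc (Suc n)) j s (cube_insert (Suc n) (i - 1) t x) k"
  proof (cases "k \<in> {1..Suc (Suc n)}")
    case True
    then obtain k' where k: "k = Suc k'" by (cases k) auto
    consider "k < j" | "k = j" | "j \<le> k'" "k' < i'" | "k' = i'" | "i' < k'" using i k by linarith
    then show ?thesis
      using True assms unfolding i k by cases (simp_all add: cube_insert_def)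
  next
    case False
    then show ?thesis
      unfolding cube_insert_def by (simp only: restrict_apply if_False)
  qed
qed

lemma cube_face_face:
  assumes "1 \<le> j" "j < i" "i \<le> Suc (Suc n)" "s \<in> pts J" "t \<in> pts J"
  shows "cube_face J (Suc n) j s (cube_face J (Suc (Suc n)) i t \<sigma>) =
    cube_face J (Suc n) (i - 1) t (cube_face J (Suc (Suc n)) j s \<sigma>)"
proof
  have i: "i - 1 \<in> {1..Suc n}" using assms unfolding atLeastAtMost_iff by linarith
  show "cube_face J (Suc n) j s (cube_face J (Suc (Suc n)) i t \<sigma>) x =
    cube_face J (Suc n) (i - 1) t (cube_face J (Suc (Suc n)) j s \<sigma>) x" for x
    using cube_insert_mem[of x n "pts J" s j] cube_insert_mem[of x n "pts J" t "i - 1"] assms i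
    by (simp add: cube_face_def cube_insert_insert[OF assms(1-3)] restrict_def)
qed

section \<open>The cubical boundary and degenerate cubes\<close>

locale cube_model =
  fixes J :: "'j::zero_neq_one clspace"
  assumes closure_J: "closure_space J" and pts_01: "0 \<in> pts J" "1 \<in> pts J"
begin

definition faces :: "nat \<Rightarrow> nat \<Rightarrow> ((nat \<Rightarrow> 'j) \<Rightarrow> 'a) \<Rightarrow> ((nat \<Rightarrow> 'j) \<Rightarrow> 'a) \<Rightarrow>\<^sub>0 int" where
  "faces n i \<sigma> = frag_of (cube_face J n i 0 \<sigma>) - frag_of (cube_face J n i 1 \<sigma>)"

lemma cube_bdry_of: "cube_bdry J n (frag_of \<sigma>) = (\<Sum>i=1..n. frag_cmul ((-1) ^ i) (faces n i \<sigma>))"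
  by (simp add: cube_bdry_def faces_def)

lemma cube_bdry_Suc: "cube_bdry J (Suc n) (frag_of \<sigma>) = (\<Sum>i\<le>n. frag_cmul ((-1) ^ Suc i) (faces (Suc n) (Suc i) \<sigma>))"
  unfolding cube_bdry_of by (simp only: One_nat_def sum.atLeast_Suc_atMost_Suc_shift atLeast0AtMost o_def)

lemma cube_bdry_0: "cube_bdry J 0 c = 0"
  by (simp add: cube_bdry_def frag_extend_eq_0)

lemma cube_bdry_zero: "cube_bdry J n 0 = 0"
  by (simp add: cube_bdry_def)

lemma cube_bdry_diff: "cube_bdry J n (x - y) = cube_bdry J n x - cube_bdry J n y"
  by (simp add: cube_bdry_def frag_extend_diff)

lemma cube_bdry_sum: "finite I \<Longrightarrow> cube_bdry J n (sum f I) = (\<Sum>i\<in>I. cube_bdry J n (f i))"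
  by (simp add: cube_bdry_def frag_extend_sum)

lemma cube_bdry_cmul: "cube_bdry J n (frag_cmul k x) = frag_cmul k (cube_bdry J n x)"
  by (simp add: cube_bdry_def frag_extend_cmul)

lemma cube_face_cells:
  assumes "\<sigma> \<in> cubes J X (Suc n)" "t \<in> pts J" "i \<in> {1..Suc n}"
  shows "cube_face J (Suc n) i t \<sigma> \<in> cubes J X n"
  using cells_compose[OF assms(1) cube_insert_continuous[OF closure_J assms(2,3)] closure_space_cl_power[OF closure_J]]
  by (simp add: cube_face_def)

lemma cube_bdry_cells:
  assumes "x \<in> frags (cubes J X n)"
  shows "cube_bdry J n x \<in> frags (cubes J X (n - 1))"
proof (cases n)
  case (Suc m)
  from assms show ?thesis
  proof (induction rule: frags_induct)
    case (one \<sigma>)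
    then show ?case
      unfolding cube_bdry_of faces_def Suc
      by (intro frags_sum frags_cmul frags_diff) (auto simp: cube_face_cells pts_01)
  qed (auto simp: cube_bdry_diff frags_diff cube_bdry_zero)
qed (simp add: cube_bdry_0)

lemma cube_bdry_bdry: "cube_bdry J n (cube_bdry J (Suc n) x) = 0"
proof (cases n)
  case (Suc m)
  have "x \<in> frags UNIV" by (simp add: frags_def)
  then show ?thesis
  proof (induction rule: frags_induct)
    case (one \<sigma>)
    \<comment> \<open>\<open>G i j\<close> collects the four iterated faces in two directions, with
      their signs and with indices shifted to start at 0. The identity \<open>cube_face_face\<close>
      gives it the symmetry that \<open>alternating_double_sum_eq_0\<close> asks for.\<close>
    define G where "G = (\<lambda>i j. faces (Suc m) (Suc j) (cube_face J (Suc (Suc m)) (Suc i) 0 \<sigma>) -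
      faces (Suc m) (Suc j) (cube_face J (Suc (Suc m)) (Suc i) 1 \<sigma>))"
    have "cube_bdry J (Suc m) (faces (Suc (Suc m)) (Suc i) \<sigma>) = (\<Sum>j\<le>m. frag_cmul ((-1) ^ Suc j) (G i j))" for i
      unfolding faces_def[of "Suc (Suc m)"] cube_bdry_diff cube_bdry_Suc G_def frag_cmul_diff sum_subtractf ..
    then have "cube_bdry J n (cube_bdry J (Suc n) (frag_of \<sigma>)) =
      (\<Sum>i\<le>Suc m. \<Sum>j\<le>m. frag_cmul ((-1) ^ (i + j)) (G i j))"
      unfolding Suc cube_bdry_Suc[of "Suc m"]
      by (simp add: cube_bdry_sum cube_bdry_cmul frag_cmul_sum power_add del: sum.atMost_Suc)
    also have "\<dots> = 0"
    proof (rule alternating_double_sum_eq_0)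
      fix i j assume ij: "j < i" "i \<le> Suc m"
      then show "G i j = G j (i - 1)"
        using cube_face_face[of "Suc j" "Suc i" m _ J _ \<sigma>] pts_01 by (simp add: G_def faces_def)
    qed
    finally show ?case .
  qed (auto simp: cube_bdry_diff cube_bdry_zero)
qed (simp add: cube_bdry_0)

lemma cube_face_agree:
  assumes "i \<in> {1..Suc n}" and \<sigma>: "\<forall>x\<in>pts (cl_power J (Suc n)). \<forall>y\<in>pts (cl_power J (Suc n)).
        (\<forall>k\<in>{1..Suc n}. k \<noteq> i \<longrightarrow> x k = y k) \<longrightarrow> \<sigma> x = \<sigma> y"
  shows "cube_face J (Suc n) i 0 \<sigma> = cube_face J (Suc n) i 1 \<sigma>"
  unfolding cube_face_def
proof (rule restrict_ext)
  fix x assume "x \<in> pts (cl_power J (Suc n - 1))"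
  then have x: "x \<in> {1..n} \<rightarrow>\<^sub>E pts J" by simp
  show "(\<sigma> \<circ> cube_insert (Suc n) i 0) x = (\<sigma> \<circ> cube_insert (Suc n) i 1) x"
    unfolding o_apply
  proof (rule \<sigma>[rule_format])
    show "cube_insert (Suc n) i 0 x \<in> pts (cl_power J (Suc n))"
      "cube_insert (Suc n) i 1 x \<in> pts (cl_power J (Suc n))"
      using cube_insert_mem[OF x pts_01(1) assms(1)] cube_insert_mem[OF x pts_01(2) assms(1)]
      unfolding pts_cl_power .
  qed (simp add: cube_insert_def)
qed

lemma cube_face_degenerate:
  assumes i: "i \<in> {1..Suc n}" and j: "j \<in> {1..Suc n}" "j \<noteq> i" and t: "t \<in> pts J"
    and \<sigma>: "\<forall>x\<in>pts (cl_power J (Suc n)). \<forall>y\<in>pts (cl_power J (Suc n)).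
        (\<forall>k\<in>{1..Suc n}. k \<noteq> i \<longrightarrow> x k = y k) \<longrightarrow> \<sigma> x = \<sigma> y"
  shows "degenerate_cube J n (cube_face J (Suc n) j t \<sigma>)"
  unfolding degenerate_cube_def
proof (intro bexI ballI impI)
  \<comment> \<open>Deleting coordinate \<open>j\<close> moves every later coordinate down by
    one.\<close>
  let ?i = "if i < j then i else i - 1"
  show i': "?i \<in> {1..n}" using i j unfolding atLeastAtMost_iff by (simp, linarith)
  fix x y assume xy: "x \<in> pts (cl_power J n)" "y \<in> pts (cl_power J n)"
    and eq: "\<forall>k\<in>{1..n}. k \<noteq> ?i \<longrightarrow> x k = y k"
  have "cube_insert (Suc n) j t x k = cube_insert (Suc n) j t y k" if k: "k \<in> {1..Suc n}" "k \<noteq> i" for k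
  proof -
    consider "k < j" | "k = j" | "j < k" by linarith
    then show ?thesis
    proof cases
      case 1
      then have "k \<in> {1..n}" "k \<noteq> ?i" using k j unfolding atLeastAtMost_iff by (linarith, auto)
      then show ?thesis using eq 1 k by (simp add: cube_insert_def)
    next
      case 3
      then have "k - 1 \<in> {1..n}" "k - 1 \<noteq> ?i" using k j i unfolding atLeastAtMost_iff by (linarith, auto)
      then show ?thesis using eq 3 k by (simp add: cube_insert_def)
    qed (simp add: cube_insert_def)
  qed
  moreover have "cube_insert (Suc n) j t x \<in> pts (cl_power J (Suc n))"
    "cube_insert (Suc n) j t y \<in> pts (cl_power J (Suc n))"
    using xy cube_insert_mem[OF _ t j(1)] unfolding pts_cl_power by blast+
  ultimately have "\<sigma> (cube_insert (Suc n) j t x) = \<sigma> (cube_insert (Suc n) j t y)"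
    using \<sigma> by blast
  then show "cube_face J (Suc n) j t \<sigma> x = cube_face J (Suc n) j t \<sigma> y"
    using xy by (simp only: cube_face_def restrict_apply diff_Suc_1 if_True o_apply)
qed

text \<open>In the direction that the cube ignores, the two faces are equal and cancel; each
  remaining face still ignores a direction.\<close>

lemma cube_bdry_degenerate:
  assumes "x \<in> frags (deg_cells J X n)"
  shows "cube_bdry J n x \<in> frags (deg_cells J X (n - 1))"
proof (cases n)
  case (Suc m)
  from assms show ?thesis
  proof (induction rule: frags_induct)
    case (one \<sigma>)
    then have cell: "\<sigma> \<in> cubes J X (Suc m)" and deg: "degenerate_cube J (Suc m) \<sigma>"
      by (simp_all add: deg_cells_def Suc)
    obtain i where i: "i \<in> {1..Suc m}" and \<sigma>: "\<forall>x\<in>pts (cl_power J (Suc m)). \<forall>y\<in>pts (cl_power J (Suc m)).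
        (\<forall>k\<in>{1..Suc m}. k \<noteq> i \<longrightarrow> x k = y k) \<longrightarrow> \<sigma> x = \<sigma> y"
      using deg unfolding degenerate_cube_def by (elim bexE) (rule that)
    have "faces (Suc m) j \<sigma> \<in> frags (deg_cells J X m)" if j: "j \<in> {1..Suc m}" for j
    proof (cases "j = i")
      case True
      then show ?thesis using cube_face_agree[OF i \<sigma>] by (simp add: faces_def)
    next
      case False
      then show ?thesis
        unfolding faces_def using cube_face_cells[OF cell _ j] cube_face_degenerate[OF i j False _ \<sigma>] pts_01
        by (intro frags_diff) (auto simp: deg_cells_def)
    qed
    then show ?case
      unfolding cube_bdry_of Suc by (intro frags_sum frags_cmul) simp
  qed (auto simp: cube_bdry_diff frags_diff cube_bdry_zero)
qed (simp add: cube_bdry_0)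

lemma excisive_cellsI:
  fixes X :: "'a clspace"
  assumes A: "A \<subseteq> pts X" and B: "B \<subseteq> pts X"
    and sub: "\<And>c n. c \<in> frags (cubes J X n) \<Longrightarrow> \<exists>s t.
      subdivision {cubes J X, cubes J (cl_subspace X A),
          cubes J (cl_subspace X B), deg_cells J X}
        (cubes J X) (deg_cells J X) (cube_bdry J) s t \<and>
      s n c \<in> small_chains (cl_power J n) X A B"
  shows "excisive_cells (cubes J X) (cubes J (cl_subspace X A))
      (cubes J (cl_subspace X B)) (deg_cells J X) (cube_bdry J)"
proof
  note closure_power = closure_space_cl_power[OF closure_J]
  show "cubes J (cl_subspace X A) n \<subseteq> cubes J X n"
    "cubes J (cl_subspace X B) n \<subseteq> cubes J X n" for n
    unfolding cells_subspace[OF closure_power A] cells_subspace[OF closure_power B] by blast+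
  show "cube_bdry J n x \<in> frags (U (n - 1))" if "U \<in> {cubes J X, cubes J (cl_subspace X A),
      cubes J (cl_subspace X B), deg_cells J X}" "x \<in> frags (U n)" for U n x
    using that cube_bdry_cells[of x n X] cube_bdry_cells[of x n "cl_subspace X A"]
      cube_bdry_cells[of x n "cl_subspace X B"] cube_bdry_degenerate[of x X n] by auto
qed (rule sub, assumption | simp add: cube_bdry_diff cube_bdry_0 cube_bdry_bdry deg_cells_sub)+

text \<open>As \<open>p\<close> adheres to every point, its only neighbourhood is
  \<open>pts J\<close>. Hence the point of the power with all coordinates \<open>p\<close> adheres
  to every point too, all cubes are already small, and the identity serves as subdivision.\<close>

proposition cube_inclusion_iso_dominated:
  fixes X :: "'a clspace"
  assumes X: "closure_space X" and cov: "interior_cover X {A, B}"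
    and p: "p \<in> pts J" "\<And>q. q \<in> pts J \<Longrightarrow> p \<in> cl J {q}"
  shows "cube_inclusion_iso J n (cl_subspace X B) (A \<inter> B) X A"
proof (rule cube_inclusion_iso_of_excisive[OF closure_space_cl_power[OF closure_J]])
  show AB: "A \<subseteq> pts X" "B \<subseteq> pts X"
    using cov by (auto simp: interior_cover_def)
  have nbhd: "V = pts J" if "cl_nbhd J p V" for V
  proof (rule ccontr)
    assume "V \<noteq> pts J"
    moreover have "V \<subseteq> pts J" using that by (simp add: cl_nbhd_def)
    ultimately obtain q where q: "q \<in> pts J" "q \<notin> V" by blast
    then have "cl J {q} \<subseteq> cl J (pts J - V)" by (intro closure_spaceD(5)[OF closure_J]) auto
    then show False using p(2)[OF q(1)] that by (auto simp: cl_nbhd_def cl_interior_def)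
  qed
  have "cubes J X n \<subseteq> cubes J (cl_subspace X A) n \<union> cubes J (cl_subspace X B) n" for n
  proof (rule cells_interior_cover[OF X cov closure_space_cl_power[OF closure_J]])
    show c: "restrict (\<lambda>_. p) {1..n} \<in> pts (cl_power J n)" using p(1) by simp
    show "restrict (\<lambda>_. p) {1..n} \<in> cl (cl_power J n) {q}" if q: "q \<in> pts (cl_power J n)" for q
    proof -
      have "\<forall>i\<in>{1..n}. q i \<in> V i" if "\<forall>i\<in>{1..n}. cl_nbhd J (restrict (\<lambda>_. p) {1..n} i) (V i)" for V
        using that nbhd q by (auto simp: PiE_iff)
      then show ?thesis using c q by (simp add: mem_cl_power)
    qed
  qed
  then show "excisive_cells (cubes J X) (cubes J (cl_subspace X A))
      (cubes J (cl_subspace X B)) (deg_cells J X) (cube_bdry J)"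
    by (intro excisive_cellsI[OF AB] exI[of _ "\<lambda>_ x. x"] exI[of _ "\<lambda>_ x. 0"])
      (simp add: subdivision_def cube_bdry_zero frags_mono)
qed

end

section \<open>Cubical excision for \<open>J_1\<close> and \<open>J_+\<close>\<close>

lemma cube_model_J1: "cube_model J1_space"
  by unfold_locales (auto simp: closure_space_def J1_space_def indiscrete_clspace_def)

lemma cube_model_Jp: "cube_model Jp_space"
  by unfold_locales (auto simp: closure_space_def Jp_space_def)

lemma cube_inclusion_iso_J1:
  assumes "closure_space X" "interior_cover X {A, B}"
  shows "cube_inclusion_iso J1_space n (cl_subspace X B) (A \<inter> B) X A"
  by (rule cube_model.cube_inclusion_iso_dominated[OF cube_model_J1 assms, where p = 0])
    (auto simp: J1_space_def indiscrete_clspace_def)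

lemma cube_inclusion_iso_Jp:
  assumes "closure_space X" "interior_cover X {A, B}"
  shows "cube_inclusion_iso Jp_space n (cl_subspace X B) (A \<inter> B) X A"
  \<comment> \<open>In \<open>J_+\<close> the point 1 lies in the closure of 0, but not conversely,
    so 1 is the dominating point.\<close>
  by (rule cube_model.cube_inclusion_iso_dominated[OF cube_model_Jp assms, where p = 1])
    (auto simp: Jp_space_def)

section \<open>Natural operations on chains\<close>

text \<open>The induced map of \<open>\<sigma>\<close> on chains of cells with domain
  \<open>K\<close>.\<close>

definition push :: "'r clspace \<Rightarrow> ('s \<Rightarrow> 'a) \<Rightarrow> (('r \<Rightarrow> 's) \<Rightarrow>\<^sub>0 int) \<Rightarrow> (('r \<Rightarrow> 'a) \<Rightarrow>\<^sub>0 int)" where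
  "push K \<sigma> = frag_extend (\<lambda>\<tau>. frag_of (restrict (\<sigma> \<circ> \<tau>) (pts K)))"

text \<open>As in the Yoneda lemma, a natural operation on chains amounts to its value
  \<open>u\<close> on the identity cell. On a cell \<open>\<sigma>\<close> it has to be the
  push-forward of \<open>u\<close> along \<open>\<sigma>\<close>.\<close>

definition natop :: "'r clspace \<Rightarrow> (('r \<Rightarrow> 's) \<Rightarrow>\<^sub>0 int) \<Rightarrow> (('s \<Rightarrow> 'a) \<Rightarrow>\<^sub>0 int) \<Rightarrow> (('r \<Rightarrow> 'a) \<Rightarrow>\<^sub>0 int)" where
  "natop K u = frag_extend (\<lambda>\<sigma>. push K \<sigma> u)"

lemma push_of: "push K \<sigma> (frag_of \<tau>) = frag_of (restrict (\<sigma> \<circ> \<tau>) (pts K))"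
  by (simp add: push_def)

lemma push_0 [simp]: "push K \<sigma> 0 = 0"
  by (simp add: push_def)

lemma push_diff: "push K \<sigma> (x - y) = push K \<sigma> x - push K \<sigma> y"
  by (simp add: push_def frag_extend_diff)

lemma push_sum: "finite I \<Longrightarrow> push K \<sigma> (sum f I) = (\<Sum>i\<in>I. push K \<sigma> (f i))"
  by (simp add: push_def frag_extend_sum)

lemma push_cmul: "push K \<sigma> (frag_cmul k x) = frag_cmul k (push K \<sigma> x)"
  by (simp add: push_def frag_extend_cmul)

lemma natop_of: "natop K u (frag_of \<sigma>) = push K \<sigma> u"
  by (simp add: natop_def)

lemma natop_0 [simp]: "natop K u 0 = 0"
  by (simp add: natop_def)

lemma natop_diff: "natop K u (x - y) = natop K u x - natop K u y"
  by (simp add: natop_def frag_extend_diff)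

lemma natop_sum: "finite I \<Longrightarrow> natop K u (sum f I) = (\<Sum>i\<in>I. natop K u (f i))"
  by (simp add: natop_def frag_extend_sum)

lemma natop_cmul: "natop K u (frag_cmul k x) = frag_cmul k (natop K u x)"
  by (simp add: natop_def frag_extend_cmul)

lemma push_cells:
  assumes K: "closure_space K" and \<sigma>: "\<sigma> \<in> cells L X" and u: "u \<in> frags (cells K L)"
  shows "push K \<sigma> u \<in> frags (cells K X)"
  unfolding push_def
  using u by (rule frags_frag_extend) (use cells_compose[OF \<sigma> _ K] in \<open>simp add: cells_def\<close>)

lemma natop_cells:
  assumes K: "closure_space K" and u: "u \<in> frags (cells K L)" and c: "c \<in> frags (cells L X)"
  shows "natop K u c \<in> frags (cells K X)"
  unfolding natop_def
  using c by (rule frags_frag_extend) (rule push_cells[OF K _ u])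

lemma push_restrict_compose:
  assumes u: "u \<in> frags (cells K L)"
  shows "push K (restrict (\<sigma> \<circ> \<tau>) (pts L)) u = push K \<sigma> (push K \<tau> u)"
  using u
proof (induction rule: frags_induct)
  case (one \<rho>)
  then have "\<rho> ` pts K \<subseteq> pts L" by (auto simp: cells_def cl_continuous_def)
  then have "restrict (restrict (\<sigma> \<circ> \<tau>) (pts L) \<circ> \<rho>) (pts K) = restrict (\<sigma> \<circ> restrict (\<tau> \<circ> \<rho>) (pts K)) (pts K)"
    by (auto simp: fun_eq_iff)
  then show ?case by (simp only: push_of)
qed (simp_all add: push_diff)

text \<open>Naturality, by associativity of composition. The cells of \<open>u\<close> take values
  in \<open>L\<close>, so restricting a composite to the points of \<open>L\<close> does not affect
  what is pushed.\<close>

lemma natop_push: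
  assumes u: "u \<in> frags (cells K L)"
  shows "natop K u (push L \<sigma> c) = push K \<sigma> (natop K u c)"
proof -
  have "c \<in> frags UNIV" by (simp add: frags_def)
  then show ?thesis
    by (induction rule: frags_induct)
      (simp_all add: push_of natop_of push_restrict_compose[OF u] push_diff natop_diff)
qed

definition id_cell :: "'s clspace \<Rightarrow> 's \<Rightarrow> 's" where
  "id_cell K = restrict (\<lambda>x. x) (pts K)"

lemma id_cell_in_cells:
  assumes "closure_space K"
  shows "id_cell K \<in> cells K K"
  using cl_continuous_restrict[OF assms, of K "\<lambda>x. x"]
  by (simp add: id_cell_def cells_def cl_continuous_def)

lemma push_id_cell:
  assumes "\<sigma> \<in> extensional (pts K)"
  shows "push K \<sigma> (frag_of (id_cell K)) = frag_of \<sigma>"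
proof -
  have "restrict (\<sigma> \<circ> id_cell K) (pts K) = \<sigma>"
    using assms by (auto simp: id_cell_def extensional_def fun_eq_iff)
  then show ?thesis by (simp only: push_of)
qed

text \<open>
  Natural transformations of chain complexes, and natural homotopies between them, need only be
  checked on the identity cells.
\<close>

lemma natop_chain_map:
  fixes K :: "nat \<Rightarrow> 's clspace"
  assumes bd_diff: "\<And>m (x :: ('s \<Rightarrow> 'a) \<Rightarrow>\<^sub>0 int) y. bd m (x - y) = bd m x - bd m y"
    and nat: "\<And>m (\<sigma> :: 's \<Rightarrow> 'a) u. u \<in> frags (cells (K m) (K n)) \<Longrightarrow> bd m (push (K m) \<sigma> u) = push (K (m - 1)) \<sigma> (bd' m u)"
    and clo: "\<And>m. closure_space (K m)" and s: "\<And>m. s m \<in> frags (cells (K m) (K m))"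
    and model: "bd' n (s n) = natop (K (n - 1)) (s (n - 1)) (bd' n (frag_of (id_cell (K n))))"
    and x: "x \<in> frags (cells (K n) X)"
  shows "bd n (natop (K n) (s n) x) = natop (K (n - 1)) (s (n - 1)) (bd n x)"
  using x
proof (induction rule: frags_induct)
  case zero
  show ?case using bd_diff[of n 0 0] by simp
next
  case (one \<sigma>)
  then have \<sigma>: "push (K n) \<sigma> (frag_of (id_cell (K n))) = frag_of \<sigma>"
    by (simp add: push_id_cell cells_def)
  have i: "frag_of (id_cell (K n)) \<in> frags (cells (K n) (K n))"
    using id_cell_in_cells[OF clo] by simp
  have "bd n (natop (K n) (s n) (frag_of \<sigma>)) = push (K (n - 1)) \<sigma> (bd' n (s n))"
    by (simp add: natop_of nat[OF s])
  also have "\<dots> = natop (K (n - 1)) (s (n - 1)) (push (K (n - 1)) \<sigma> (bd' n (frag_of (id_cell (K n)))))"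
    unfolding model natop_push[OF s] ..
  also have "\<dots> = natop (K (n - 1)) (s (n - 1)) (bd n (frag_of \<sigma>))"
    using nat[OF i, of \<sigma>] \<sigma> by simp
  finally show ?case .
qed (simp_all add: bd_diff natop_diff)

lemma natop_homotopy:
  fixes K :: "nat \<Rightarrow> 's clspace"
  assumes bd_diff: "\<And>m (x :: ('s \<Rightarrow> 'a) \<Rightarrow>\<^sub>0 int) y. bd m (x - y) = bd m x - bd m y"
    and bd_0: "\<And>x. bd 0 x = 0" "\<And>x. bd' 0 x = 0"
    and nat: "\<And>m (\<sigma> :: 's \<Rightarrow> 'a) u. u \<in> frags (cells (K m) (K n)) \<Longrightarrow> bd m (push (K m) \<sigma> u) = push (K (m - 1)) \<sigma> (bd' m u)"
    and clo: "\<And>m. closure_space (K m)" and s: "\<And>m. s m \<in> frags (cells (K m) (K m))"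
    and t: "\<And>m. t m \<in> frags (cells (K (Suc m)) (K m))"
    and model: "s n - frag_of (id_cell (K n)) - bd' (Suc n) (t n) -
        natop (K n) (t (n - 1)) (bd' n (frag_of (id_cell (K n)))) \<in> frags D"
    and D: "\<And>\<sigma> u. \<sigma> \<in> cells (K n) X \<Longrightarrow> u \<in> frags D \<Longrightarrow> push (K n) \<sigma> u \<in> frags D'"
    and x: "x \<in> frags (cells (K n) X)"
  shows "natop (K n) (s n) x - x - bd (Suc n) (natop (K (Suc n)) (t n) x) -
    natop (K (Suc (n - 1))) (t (n - 1)) (bd n x) \<in> frags D'"
  using x
proof (induction rule: frags_induct)
  case zero
  show ?case using bd_diff[of _ 0 0] by simp
next
  case (one \<sigma>)
  then have \<sigma>: "push (K n) \<sigma> (frag_of (id_cell (K n))) = frag_of \<sigma>"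
    by (simp add: push_id_cell cells_def)
  have i: "frag_of (id_cell (K n)) \<in> frags (cells (K n) (K n))"
    using id_cell_in_cells[OF clo] by simp
  have "natop (K (Suc (n - 1))) (t (n - 1)) (bd n (frag_of \<sigma>)) =
      push (K n) \<sigma> (natop (K n) (t (n - 1)) (bd' n (frag_of (id_cell (K n)))))"
  \<comment> \<open>For \<open>n = 0\<close> the index \<open>Suc (n - 1)\<close> is 1 instead of
    \<open>n\<close>; both sides are then zero because the boundary in degree 0 is.\<close>
  proof (cases n)
    case (Suc k)
    have "natop (K n) (t k) (bd n (frag_of \<sigma>)) = natop (K n) (t k) (push (K k) \<sigma> (bd' n (frag_of (id_cell (K n)))))"
      using nat[OF i, of \<sigma>] \<sigma> Suc by simp
    then show ?thesis
      using natop_push[of "t k" "K n" "K k"] t[of k] Suc by simp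
  qed (simp add: bd_0)
  then have "natop (K n) (s n) (frag_of \<sigma>) - frag_of \<sigma> - bd (Suc n) (natop (K (Suc n)) (t n) (frag_of \<sigma>)) -
      natop (K (Suc (n - 1))) (t (n - 1)) (bd n (frag_of \<sigma>)) =
    push (K n) \<sigma> (s n - frag_of (id_cell (K n)) - bd' (Suc n) (t n) -
        natop (K n) (t (n - 1)) (bd' n (frag_of (id_cell (K n)))))"
    using nat[OF t, of \<sigma>] by (simp add: push_diff \<sigma> natop_of)
  then show ?case
    using D[OF one model] by simp
next
  case (diff a b)
  have eq: "natop (K n) (s n) (a - b) - (a - b) - bd (Suc n) (natop (K (Suc n)) (t n) (a - b)) -
      natop (K (Suc (n - 1))) (t (n - 1)) (bd n (a - b)) =
    (natop (K n) (s n) a - a - bd (Suc n) (natop (K (Suc n)) (t n) a) - natop (K (Suc (n - 1))) (t (n - 1)) (bd n a)) -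
    (natop (K n) (s n) b - b - bd (Suc n) (natop (K (Suc n)) (t n) b) - natop (K (Suc (n - 1))) (t (n - 1)) (bd n b))"
    by (simp add: bd_diff natop_diff algebra_simps)
  show ?case
    unfolding eq by (rule frags_diff[OF diff])
qed

section \<open>Topological spaces as closure spaces\<close>

lemma closure_space_of_topology: "closure_space (clspace_of_topology T)"
  by (auto simp: closure_space_def clspace_of_topology_def closure_of_subset_topspace closure_of_subset closure_of_Un)

lemma cl_continuous_of_continuous_map:
  "continuous_map T T' f \<Longrightarrow> cl_continuous (clspace_of_topology T) (clspace_of_topology T') f"
  by (auto simp: cl_continuous_def clspace_of_topology_def continuous_map_image_subset_topspace[THEN subsetD]
      continuous_map_image_closure_subset[THEN subsetD])

text \<open>In \<open>X\<close> an interior need not be open, but in the topological domain of the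
  cell it is. A point mapped into the interior of \<open>C\<close> cannot adhere to the points
  mapped outside \<open>C\<close>, since continuity would put its image into the closure of the
  complement of \<open>C\<close>.\<close>

lemma pullback_interior_cover:
  assumes X: "closure_space X" and cov: "interior_cover X {A, B}"
    and \<sigma>: "\<sigma> \<in> cells (clspace_of_topology T) X"
  obtains U V where "openin T U" "openin T V" "topspace T \<subseteq> U \<union> V" "\<sigma> ` U \<subseteq> A" "\<sigma> ` V \<subseteq> B"
proof -
  have \<sigma>c: "\<sigma> ` topspace T \<subseteq> pts X"
    "\<And>S. S \<subseteq> topspace T \<Longrightarrow> \<sigma> ` (T closure_of S) \<subseteq> cl X (\<sigma> ` S)"
    using \<sigma> by (auto simp: cells_def cl_continuous_def clspace_of_topology_def)
  \<comment> \<open>The topological interior of the preimage of \<open>C\<close>.\<close>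
  define W where "W = (\<lambda>C. topspace T - T closure_of {x \<in> topspace T. \<sigma> x \<notin> C})"
  have W1: "openin T (W C)" for C
    unfolding W_def by (rule openin_diff) auto
  have W2: "\<sigma> ` W C \<subseteq> C" for C
  proof (rule image_subsetI, rule ccontr)
    fix x assume "x \<in> W C" "\<sigma> x \<notin> C"
    then show False
      using closure_of_subset[of "{x \<in> topspace T. \<sigma> x \<notin> C}" T] by (auto simp: W_def)
  qed
  have "x \<in> W C" if x: "x \<in> topspace T" "\<sigma> x \<in> cl_interior X C" for x C
  proof (rule ccontr)
    assume "x \<notin> W C"
    then have "\<sigma> x \<in> \<sigma> ` (T closure_of {x \<in> topspace T. \<sigma> x \<notin> C})"
      using x(1) by (auto simp: W_def)
    also have "\<dots> \<subseteq> cl X (\<sigma> ` {x \<in> topspace T. \<sigma> x \<notin> C})"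
      by (rule \<sigma>c(2)) auto
    also have "\<dots> \<subseteq> cl X (pts X - C)"
    proof (rule closure_spaceD(5)[OF X])
      show "\<sigma> ` {x \<in> topspace T. \<sigma> x \<notin> C} \<subseteq> pts X - C"
        using \<sigma>c(1) by blast
    qed simp
    finally show False using x(2) by (simp add: cl_interior_def)
  qed
  moreover have "\<sigma> x \<in> cl_interior X A \<or> \<sigma> x \<in> cl_interior X B" if "x \<in> topspace T" for x
    using that \<sigma>c(1) cov by (auto simp: interior_cover_def)
  ultimately have "topspace T \<subseteq> W A \<union> W B" by blast
  then show ?thesis using that[of "W A" "W B"] W1 W2 by simp
qed

section \<open>Topological simplices\<close>

abbreviation simplex_space :: "nat \<Rightarrow> (nat \<Rightarrow> real) clspace" where
  "simplex_space \<equiv> simplex I_simplices"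

lemma simplex_space_eq:
  "simplex_space n = clspace_of_topology (subtopology (powertop_real UNIV) (standard_simplex n))"
  by (simp add: I_simplices_def)

lemma pts_simplex_space [simp]: "pts (simplex_space n) = standard_simplex n"
  by (simp add: simplex_space_eq clspace_of_topology_def)

lemma coface_I [simp]: "coface I_simplices = simplical_face"
  by (simp add: I_simplices_def)

abbreviation simplex_maps :: "nat \<Rightarrow> nat \<Rightarrow> ((nat \<Rightarrow> real) \<Rightarrow> nat \<Rightarrow> real) set" where
  "simplex_maps m n \<equiv> cells (simplex_space m) (simplex_space n)"

lemma singular_simplex_in_cells:
  "singular_simplex m (subtopology (powertop_real UNIV) (standard_simplex n)) f \<Longrightarrow> f \<in> simplex_maps m n"
  unfolding singular_simplex_def cells_def mem_Collect_eq pts_simplex_space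
  unfolding simplex_space_eq by (blast intro: cl_continuous_of_continuous_map)

lemma simplicial_chain_in_cells:
  "simplicial_chain m (standard_simplex n) c \<Longrightarrow> c \<in> frags (simplex_maps m n)"
  using simplicial_imp_singular_chain[of m "standard_simplex n" c] singular_simplex_in_cells
  by (auto simp: singular_chain_def frags_def)

lemma sing_bdry_I: "sing_bdry I_simplices = chain_boundary"
  by (intro ext) (simp add: sing_bdry_def chain_boundary_def singular_face_def atLeast0AtMost)

lemma push_I: "push (simplex_space n) = chain_map n"
  by (intro ext) (simp add: push_def chain_map_def simplex_map_def o_def)

lemma id_cell_I: "id_cell (simplex_space n) = restrict id (standard_simplex n)"
  by (simp add: id_cell_def id_def)

lemma coface_model_I: "coface_model I_simplices"
proof
  show "closure_space (simplex_space n)" for n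
    by (simp add: simplex_space_eq closure_space_of_topology)
  show "cl_continuous (simplex_space n) (simplex_space (Suc n)) (coface I_simplices i)" if i: "i \<le> Suc n" for i n
  proof -
    \<comment> \<open>On the simplex the coface map is the \<open>i\<close>-th face of the identity
      simplex, so it is continuous as a singular simplex.\<close>
    have "singular_simplex (Suc n) (subtopology (powertop_real UNIV) (standard_simplex (Suc n))) (restrict id (standard_simplex (Suc n)))"
      by (simp add: simplicial_imp_singular_simplex)
    then have "singular_face (Suc n) i (restrict id (standard_simplex (Suc n))) \<in> simplex_maps n (Suc n)"
      using singular_simplex_singular_face[OF _ _ i] by (intro singular_simplex_in_cells) (simp del: singular_face_restrict)
    moreover have "singular_face (Suc n) i (restrict id (standard_simplex (Suc n))) = restrict (coface I_simplices i) (pts (simplex_space n))"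
      using i simplical_face_in_standard_simplex[of "Suc n" i] by (auto simp: singular_face_def fun_eq_iff)
    ultimately show ?thesis
      using cl_continuous_restrict[OF \<open>\<And>n. closure_space (simplex_space n)\<close>,
          of n "simplex_space (Suc n)" "simplical_face i"] by (simp add: cells_def)
  qed
  show "coface I_simplices i (coface I_simplices j x) = coface I_simplices j (coface I_simplices (i - 1) x)"
    if "j < i" "i \<le> Suc (Suc n)" for i j n x
    using that by (auto simp: simplical_face_def fun_eq_iff)
qed

interpretation I_simplex: coface_model I_simplices
  by (rule coface_model_I)

text \<open>This chain and \<open>sdh_model\<close> are the values of barycentric subdivision and of
  its homotopy on the identity simplex; \<open>natop\<close> spreads them to cells of arbitrary
  closure spaces.\<close>

abbreviation sd_model :: "nat \<Rightarrow> ((nat \<Rightarrow> real) \<Rightarrow> (nat \<Rightarrow> real)) \<Rightarrow>\<^sub>0 int" where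
  "sd_model n \<equiv> simplicial_subdivision n (frag_of (id_cell (simplex_space n)))"

abbreviation sdh_model :: "nat \<Rightarrow> ((nat \<Rightarrow> real) \<Rightarrow> (nat \<Rightarrow> real)) \<Rightarrow>\<^sub>0 int" where
  "sdh_model n \<equiv> subd n (frag_of (id_cell (simplex_space n)))"

lemma id_cell_chain: "simplicial_chain n (standard_simplex n) (frag_of (id_cell (simplex_space n)))"
  by (simp add: id_cell_I)

lemma sd_model_cells: "sd_model n \<in> frags (simplex_maps n n)"
  using simplicial_chain_simplicial_subdivision[OF id_cell_chain] by (rule simplicial_chain_in_cells)

lemma sdh_model_cells: "sdh_model n \<in> frags (simplex_maps (Suc n) n)"
  using chain_homotopic_simplicial_subdivision2[OF id_cell_chain] by (rule simplicial_chain_in_cells)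

lemma natop_sd: "natop (simplex_space n) (sd_model n) = singular_subdivision n"
  by (simp add: natop_def singular_subdivision_def push_I id_cell_I)

text \<open>On simplicial chains \<open>natop\<close> gives back \<open>subd\<close>, because
  \<open>subd\<close> commutes with the maps induced by simplicial simplices. This identifies the
  term on the boundary of the identity simplex in the homotopy formula.\<close>

lemma natop_sdh:
  assumes "simplicial_chain p (standard_simplex q) c"
  shows "natop (simplex_space (Suc p)) (sdh_model p) c = subd p c"
proof -
  have "c \<in> frags {g. simplicial_simplex p (standard_simplex q) g}"
    using assms by (simp add: simplicial_chain_def frags_def)
  then show ?thesis
  proof (induction rule: frags_induct)
    case (one g)
    then have g: "simplicial_simplex p (standard_simplex q) g" by simp
    then have "g \<in> extensional (pts (simplex_space p))"
      by (simp add: simplicial_simplex_def singular_simplex_def)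
    then have "chain_map p g (frag_of (id_cell (simplex_space p))) = frag_of g"
      using push_id_cell[of g "simplex_space p"] by (simp only: push_I)
    then show ?case
      using chain_homotopic_simplicial_subdivision1[OF id_cell_chain g]
      by (simp only: natop_of push_I)
  qed (simp_all add: natop_diff)
qed

lemma (in coface_model) sing_bdry_push:
  "sing_bdry \<Delta> m (push (simplex \<Delta> m) \<sigma> u) = push (simplex \<Delta> (m - 1)) \<sigma> (sing_bdry \<Delta> m u)"
proof (cases m)
  case (Suc k)
  have "u \<in> frags UNIV" by (simp add: frags_def)
  then show ?thesis
  proof (induction rule: frags_induct)
    case (one \<tau>)
    have "face k i (restrict (\<sigma> \<circ> \<tau>) (pts (simplex \<Delta> (Suc k)))) = restrict (\<sigma> \<circ> face k i \<tau>) (pts (simplex \<Delta> k))"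
      if "i \<le> Suc k" for i
      using coface_continuous[OF that] by (auto simp: face_def cl_continuous_def fun_eq_iff)
    then show ?case
      by (simp add: Suc push_of sing_bdry_Suc push_sum push_cmul del: sum.atMost_Suc)
  qed (simp_all add: sing_bdry_zero sing_bdry_diff push_diff)
qed (simp add: sing_bdry_0)

section \<open>Barycentric subdivision of simplices in a closure space\<close>

lemma singular_subdivision_cells:
  "x \<in> frags (cells (simplex_space n) X) \<Longrightarrow> singular_subdivision n x \<in> frags (cells (simplex_space n) X)"
  unfolding natop_sd[symmetric] by (rule natop_cells[OF I_simplex.closure_simplex sd_model_cells])

text \<open>The target is only a closure space, so the property is checked on the identity simplex
  and transported by naturality.\<close>

lemma singular_subdivision_chain_map:
  assumes "x \<in> frags (cells (simplex_space n) X)"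
  shows "chain_boundary n (singular_subdivision n x) = singular_subdivision (n - 1) (chain_boundary n x)"
proof -
  have "simplicial_chain (n - 1) (standard_simplex n) (chain_boundary n (frag_of (id_cell (simplex_space n))))"
    using simplicial_chain_boundary[OF id_cell_chain] by simp
  then have model: "chain_boundary n (sd_model n) =
      natop (simplex_space (n - 1)) (sd_model (n - 1)) (chain_boundary n (frag_of (id_cell (simplex_space n))))"
    by (simp only: natop_sd chain_boundary_simplicial_subdivision[OF id_cell_chain] singular_subdivision_simplicial_simplex)
  show ?thesis
    using natop_chain_map[where bd = chain_boundary and bd' = chain_boundary and K = simplex_space and s = sd_model,
        OF chain_boundary_diff I_simplex.sing_bdry_push[unfolded sing_bdry_I] I_simplex.closure_simplex sd_model_cells model assms]
    by (simp only: natop_sd)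
qed

text \<open>For simplices nothing degenerate is divided out: the error term of
  \<open>natop_homotopy\<close> lies in \<open>frags {}\<close>, and the identity is exact.\<close>

lemma singular_subdivision_homotopy:
  assumes "x \<in> frags (cells (simplex_space n) X)"
  shows "chain_boundary (Suc n) (natop (simplex_space (Suc n)) (sdh_model n) x) +
    natop (simplex_space (Suc (n - 1))) (sdh_model (n - 1)) (chain_boundary n x) = singular_subdivision n x - x"
proof -
  have "natop (simplex_space n) (sdh_model (n - 1)) (chain_boundary n (frag_of (id_cell (simplex_space n)))) =
      subd (n - 1) (chain_boundary n (frag_of (id_cell (simplex_space n))))"
  proof (cases n)
    case (Suc m)
    then show ?thesis
      using natop_sdh[of m n] simplicial_chain_boundary[OF id_cell_chain[of n]] by simp
  qed (simp add: chain_boundary_def)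
  then have model: "sd_model n - frag_of (id_cell (simplex_space n)) - chain_boundary (Suc n) (sdh_model n) -
      natop (simplex_space n) (sdh_model (n - 1)) (chain_boundary n (frag_of (id_cell (simplex_space n)))) \<in> frags {}"
    by (simp add: chain_homotopic_simplicial_subdivision3[OF id_cell_chain])
  have b0: "chain_boundary 0 c = 0" for c :: "((nat \<Rightarrow> real) \<Rightarrow> 'c) \<Rightarrow>\<^sub>0 int"
    by (simp add: chain_boundary_def)
  have "natop (simplex_space n) (sd_model n) x - x - chain_boundary (Suc n) (natop (simplex_space (Suc n)) (sdh_model n) x) -
      natop (simplex_space (Suc (n - 1))) (sdh_model (n - 1)) (chain_boundary n x) \<in> frags {}"
    by (rule natop_homotopy[where bd = chain_boundary and bd' = chain_boundary and K = simplex_space and s = sd_model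
        and t = sdh_model, OF chain_boundary_diff b0 b0 I_simplex.sing_bdry_push[unfolded sing_bdry_I] I_simplex.closure_simplex
        sd_model_cells sdh_model_cells model _ assms]) (simp add: frags_empty)
  then show ?thesis
    by (simp add: frags_empty natop_sd algebra_simps)
qed

section \<open>Iterated subdivision and small simplices\<close>

lemma iterated_subdivision_cells:
  "x \<in> frags (cells (simplex_space n) X) \<Longrightarrow> (singular_subdivision n ^^ k) x \<in> frags (cells (simplex_space n) X)"
  by (induction k) (simp_all add: singular_subdivision_cells)

lemma iterated_subdivision_chain_map:
  "x \<in> frags (cells (simplex_space n) X) \<Longrightarrow>
    chain_boundary n ((singular_subdivision n ^^ k) x) = (singular_subdivision (n - 1) ^^ k) (chain_boundary n x)"
  by (induction k) (simp_all add: singular_subdivision_chain_map[OF iterated_subdivision_cells])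

text \<open>Homotopies compose: if \<open>t\<close> belongs to \<open>k\<close> subdivisions and
  \<open>T\<close> to a single one, then \<open>t\<close> after one subdivision, plus
  \<open>T\<close>, belongs to \<open>Suc k\<close>. One \<open>t\<close> serves all spaces
  \<open>X\<close>, hence it preserves the chains of subspaces.\<close>

lemma iterated_subdivision_homotopy:
  "\<exists>t :: nat \<Rightarrow> (((nat \<Rightarrow> real) \<Rightarrow> 'a) \<Rightarrow>\<^sub>0 int) \<Rightarrow> ((nat \<Rightarrow> real) \<Rightarrow> 'a) \<Rightarrow>\<^sub>0 int.
    (\<forall>m x y. t m (x - y) = t m x - t m y) \<and>
    (\<forall>X m. \<forall>x\<in>frags (cells (simplex_space m) X). t m x \<in> frags (cells (simplex_space (Suc m)) X) \<and>
      chain_boundary (Suc m) (t m x) + t (m - 1) (chain_boundary m x) = (singular_subdivision m ^^ k) x - x)"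
proof (induction k)
  case 0
  show ?case by (rule exI[of _ "\<lambda>_ _. 0"]) simp
next
  case (Suc k)
  then obtain t :: "nat \<Rightarrow> (((nat \<Rightarrow> real) \<Rightarrow> 'a) \<Rightarrow>\<^sub>0 int) \<Rightarrow> ((nat \<Rightarrow> real) \<Rightarrow> 'a) \<Rightarrow>\<^sub>0 int"
    where t: "\<And>m x y. t m (x - y) = t m x - t m y"
      "\<And>X m x. x \<in> frags (cells (simplex_space m) X) \<Longrightarrow> t m x \<in> frags (cells (simplex_space (Suc m)) X)"
      "\<And>X m x. x \<in> frags (cells (simplex_space m) X) \<Longrightarrow>
        chain_boundary (Suc m) (t m x) + t (m - 1) (chain_boundary m x) = (singular_subdivision m ^^ k) x - x"
    by blast
  let ?T = "\<lambda>m. natop (simplex_space (Suc m)) (sdh_model m)"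
  show ?case
  proof (intro exI[of _ "\<lambda>m x. t m (singular_subdivision m x) + ?T m x"] conjI allI ballI)
    fix m x y
    show "t m (singular_subdivision m (x - y)) + ?T m (x - y) =
        t m (singular_subdivision m x) + ?T m x - (t m (singular_subdivision m y) + ?T m y)"
      by (simp add: singular_subdivision_diff t(1) natop_diff)
  next
    fix X :: "'a clspace" and m x
    assume x: "x \<in> frags (cells (simplex_space m) X)"
    show "t m (singular_subdivision m x) + ?T m x \<in> frags (cells (simplex_space (Suc m)) X)"
      by (intro frags_add t(2) singular_subdivision_cells x natop_cells[OF I_simplex.closure_simplex sdh_model_cells])
    have "chain_boundary (Suc m) (t m (singular_subdivision m x) + ?T m x) +
        (t (m - 1) (singular_subdivision (m - 1) (chain_boundary m x)) + ?T (m - 1) (chain_boundary m x)) =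
      (chain_boundary (Suc m) (t m (singular_subdivision m x)) + t (m - 1) (chain_boundary m (singular_subdivision m x)))
      + (chain_boundary (Suc m) (?T m x) + ?T (m - 1) (chain_boundary m x))"
      by (simp add: chain_boundary_add singular_subdivision_chain_map[OF x])
    also have "\<dots> = (singular_subdivision m ^^ Suc k) x - x"
      unfolding t(3)[OF singular_subdivision_cells[OF x]] singular_subdivision_homotopy[OF x]
      by (simp add: funpow_swap1)
    finally show "chain_boundary (Suc m) (t m (singular_subdivision m x) + ?T m x) +
        (t (m - 1) (singular_subdivision (m - 1) (chain_boundary m x)) + ?T (m - 1) (chain_boundary m x)) =
      (singular_subdivision m ^^ Suc k) x - x" .
  qed
qed

lemma iterated_subdivision_push:
  "(singular_subdivision n ^^ k) (push (simplex_space n) \<sigma> c) = push (simplex_space n) \<sigma> ((singular_subdivision n ^^ k) c)"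
proof (induction k)
  case (Suc k)
  then show ?case
    using natop_push[OF sd_model_cells[of n], of \<sigma>] by (simp add: natop_sd)
qed simp

text \<open>For a single cell, the identity simplex is subdivided until it is subordinate to the
  pulled back open cover, and the result is pushed forward. Smallness for all large \<open>m\<close>
  allows the bounds for several cells to be combined by a maximum.\<close>

lemma iterated_subdivision_small:
  assumes X: "closure_space X" and cov: "interior_cover X {A, B}"
    and c: "c \<in> frags (cells (simplex_space n) X)"
  shows "\<exists>k. \<forall>m\<ge>k. (singular_subdivision n ^^ m) c \<in>
    small_chains (simplex_space n) X A B"
  using c
proof (induction rule: frags_induct)
  case (one \<sigma>)
  have AB: "A \<subseteq> pts X" "B \<subseteq> pts X"
    using cov by (auto simp: interior_cover_def)
  let ?T = "subtopology (powertop_real UNIV) (standard_simplex n)"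
  obtain U V where UV: "openin ?T U" "openin ?T V" "topspace ?T \<subseteq> U \<union> V" "\<sigma> ` U \<subseteq> A" "\<sigma> ` V \<subseteq> B"
    using pullback_interior_cover[OF X cov] one unfolding simplex_space_eq by blast
  let ?i = "frag_of (id_cell (simplex_space n))"
  have i: "singular_chain n ?T ?i"
    by (rule simplicial_imp_singular_chain[OF id_cell_chain])
  obtain k where k: "\<And>m f. k \<le> m \<Longrightarrow> f \<in> Poly_Mapping.keys ((singular_subdivision n ^^ m) ?i)
      \<Longrightarrow> \<exists>W\<in>{U, V}. f \<in> standard_simplex n \<rightarrow> W"
    by (rule sufficient_iterated_singular_subdivision_exists[of "{U, V}" ?T n ?i]) (use UV i in auto)
  show ?case
  proof (intro exI allI impI)
    fix m assume m: "k \<le> m"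
    have ic: "(singular_subdivision n ^^ m) ?i \<in> frags (simplex_maps n n)"
      using id_cell_in_cells[OF I_simplex.closure_simplex] by (intro iterated_subdivision_cells) simp
    have "frag_of \<sigma> = push (simplex_space n) \<sigma> ?i"
      using one by (simp add: push_id_cell cells_def)
    then have "(singular_subdivision n ^^ m) (frag_of \<sigma>) = push (simplex_space n) \<sigma> ((singular_subdivision n ^^ m) ?i)"
      by (simp only: iterated_subdivision_push)
    also have "\<dots> \<in> small_chains (simplex_space n) X A B"
      unfolding push_def
    proof (rule frags_frag_extend)
      show "(singular_subdivision n ^^ m) ?i \<in> frags (Poly_Mapping.keys ((singular_subdivision n ^^ m) ?i))"
        by (simp add: frags_def)
      fix f assume f: "f \<in> Poly_Mapping.keys ((singular_subdivision n ^^ m) ?i)"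
      then have "f \<in> simplex_maps n n"
        using ic by (auto simp: frags_def)
      then have cell: "restrict (\<sigma> \<circ> f) (pts (simplex_space n)) \<in> cells (simplex_space n) X"
        using cells_compose[OF one _ I_simplex.closure_simplex] by (simp add: cells_def)
      have "restrict (\<sigma> \<circ> f) (pts (simplex_space n)) ` pts (simplex_space n) \<subseteq> A \<or>
          restrict (\<sigma> \<circ> f) (pts (simplex_space n)) ` pts (simplex_space n) \<subseteq> B"
        using k[OF m f] UV(4,5) by (fastforce simp: Pi_iff)
      then show "frag_of (restrict (\<sigma> \<circ> f) (pts (simplex_space n))) \<in>
          small_chains (simplex_space n) X A B"
        using cell unfolding cells_subspace[OF I_simplex.closure_simplex AB(1)] cells_subspace[OF I_simplex.closure_simplex AB(2)]
        by (simp only: frags_frag_of) blast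
    qed
    finally show "(singular_subdivision n ^^ m) (frag_of \<sigma>) \<in>
        small_chains (simplex_space n) X A B" .
  qed
next
  case (diff a b)
  then obtain k l where "\<forall>m\<ge>k. (singular_subdivision n ^^ m) a \<in>
      small_chains (simplex_space n) X A B"
    "\<forall>m\<ge>l. (singular_subdivision n ^^ m) b \<in>
      small_chains (simplex_space n) X A B"
    by blast
  then show ?case
    by (intro exI[of _ "max k l"]) (simp add: singular_subdivision_power_diff frags_diff)
qed simp

proposition sing_inclusion_iso_I:
  fixes X :: "'a clspace"
  assumes X: "closure_space X" and cov: "interior_cover X {A, B}"
  shows "sing_inclusion_iso I_simplices n (cl_subspace X B) (A \<inter> B) X A"
proof (rule sing_inclusion_iso_of_excisive[OF I_simplex.closure_simplex])
  show AB: "A \<subseteq> pts X" "B \<subseteq> pts X"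
    using cov by (auto simp: interior_cover_def)
  show "excisive_cells (\<lambda>n. cells (simplex_space n) X) (\<lambda>n. cells (simplex_space n) (cl_subspace X A))
     (\<lambda>n. cells (simplex_space n) (cl_subspace X B)) (\<lambda>_. {}) (sing_bdry I_simplices)"
  proof (rule I_simplex.excisive_cellsI[OF AB])
    fix c n assume "c \<in> frags (cells (simplex_space n) X)"
    from iterated_subdivision_small[OF X cov this] obtain k where k: "(singular_subdivision n ^^ k) c \<in>
        small_chains (simplex_space n) X A B"
      by blast
    obtain t :: "nat \<Rightarrow> (((nat \<Rightarrow> real) \<Rightarrow> 'a) \<Rightarrow>\<^sub>0 int) \<Rightarrow> ((nat \<Rightarrow> real) \<Rightarrow> 'a) \<Rightarrow>\<^sub>0 int"
      where t: "\<And>m x y. t m (x - y) = t m x - t m y"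
        "\<And>X m x. x \<in> frags (cells (simplex_space m) X) \<Longrightarrow> t m x \<in> frags (cells (simplex_space (Suc m)) X)"
        "\<And>X m x. x \<in> frags (cells (simplex_space m) X) \<Longrightarrow>
          chain_boundary (Suc m) (t m x) + t (m - 1) (chain_boundary m x) = (singular_subdivision m ^^ k) x - x"
      using iterated_subdivision_homotopy[of k] by blast
    have "(singular_subdivision m ^^ k) 0 = 0" "t m 0 = 0" for m
      using t(1)[of m 0 0] by simp_all
    then have "subdivision {\<lambda>n. cells (simplex_space n) X, \<lambda>n. cells (simplex_space n) (cl_subspace X A),
          \<lambda>n. cells (simplex_space n) (cl_subspace X B), \<lambda>_. {}}
        (\<lambda>n. cells (simplex_space n) X) (\<lambda>_. {}) chain_boundary (\<lambda>m. singular_subdivision m ^^ k) t"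
      unfolding subdivision_def
      by (simp add: singular_subdivision_power_diff t(1,2) t(3)[symmetric] iterated_subdivision_cells
          iterated_subdivision_chain_map frags_empty)
    then show "\<exists>s t. subdivision {\<lambda>n. cells (simplex_space n) X, \<lambda>n. cells (simplex_space n) (cl_subspace X A),
          \<lambda>n. cells (simplex_space n) (cl_subspace X B), \<lambda>_. {}}
        (\<lambda>n. cells (simplex_space n) X) (\<lambda>_. {}) (sing_bdry I_simplices) s t \<and>
      s n c \<in> small_chains (simplex_space n) X A B"
      unfolding sing_bdry_I using k by blast
  qed
qed

section \<open>Topological cubes\<close>

definition cube :: "nat \<Rightarrow> (nat \<Rightarrow> real) set" where
  "cube n = {1..n} \<rightarrow>\<^sub>E {0..1}"

abbreviation cube_space :: "nat \<Rightarrow> (nat \<Rightarrow> real) clspace" where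
  "cube_space \<equiv> cl_power I_space"

lemma pts_I_space: "pts I_space = {0..1}"
  by (simp add: I_space_def clspace_of_topology_def)

lemma closure_I_space: "closure_space I_space"
  by (simp add: I_space_def closure_space_of_topology)

lemma pts_cube_space: "pts (cube_space n) = cube n"
  by (simp add: cube_def pts_I_space)

interpretation I_cube: cube_model I_space
  by unfold_locales (simp_all add: closure_I_space pts_I_space)

lemma closure_cube_space: "closure_space (cube_space n)"
  by (rule closure_space_cl_power[OF closure_I_space])

lemma cl_nbhd_I_space:
  "cl_nbhd I_space t V \<longleftrightarrow> V \<subseteq> {0..1} \<and> t \<in> {0..1} \<and> (\<exists>T. open T \<and> t \<in> T \<and> T \<inter> {0..1} \<subseteq> V)"
proof -
  have "cl_interior I_space V = top_of_set {0..1} interior_of V"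
    by (simp add: interior_of_closure_of cl_interior_def I_space_def clspace_of_topology_def)
  moreover have "t \<in> top_of_set {0..1} interior_of V \<longleftrightarrow> t \<in> {0..1} \<and> (\<exists>T. open T \<and> t \<in> T \<and> T \<inter> {0..1} \<subseteq> V)" for t :: real
  proof
    show "t \<in> {0..1} \<and> (\<exists>T. open T \<and> t \<in> T \<and> T \<inter> {0..1} \<subseteq> V)" if "t \<in> top_of_set {0..1} interior_of V"
      using that unfolding interior_of_def openin_open by (force simp: Int_commute)
    show "t \<in> top_of_set {0..1} interior_of V" if "t \<in> {0..1} \<and> (\<exists>T. open T \<and> t \<in> T \<and> T \<inter> {0..1} \<subseteq> V)"
      using that unfolding interior_of_def openin_open by (blast intro: Int_commute)
  qed
  ultimately show ?thesis
    unfolding cl_nbhd_def pts_I_space by blast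
qed

text \<open>Boxes of neighbourhoods and basic open sets of the product topology refine each other on
  the cube. Only the finitely many coordinates in \<open>{1..n}\<close> constrain a box, so its
  preimage condition is open.\<close>

lemma cl_cube_space: "cl (cube_space n) S = top_of_set (cube n) closure_of S"
proof (intro equalityI subsetI)
  fix x assume x: "x \<in> cl (cube_space n) S"
  then have xc: "x \<in> cube n" by (simp add: mem_cl_power pts_I_space cube_def)
  show "x \<in> top_of_set (cube n) closure_of S"
    unfolding closure_of_def
  proof (intro CollectI conjI allI impI)
    show "x \<in> topspace (top_of_set (cube n))" using xc by simp
    fix T assume T: "x \<in> T \<and> openin (top_of_set (cube n)) T"
    then obtain U where U: "open U" "T = cube n \<inter> U" by (auto simp: openin_open)
    have "openin (product_topology (\<lambda>i. euclidean) UNIV) U"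
      using U(1) by (simp add: euclidean_product_topology)
    moreover have "x \<in> U" using T U(2) by blast
    ultimately obtain W where W: "x \<in> Pi\<^sub>E UNIV W" "\<And>i. open (W i)" "Pi\<^sub>E UNIV W \<subseteq> U"
      using product_topology_open_contains_basis[of "\<lambda>i. euclidean" UNIV U x] by auto
    have "\<forall>i\<in>{1..n}. cl_nbhd I_space (x i) (W i \<inter> {0..1})"
    proof
      fix i assume "i \<in> {1..n}"
      then have "x i \<in> {0..1}" using xc unfolding cube_def by (rule PiE_mem[rotated])
      moreover have "x i \<in> W i" using W(1) by auto
      ultimately show "cl_nbhd I_space (x i) (W i \<inter> {0..1})"
        using W(2)[of i] unfolding cl_nbhd_I_space by blast
    qed
    then obtain y where y: "y \<in> S" "y \<in> cube n" "\<forall>i\<in>{1..n}. y i \<in> W i \<inter> {0..1}"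
      using x[unfolded mem_cl_power, THEN conjunct2, rule_format, of "\<lambda>i. W i \<inter> {0..1}"]
      unfolding cube_def pts_I_space by blast
    \<comment> \<open>Outside \<open>{1..n}\<close> all points of the cube have the same value
      \<open>undefined\<close>, so a basic open set around \<open>x\<close> imposes no condition on
      \<open>y\<close> there.\<close>
    have "y i \<in> W i" for i
    proof (cases "i \<in> {1..n}")
      case False
      then have "y i = x i"
        using PiE_arb[OF y(2)[unfolded cube_def], of i] PiE_arb[OF xc[unfolded cube_def], of i] by simp
      then show ?thesis using PiE_mem[OF W(1), of i] by simp
    qed (use y(3) in blast)
    then show "\<exists>y\<in>S. y \<in> T" using W(3) y(1,2) U(2) by blast
  qed
next
  fix x assume x: "x \<in> top_of_set (cube n) closure_of S"
  then have xc: "x \<in> cube n" by (simp add: in_closure_of)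
  show "x \<in> cl (cube_space n) S"
    unfolding mem_cl_power pts_I_space
  proof (intro conjI allI impI)
    show "x \<in> {1..n} \<rightarrow>\<^sub>E {0..1}" using xc by (simp add: cube_def)
    fix V assume "\<forall>i\<in>{1..n}. cl_nbhd I_space (x i) (V i)"
    then have "\<forall>i\<in>{1..n}. \<exists>T. open T \<and> x i \<in> T \<and> T \<inter> {0..1} \<subseteq> V i"
      unfolding cl_nbhd_I_space by blast
    then obtain T where T: "\<And>i. i \<in> {1..n} \<Longrightarrow> open (T i) \<and> x i \<in> T i \<and> T i \<inter> {0..1} \<subseteq> V i"
      by metis
    have "open (\<Inter>i\<in>{1..n}. (\<lambda>y :: nat \<Rightarrow> real. y i) -` T i)"
      using T by (intro open_INT ballI open_vimage continuous_on_product_coordinates) auto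
    moreover have "x \<in> (\<Inter>i\<in>{1..n}. (\<lambda>y. y i) -` T i)" using T by blast
    ultimately obtain y where y: "y \<in> S" "y \<in> cube n" "y \<in> (\<Inter>i\<in>{1..n}. (\<lambda>y. y i) -` T i)"
      using x xc unfolding in_closure_of topspace_euclidean_subtopology
      by (metis (no_types, lifting) IntD1 IntD2 IntI openin_open_Int)
    have "y i \<in> V i" if i: "i \<in> {1..n}" for i
    proof -
      have "y i \<in> {0..1}" using y(2) i unfolding cube_def by (rule PiE_mem)
      moreover have "y i \<in> T i" using y(3) i by blast
      ultimately show ?thesis using T[OF i] by blast
    qed
    then show "\<exists>y\<in>S. y \<in> {1..n} \<rightarrow>\<^sub>E {0..1} \<and> (\<forall>i\<in>{1..n}. y i \<in> V i)"
      using y(1,2) unfolding cube_def by blast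
  qed
qed

lemma cube_space_eq: "cube_space n = clspace_of_topology (top_of_set (cube n))"
  by (rule clspace.equality) (simp_all add: clspace_of_topology_def pts_cube_space cl_cube_space fun_eq_iff del: pts_cl_power)

abbreviation cube_maps :: "nat \<Rightarrow> nat \<Rightarrow> ((nat \<Rightarrow> real) \<Rightarrow> nat \<Rightarrow> real) set" where
  "cube_maps m n \<equiv> cells (cube_space m) (cube_space n)"

lemma cells_cube_space:
  "f \<in> cube_maps m n \<longleftrightarrow>
    continuous_on (cube m) f \<and> f ` cube m \<subseteq> cube n \<and> f \<in> extensional (cube m)"
proof -
  have "cl_continuous (cube_space m) (cube_space n) f \<longleftrightarrow> continuous_map (top_of_set (cube m)) (top_of_set (cube n)) f"
    unfolding continuous_map_eq_image_closure_subset_alt cl_continuous_def cube_space_eq clspace_of_topology_def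
    using closure_of_topspace[of "top_of_set (cube m)"] closure_of_subset_topspace[of "top_of_set (cube n)"]
    by (auto simp: Pi_iff image_subset_iff) blast+
  then show ?thesis
    by (auto simp: cells_def pts_cube_space simp del: pts_cl_power)
qed

text \<open>With one-point factors outside \<open>{1..n}\<close> the cube becomes a product over all
  indices, to which Tychonoff applies.\<close>

lemma compact_cube: "compact (cube n)"
proof -
  let ?B = "\<lambda>i. if i \<in> {1..n} then {0..1::real} else {undefined}"
  have "cube n = Pi\<^sub>E UNIV ?B"
    unfolding cube_def by (auto simp: PiE_iff extensional_def split: if_splits; metis singletonD)
  moreover have "compactin (product_topology (\<lambda>i::nat. euclidean::real topology) UNIV) (Pi\<^sub>E UNIV ?B)"
    by (simp add: compactin_PiE)
  ultimately show ?thesis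
    by (simp add: euclidean_product_topology)
qed

text \<open>The distance of functions is a series of coordinate distances, cut off at 1, with
  weights \<open>(1/2)^n\<close>; the factor 2 is the sum of the weights.\<close>

lemma dist_fun_le:
  fixes x y :: "nat \<Rightarrow> real"
  assumes "\<And>i. dist (x i) (y i) \<le> e"
  shows "dist x y \<le> 2 * e"
proof -
  have e: "0 \<le> e" using assms[of 0] zero_le_dist order_trans by blast
  have s: "summable (\<lambda>n. (1/2)^n * e)"
    by (intro summable_mult2) (simp add: summable_geometric_iff)
  have le: "(1/2)^n * min (dist (x (from_nat n)) (y (from_nat n))) 1 \<le> (1/2)^n * e" for n
    using assms[of "from_nat n"] by (intro mult_left_mono) auto
  have s': "summable (\<lambda>n. (1/2)^n * min (dist (x (from_nat n)) (y (from_nat n))) 1)"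
    by (rule summable_comparison_test'[OF s, of 0]) (use le in auto)
  have "dist x y \<le> suminf (\<lambda>n. (1/2)^n * e)"
    unfolding dist_fun_def by (rule suminf_le[OF le s' s])
  also have "\<dots> = 2 * e"
    using suminf_mult2[of "\<lambda>n. (1/2::real)^n" e] suminf_geometric[of "1/2::real"]
    by (simp add: summable_geometric_iff)
  finally show ?thesis .
qed

section \<open>Push-forward of cubical chains and maps between cubes\<close>

lemma (in cube_model) cube_bdry_push:
  "cube_bdry J m (push (cl_power J m) \<sigma> u) = push (cl_power J (m - 1)) \<sigma> (cube_bdry J m u)"
proof (cases m)
  case (Suc k)
  have "u \<in> frags UNIV" by (simp add: frags_def)
  then show ?thesis
  proof (induction rule: frags_induct)
    case (one \<tau>)
    have "cube_face J (Suc k) i t (restrict (\<sigma> \<circ> \<tau>) (pts (cl_power J (Suc k)))) =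
        restrict (\<sigma> \<circ> cube_face J (Suc k) i t \<tau>) (pts (cl_power J k))"
      if "i \<in> {1..Suc k}" "t \<in> pts J" for i t
    proof
      fix x show "cube_face J (Suc k) i t (restrict (\<sigma> \<circ> \<tau>) (pts (cl_power J (Suc k)))) x =
        restrict (\<sigma> \<circ> cube_face J (Suc k) i t \<tau>) (pts (cl_power J k)) x"
        using cube_insert_mem[OF _ that(2,1), of x] by (simp add: cube_face_def)
    qed
    then have "faces (Suc k) i (restrict (\<sigma> \<circ> \<tau>) (pts (cl_power J (Suc k)))) = push (cl_power J k) \<sigma> (faces (Suc k) i \<tau>)"
      if "i \<in> {1..Suc k}" for i
      using that pts_01 by (simp only: faces_def push_diff push_of)
    then show ?case
      by (simp add: Suc push_of cube_bdry_of push_sum push_cmul del: sum.cl_ivl_Suc pts_cl_power)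
  qed (simp_all add: cube_bdry_zero cube_bdry_diff push_diff)
qed (simp add: cube_bdry_0)

lemma (in cube_model) push_degenerate:
  assumes \<sigma>: "\<sigma> \<in> cubes J X n" and u: "u \<in> frags (deg_cells J (cl_power J n) m)"
  shows "push (cl_power J m) \<sigma> u \<in> frags (deg_cells J X m)"
  unfolding push_def
  using u
proof (rule frags_frag_extend)
  fix \<tau> assume \<tau>: "\<tau> \<in> deg_cells J (cl_power J n) m"
  have "restrict (\<sigma> \<circ> \<tau>) (pts (cl_power J m)) \<in> cubes J X m"
    using \<tau> by (intro cells_compose[OF \<sigma> _ closure_space_cl_power[OF closure_J]]) (simp add: deg_cells_def cells_def)
  moreover have "degenerate_cube J m (restrict (\<sigma> \<circ> \<tau>) (pts (cl_power J m)))"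
    using \<tau> unfolding deg_cells_def degenerate_cube_def mem_Collect_eq
    by (simp only: restrict_apply if_True o_apply) metis
  ultimately show "frag_of (restrict (\<sigma> \<circ> \<tau>) (pts (cl_power J m))) \<in> frags (deg_cells J X m)"
    by (simp add: deg_cells_def)
qed

abbreviation degs :: "nat \<Rightarrow> nat \<Rightarrow> ((nat \<Rightarrow> real) \<Rightarrow> nat \<Rightarrow> real) set" where
  "degs m n \<equiv> deg_cells I_space (cube_space n) m"

abbreviation I_bdry :: "nat \<Rightarrow> (((nat \<Rightarrow> real) \<Rightarrow> 'a) \<Rightarrow>\<^sub>0 int) \<Rightarrow> ((nat \<Rightarrow> real) \<Rightarrow> 'a) \<Rightarrow>\<^sub>0 int" where
  "I_bdry \<equiv> cube_bdry I_space"

abbreviation id_cube :: "nat \<Rightarrow> ((nat \<Rightarrow> real) \<Rightarrow> nat \<Rightarrow> real) \<Rightarrow>\<^sub>0 int" where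
  "id_cube n \<equiv> frag_of (id_cell (cube_space n))"

lemma cubeD: "x \<in> cube n \<Longrightarrow> i \<in> {1..n} \<Longrightarrow> 0 \<le> x i \<and> x i \<le> 1"
  unfolding cube_def by (drule PiE_mem) auto

lemma cube_arb: "x \<in> cube n \<Longrightarrow> i \<notin> {1..n} \<Longrightarrow> x i = undefined"
  unfolding cube_def by (rule PiE_arb)

lemma cubeI: "(\<And>i. i \<in> {1..n} \<Longrightarrow> 0 \<le> x i \<and> x i \<le> 1) \<Longrightarrow> (\<And>i. i \<notin> {1..n} \<Longrightarrow> x i = undefined) \<Longrightarrow> x \<in> cube n"
  unfolding cube_def by (rule PiE_I) auto

lemma cube_insert_cube: "x \<in> cube n \<Longrightarrow> 0 \<le> t \<Longrightarrow> t \<le> 1 \<Longrightarrow> i \<in> {1..Suc n} \<Longrightarrow> cube_insert (Suc n) i t x \<in> cube (Suc n)"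
  unfolding cube_def by (rule cube_insert_mem) auto

lemma cells_cubeI:
  assumes "\<And>x i. x \<in> cube m \<Longrightarrow> i \<in> {1..n} \<Longrightarrow> 0 \<le> f x i \<and> f x i \<le> 1"
    and "\<And>i. i \<in> {1..n} \<Longrightarrow> continuous_on (cube m) (\<lambda>x. f x i)"
  shows "(\<lambda>x\<in>cube m. \<lambda>i\<in>{1..n}. f x i) \<in> cube_maps m n"
  unfolding cells_cube_space
proof (intro conjI)
  have "continuous_on (cube m) (\<lambda>x. \<lambda>i\<in>{1..n}. f x i)"
  proof (rule continuous_on_coordinatewise_then_product)
    fix i
    show "continuous_on (cube m) (\<lambda>x. (\<lambda>i\<in>{1..n}. f x i) i)"
      using assms(2)[of i] by (cases "i \<in> {1..n}") (simp_all only: restrict_apply if_True if_False continuous_on_const)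
  qed
  then show "continuous_on (cube m) (\<lambda>x\<in>cube m. \<lambda>i\<in>{1..n}. f x i)"
    by (rule continuous_on_eq) simp
  show "(\<lambda>x\<in>cube m. \<lambda>i\<in>{1..n}. f x i) ` cube m \<subseteq> cube n"
    using assms(1) by (auto intro!: cubeI simp del: One_nat_def)
qed simp

lemma continuous_coordinate: "continuous_on S (\<lambda>x::nat \<Rightarrow> real. x i)"
  by (rule continuous_on_subset[OF continuous_on_product_coordinates]) simp

section \<open>The cone\<close>

text \<open>The straight-line cone from the origin: the new coordinate scales \<open>\<tau>\<close>,
  giving a constant cube at 0 and \<open>\<tau>\<close> at 1. Putting it last leaves the numbers of
  the old faces, and so their signs, unchanged.\<close>

definition cone :: "nat \<Rightarrow> nat \<Rightarrow> ((nat \<Rightarrow> real) \<Rightarrow> nat \<Rightarrow> real) \<Rightarrow> (nat \<Rightarrow> real) \<Rightarrow> nat \<Rightarrow> real" where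
  "cone m n \<tau> = (\<lambda>x\<in>cube (Suc m). \<lambda>k\<in>{1..n}. x (Suc m) * \<tau> (restrict x {1..m}) k)"

definition coneop :: "nat \<Rightarrow> nat \<Rightarrow> (((nat \<Rightarrow> real) \<Rightarrow> nat \<Rightarrow> real) \<Rightarrow>\<^sub>0 int) \<Rightarrow> ((nat \<Rightarrow> real) \<Rightarrow> nat \<Rightarrow> real) \<Rightarrow>\<^sub>0 int" where
  "coneop m n = frag_extend (\<lambda>\<tau>. frag_of (cone m n \<tau>))"

definition zero_cell :: "nat \<Rightarrow> nat \<Rightarrow> (nat \<Rightarrow> real) \<Rightarrow> nat \<Rightarrow> real" where
  "zero_cell m n = (\<lambda>x\<in>cube m. \<lambda>k\<in>{1..n}. 0)"

lemma coneop_of: "coneop m n (frag_of \<tau>) = frag_of (cone m n \<tau>)"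
  by (simp add: coneop_def)

lemma coneop_0 [simp]: "coneop m n 0 = 0"
  by (simp add: coneop_def)

lemma coneop_diff: "coneop m n (x - y) = coneop m n x - coneop m n y"
  by (simp add: coneop_def frag_extend_diff)

lemma coneop_sum: "finite I \<Longrightarrow> coneop m n (sum f I) = (\<Sum>i\<in>I. coneop m n (f i))"
  by (simp add: coneop_def frag_extend_sum)

lemma coneop_cmul: "coneop m n (frag_cmul k x) = frag_cmul k (coneop m n x)"
  by (simp add: coneop_def frag_extend_cmul)

lemma restrict_cube: "x \<in> cube (Suc m) \<Longrightarrow> restrict x {1..m} \<in> cube m"
  using cubeD[of x "Suc m"] by (intro cubeI) auto

lemma cone_cells:
  assumes \<tau>: "\<tau> \<in> cube_maps m n"
  shows "cone m n \<tau> \<in> cube_maps (Suc m) n"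
  unfolding cone_def
proof (rule cells_cubeI)
  fix x k assume x: "x \<in> cube (Suc m)" and k: "k \<in> {1..n}"
  have "\<tau> (restrict x {1..m}) \<in> cube n"
    using \<tau> restrict_cube[OF x] by (auto simp: cells_cube_space)
  then show "0 \<le> x (Suc m) * \<tau> (restrict x {1..m}) k \<and> x (Suc m) * \<tau> (restrict x {1..m}) k \<le> 1"
    using cubeD[OF x, of "Suc m"] cubeD[of _ n k] k by (auto intro: mult_le_one)
next
  fix k assume k: "k \<in> {1..n}"
  have "continuous_on (cube (Suc m)) (\<lambda>x. restrict x {1..m})"
  proof (rule continuous_on_coordinatewise_then_product)
    show "continuous_on (cube (Suc m)) (\<lambda>x. restrict x {1..m} i)" for i
      by (cases "i \<in> {1..m}") (simp_all only: restrict_apply if_True if_False continuous_on_const continuous_coordinate)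
  qed
  then have "continuous_on (cube (Suc m)) (\<lambda>x. \<tau> (restrict x {1..m}))"
  proof (rule continuous_on_compose2[rotated])
    show "continuous_on (cube m) \<tau>" using \<tau> by (simp only: cells_cube_space)
    show "(\<lambda>x. restrict x {1..m}) ` cube (Suc m) \<subseteq> cube m"
      by (rule image_subsetI) (rule restrict_cube)
  qed
  then have "continuous_on (cube (Suc m)) (\<lambda>x. \<tau> (restrict x {1..m}) k)"
    by (rule continuous_on_product_then_coordinatewise)
  then show "continuous_on (cube (Suc m)) (\<lambda>x. x (Suc m) * \<tau> (restrict x {1..m}) k)"
    by (intro continuous_on_mult continuous_coordinate)
qed

lemma zero_cell_cells: "zero_cell m n \<in> cube_maps m n"
  unfolding zero_cell_def by (rule cells_cubeI) auto

text \<open>A constant cube is degenerate from dimension 1 on; a cube of dimension 0 has no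
  coordinate to ignore.\<close>

lemma zero_cell_degs:
  assumes "0 < m"
  shows "zero_cell m n \<in> degs m n"
proof -
  have "degenerate_cube I_space m (zero_cell m n)"
    unfolding degenerate_cube_def pts_cube_space
  proof (intro bexI[of _ 1] ballI impI)
    fix x y assume "x \<in> cube m" "y \<in> cube m"
    then show "zero_cell m n x = zero_cell m n y" by (simp only: zero_cell_def restrict_apply if_True)
  qed (use assms in simp)
  then show ?thesis
    using zero_cell_cells by (simp add: deg_cells_def)
qed

lemma deg_cellsE:
  assumes "\<sigma> \<in> deg_cells I_space X n"
  obtains i where "i \<in> {1..n}" "\<sigma> \<in> cells (cube_space n) X"
    "\<And>x y. x \<in> cube n \<Longrightarrow> y \<in> cube n \<Longrightarrow> (\<forall>k\<in>{1..n}. k \<noteq> i \<longrightarrow> x k = y k) \<Longrightarrow> \<sigma> x = \<sigma> y"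
  using assms unfolding deg_cells_def degenerate_cube_def pts_cube_space by blast

lemma cone_degs:
  assumes \<tau>: "\<tau> \<in> degs m n"
  shows "cone m n \<tau> \<in> degs (Suc m) n"
proof -
  from \<tau> obtain i where i: "i \<in> {1..m}" and cell: "\<tau> \<in> cube_maps m n"
    and eq: "\<And>x y. x \<in> cube m \<Longrightarrow> y \<in> cube m \<Longrightarrow> (\<forall>k\<in>{1..m}. k \<noteq> i \<longrightarrow> x k = y k) \<Longrightarrow> \<tau> x = \<tau> y"
    by (rule deg_cellsE) blast
  have "degenerate_cube I_space (Suc m) (cone m n \<tau>)"
    unfolding degenerate_cube_def pts_cube_space
  proof (intro bexI[of _ i] ballI impI)
    fix x y assume xy: "x \<in> cube (Suc m)" "y \<in> cube (Suc m)" and *: "\<forall>k\<in>{1..Suc m}. k \<noteq> i \<longrightarrow> x k = y k"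
    have "\<tau> (restrict x {1..m}) = \<tau> (restrict y {1..m})"
      using * by (intro eq restrict_cube xy) auto
    moreover have "x (Suc m) = y (Suc m)" using * i by auto
    ultimately show "cone m n \<tau> x = cone m n \<tau> y"
      using xy by (simp add: cone_def)
  qed (use i in auto)
  then show ?thesis
    using cone_cells[OF cell] by (simp add: deg_cells_def)
qed

lemma cube_face_cone:
  assumes i: "i \<in> {1..Suc l}" and t: "0 \<le> t" "t \<le> 1"
  shows "cube_face I_space (Suc (Suc l)) i t (cone (Suc l) n \<tau>) = cone l n (cube_face I_space (Suc l) i t \<tau>)"
proof
  fix x
  show "cube_face I_space (Suc (Suc l)) i t (cone (Suc l) n \<tau>) x = cone l n (cube_face I_space (Suc l) i t \<tau>) x"
  proof (cases "x \<in> cube (Suc l)")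
    case True
    have 1: "cube_insert (Suc (Suc l)) i t x \<in> cube (Suc (Suc l))"
      using True t i by (intro cube_insert_cube) auto
    have 2: "cube_insert (Suc (Suc l)) i t x (Suc (Suc l)) = x (Suc l)"
      using i by (auto simp: cube_insert_def)
    have 3: "restrict (cube_insert (Suc (Suc l)) i t x) {1..Suc l} = cube_insert (Suc l) i t (restrict x {1..l})"
    proof
      fix k
      show "restrict (cube_insert (Suc (Suc l)) i t x) {1..Suc l} k = cube_insert (Suc l) i t (restrict x {1..l}) k"
      proof (cases "k \<in> {1..Suc l}")
        case True
        consider "k < i" | "k = i" | "i < k" by linarith
        then show ?thesis
        proof cases
          case 1
          then have "k \<in> {1..l}" using True i by auto
          then show ?thesis using 1 True by (simp add: cube_insert_def)
        next
          case 3
          then have "k - 1 \<in> {1..l}" using True i unfolding atLeastAtMost_iff by linarith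
          then show ?thesis using 3 True by (simp add: cube_insert_def)
        qed (use True in \<open>simp add: cube_insert_def\<close>)
      next
        case False
        then show ?thesis unfolding cube_insert_def by (simp only: restrict_apply if_False)
      qed
    qed
    show ?thesis
      using True 1 restrict_cube[OF True]
      by (simp only: cube_face_def cone_def pts_cube_space restrict_apply o_apply diff_Suc_1 if_True 2 3)
  next
    case False
    then show ?thesis
      unfolding cube_face_def cone_def pts_cube_space diff_Suc_1 by (simp only: restrict_apply if_False)
  qed
qed

lemma cube_face_cone_0: "cube_face I_space (Suc m) (Suc m) 0 (cone m n \<tau>) = zero_cell m n"
proof
  fix x
  show "cube_face I_space (Suc m) (Suc m) 0 (cone m n \<tau>) x = zero_cell m n x"
  proof (cases "x \<in> cube m")
    case True
    have 1: "cube_insert (Suc m) (Suc m) 0 x \<in> cube (Suc m)"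
      using True by (intro cube_insert_cube) auto
    have 2: "cube_insert (Suc m) (Suc m) 0 x (Suc m) = 0"
      by (simp add: cube_insert_def)
    show ?thesis
      using True 1 by (simp only: cube_face_def cone_def zero_cell_def pts_cube_space restrict_apply o_apply
          diff_Suc_1 if_True 2 mult_zero_left)
  next
    case False
    then show ?thesis
      by (simp only: cube_face_def zero_cell_def pts_cube_space restrict_apply diff_Suc_1 if_False)
  qed
qed

lemma cube_face_cone_1:
  assumes \<tau>: "\<tau> \<in> cube_maps m n"
  shows "cube_face I_space (Suc m) (Suc m) 1 (cone m n \<tau>) = \<tau>"
proof
  fix x
  show "cube_face I_space (Suc m) (Suc m) 1 (cone m n \<tau>) x = \<tau> x"
  proof (cases "x \<in> cube m")
    case True
    have 1: "cube_insert (Suc m) (Suc m) 1 x \<in> cube (Suc m)"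
      using True by (intro cube_insert_cube) auto
    have 2: "cube_insert (Suc m) (Suc m) 1 x (Suc m) = 1"
      by (simp add: cube_insert_def)
    have 3: "restrict (cube_insert (Suc m) (Suc m) 1 x) {1..m} = x"
      using cube_arb[OF True] by (auto simp: cube_insert_def fun_eq_iff)
    have "\<tau> x \<in> cube n" using \<tau> True by (auto simp: cells_cube_space)
    then have 4: "(\<lambda>k\<in>{1..n}. 1 * \<tau> x k) = \<tau> x"
      using cube_arb[of "\<tau> x" n] by (auto simp: fun_eq_iff)
    show ?thesis
      using True 1 by (simp only: cube_face_def cone_def pts_cube_space restrict_apply o_apply diff_Suc_1 if_True 2 3 4)
  next
    case False
    then have "\<tau> x = undefined" using \<tau> by (auto simp: cells_cube_space extensional_def)
    then show ?thesis
      using False by (simp only: cube_face_def pts_cube_space restrict_apply diff_Suc_1 if_False)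
  qed
qed

text \<open>Faces in old directions are cones over faces, and the two faces in the new direction are
  the constant cube and the original one. Hence coning is a contraction up to sign and up to
  multiples \<open>d\<close> of the constant cube.\<close>

lemma cube_bdry_coneop:
  assumes c: "c \<in> frags (cube_maps m n)"
  shows "\<exists>d\<in>frags {zero_cell m n}. I_bdry (Suc m) (coneop m n c) =
    coneop (m - 1) n (I_bdry m c) + frag_cmul ((-1) ^ m) c + d"
  using c
proof (induction rule: frags_induct)
  case zero
  show ?case by (rule bexI[of _ 0]) (simp_all add: I_cube.cube_bdry_zero)
next
  case (one \<tau>)
  have f: "I_cube.faces (Suc m) i (cone m n \<tau>) = coneop (m - 1) n (I_cube.faces m i \<tau>)" if i: "i \<in> {1..m}" for i
  proof -
    obtain l where l: "m = Suc l" using i by (cases m) auto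
    show ?thesis using i cube_face_cone[of i l 0 n \<tau>] cube_face_cone[of i l 1 n \<tau>]
      unfolding I_cube.faces_def coneop_diff coneop_of l diff_Suc_1 by (simp only: simp_thms zero_le_one order_refl)
  qed
  have "I_bdry (Suc m) (coneop m n (frag_of \<tau>)) =
      (\<Sum>i=1..m. frag_cmul ((-1) ^ i) (I_cube.faces (Suc m) i (cone m n \<tau>))) +
      frag_cmul ((-1) ^ Suc m) (I_cube.faces (Suc m) (Suc m) (cone m n \<tau>))"
    unfolding coneop_of I_cube.cube_bdry_of by simp
  also have "(\<Sum>i=1..m. frag_cmul ((-1) ^ i) (I_cube.faces (Suc m) i (cone m n \<tau>))) =
      coneop (m - 1) n (I_bdry m (frag_of \<tau>))"
    unfolding I_cube.cube_bdry_of coneop_sum[OF finite_atLeastAtMost] coneop_cmul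
    by (intro sum.cong refl) (simp only: f)
  also have "I_cube.faces (Suc m) (Suc m) (cone m n \<tau>) = frag_of (zero_cell m n) - frag_of \<tau>"
    by (simp only: I_cube.faces_def cube_face_cone_0 cube_face_cone_1[OF one])
  finally show ?case
    by (intro bexI[of _ "frag_cmul ((-1) ^ Suc m) (frag_of (zero_cell m n))"] frags_cmul)
      (simp_all add: frag_cmul_diff)
next
  case (diff a b)
  then obtain d e where de: "d \<in> frags {zero_cell m n}" "e \<in> frags {zero_cell m n}"
    "I_bdry (Suc m) (coneop m n a) = coneop (m - 1) n (I_bdry m a) + frag_cmul ((-1) ^ m) a + d"
    "I_bdry (Suc m) (coneop m n b) = coneop (m - 1) n (I_bdry m b) + frag_cmul ((-1) ^ m) b + e"
    by blast
  then show ?case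
    by (intro bexI[of _ "d - e"] frags_diff) (simp_all add: coneop_diff I_cube.cube_bdry_diff frag_cmul_diff)
qed

lemma coneop_cells: "c \<in> frags (cube_maps m n) \<Longrightarrow> coneop m n c \<in> frags (cube_maps (Suc m) n)"
  unfolding coneop_def by (erule frags_frag_extend) (simp add: cone_cells)

lemma coneop_degs: "c \<in> frags (degs m n) \<Longrightarrow> coneop m n c \<in> frags (degs (Suc m) n)"
  unfolding coneop_def by (erule frags_frag_extend) (simp add: cone_degs)

section \<open>The grid subdivision\<close>

text \<open>The affine map of the unit cube onto the small cube of side \<open>1 / N\<close> whose
  lowest corner is \<open>v / N\<close>.\<close>

definition grid_cell :: "nat \<Rightarrow> nat \<Rightarrow> (nat \<Rightarrow> nat) \<Rightarrow> (nat \<Rightarrow> real) \<Rightarrow> nat \<Rightarrow> real" where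
  "grid_cell N n v = (\<lambda>x\<in>cube n. \<lambda>k\<in>{1..n}. (x k + real (v k)) / real N)"

abbreviation grid :: "nat \<Rightarrow> nat \<Rightarrow> (nat \<Rightarrow> nat) set" where
  "grid N n \<equiv> {1..n} \<rightarrow>\<^sub>E {..<N}"

definition grid_chain :: "nat \<Rightarrow> nat \<Rightarrow> ((nat \<Rightarrow> real) \<Rightarrow> nat \<Rightarrow> real) \<Rightarrow>\<^sub>0 int" where
  "grid_chain N n = (\<Sum>v\<in>grid N n. frag_of (grid_cell N n v))"

lemma finite_grid: "finite (grid N n)"
  by (rule finite_PiE) auto

lemma grid_cell_cells:
  assumes "v \<in> grid N n"
  shows "grid_cell N n v \<in> cube_maps n n"
  unfolding grid_cell_def
proof (rule cells_cubeI)
  fix x k assume x: "x \<in> cube n" and k: "k \<in> {1..n}"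
  have "v k < N" using PiE_mem[OF assms k] by simp
  then have "real (v k) + 1 \<le> real N" by linarith
  then show "0 \<le> (x k + real (v k)) / real N \<and> (x k + real (v k)) / real N \<le> 1"
    using cubeD[OF x k] \<open>v k < N\<close> by (auto simp: divide_simps)
qed (simp add: divide_inverse; intro continuous_on_mult_right continuous_on_add continuous_on_const continuous_coordinate)

lemma grid_chain_cells: "grid_chain N n \<in> frags (cube_maps n n)"
  unfolding grid_chain_def by (rule frags_sum) (simp add: grid_cell_cells)

text \<open>Grid cells act on each coordinate separately, so a cube ignoring coordinate
  \<open>i\<close> still ignores it after composition with one of them.\<close>

lemma push_grid_chain_degenerate:
  assumes "\<sigma> \<in> deg_cells I_space X n"
  shows "push (cube_space n) \<sigma> (grid_chain N n) \<in> frags (deg_cells I_space X n)"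
proof -
  from assms obtain i where i: "i \<in> {1..n}" and cell: "\<sigma> \<in> cells (cube_space n) X"
    and eq: "\<And>x y. x \<in> cube n \<Longrightarrow> y \<in> cube n \<Longrightarrow> (\<forall>k\<in>{1..n}. k \<noteq> i \<longrightarrow> x k = y k) \<Longrightarrow> \<sigma> x = \<sigma> y"
    by (rule deg_cellsE) blast
  have "restrict (\<sigma> \<circ> grid_cell N n v) (pts (cube_space n)) \<in> deg_cells I_space X n" if v: "v \<in> grid N n" for v
  proof -
    note g = grid_cell_cells[OF v]
    have "degenerate_cube I_space n (restrict (\<sigma> \<circ> grid_cell N n v) (pts (cube_space n)))"
      unfolding degenerate_cube_def pts_cube_space
    proof (intro bexI[OF _ i] ballI impI)
      fix x y assume xy: "x \<in> cube n" "y \<in> cube n" and *: "\<forall>k\<in>{1..n}. k \<noteq> i \<longrightarrow> x k = y k"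
      have "\<sigma> (grid_cell N n v x) = \<sigma> (grid_cell N n v y)"
        using g xy * by (intro eq) (auto simp: cells_cube_space, simp add: grid_cell_def)
      then show "restrict (\<sigma> \<circ> grid_cell N n v) (cube n) x = restrict (\<sigma> \<circ> grid_cell N n v) (cube n) y"
        using xy by simp
    qed
    moreover have "restrict (\<sigma> \<circ> grid_cell N n v) (pts (cube_space n)) \<in> cells (cube_space n) X"
      using g by (intro cells_compose[OF cell _ closure_cube_space]) (simp add: cells_def)
    ultimately show ?thesis by (simp add: deg_cells_def)
  qed
  then show ?thesis
    unfolding grid_chain_def push_sum[OF finite_grid] push_of by (intro frags_sum) simp
qed

text \<open>This sorts the small cubes into rows in direction \<open>i\<close>, along which the
  faces in that direction telescope.\<close>

lemma bij_betw_grid_insert: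
  assumes i: "i \<in> {1..Suc m}"
  shows "bij_betw (\<lambda>(w, k). cube_insert (Suc m) i k w) (grid N m \<times> {..<N}) (grid N (Suc m))"
proof (rule bij_betw_byWitness[where f' = "\<lambda>v. (\<lambda>j\<in>{1..m}. if j < i then v j else v (Suc j), v i)"])
  show "\<forall>p\<in>grid N m \<times> {..<N}. (\<lambda>v. (\<lambda>j\<in>{1..m}. if j < i then v j else v (Suc j), v i)) ((\<lambda>(w, k). cube_insert (Suc m) i k w) p) = p"
  proof (rule ballI, unfold split_beta, rule prod_eqI)
    fix p assume "p \<in> grid N m \<times> {..<N}"
    then obtain w k where p: "p = (w, k)" and w: "w \<in> grid N m" by blast
    show "snd (\<lambda>j\<in>{1..m}. if j < i then cube_insert (Suc m) i (snd p) (fst p) j else cube_insert (Suc m) i (snd p) (fst p) (Suc j),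
        cube_insert (Suc m) i (snd p) (fst p) i) = snd p"
      using i by (simp add: cube_insert_def p)
    show "fst (\<lambda>j\<in>{1..m}. if j < i then cube_insert (Suc m) i (snd p) (fst p) j else cube_insert (Suc m) i (snd p) (fst p) (Suc j),
        cube_insert (Suc m) i (snd p) (fst p) i) = fst p"
      using PiE_arb[OF w] by (auto simp: cube_insert_def fun_eq_iff p)
  qed
  show "\<forall>v\<in>grid N (Suc m). (\<lambda>(w, k). cube_insert (Suc m) i k w) (\<lambda>j\<in>{1..m}. if j < i then v j else v (Suc j), v i) = v"
  proof (clarify, rule ext)
    fix v j assume v: "v \<in> grid N (Suc m)"
    show "cube_insert (Suc m) i (v i) (\<lambda>j\<in>{1..m}. if j < i then v j else v (Suc j)) j = v j"
    proof (cases "j \<in> {1..Suc m}")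
      case True
      consider "j < i" | "j = i" | "i < j" by linarith
      then show ?thesis
      proof cases
        case 1
        then have "j \<in> {1..m}" using True i by auto
        then show ?thesis using 1 True by (simp add: cube_insert_def)
      next
        case 3
        then have "j - 1 \<in> {1..m}" "\<not> j - 1 < i" "Suc (j - 1) = j"
          using True i unfolding atLeastAtMost_iff by linarith+
        then show ?thesis using 3 True by (simp add: cube_insert_def)
      qed (use True in \<open>simp add: cube_insert_def\<close>)
    next
      case False
      then show ?thesis
        using PiE_arb[OF v False] unfolding cube_insert_def by (simp only: restrict_apply if_False)
    qed
  qed
  show "(\<lambda>(w, k). cube_insert (Suc m) i k w) ` (grid N m \<times> {..<N}) \<subseteq> grid N (Suc m)"
  proof (rule image_subsetI)
    fix p assume "p \<in> grid N m \<times> {..<N}"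
    then show "(\<lambda>(w, k). cube_insert (Suc m) i k w) p \<in> grid N (Suc m)"
      using cube_insert_mem[OF _ _ i, of "fst p" "{..<N}" "snd p"] by (simp add: split_beta mem_Times_iff)
  qed
  show "(\<lambda>v. (\<lambda>j\<in>{1..m}. if j < i then v j else v (Suc j), v i)) ` grid N (Suc m) \<subseteq> grid N m \<times> {..<N}"
  proof (rule image_subsetI, rule SigmaI)
    fix v assume v: "v \<in> grid N (Suc m)"
    show "v i \<in> {..<N}" using PiE_mem[OF v i] .
    show "(\<lambda>j\<in>{1..m}. if j < i then v j else v (Suc j)) \<in> grid N m"
    proof (rule PiE_I)
      fix j assume j: "j \<in> {1..m}"
      then have "j \<in> {1..Suc m}" "Suc j \<in> {1..Suc m}" by auto
      then show "(\<lambda>j\<in>{1..m}. if j < i then v j else v (Suc j)) j \<in> {..<N}"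
        using PiE_mem[OF v] j by simp
    qed (simp only: restrict_apply if_False)
  qed
qed

text \<open>A cell of the grid in the hyperplane where coordinate \<open>i\<close> equals
  \<open>c\<close>. Walls are named by the position \<open>c\<close>, not by a small cube, so that
  the wall shared by two neighbours is one and the same cell.\<close>

definition slice_cell :: "nat \<Rightarrow> nat \<Rightarrow> nat \<Rightarrow> real \<Rightarrow> (nat \<Rightarrow> nat) \<Rightarrow> (nat \<Rightarrow> real) \<Rightarrow> nat \<Rightarrow> real" where
  "slice_cell N m i c w = (\<lambda>x\<in>cube m. cube_insert (Suc m) i c (grid_cell N m w x))"

lemma cube_face_grid_cell:
  assumes i: "i \<in> {1..Suc m}" and t: "0 \<le> t" "t \<le> 1"
  shows "cube_face I_space (Suc m) i t (grid_cell N (Suc m) (cube_insert (Suc m) i k w)) =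
    slice_cell N m i ((t + real k) / real N) w"
proof
  fix x
  show "cube_face I_space (Suc m) i t (grid_cell N (Suc m) (cube_insert (Suc m) i k w)) x =
    slice_cell N m i ((t + real k) / real N) w x"
  proof (cases "x \<in> cube m")
    case True
    have 1: "cube_insert (Suc m) i t x \<in> cube (Suc m)"
      using True t i by (intro cube_insert_cube) auto
    have "(\<lambda>j\<in>{1..Suc m}. (cube_insert (Suc m) i t x j + real (cube_insert (Suc m) i k w j)) / real N) =
        cube_insert (Suc m) i ((t + real k) / real N) (\<lambda>j\<in>{1..m}. (x j + real (w j)) / real N)"
    proof
      fix j
      show "(\<lambda>j\<in>{1..Suc m}. (cube_insert (Suc m) i t x j + real (cube_insert (Suc m) i k w j)) / real N) j =
        cube_insert (Suc m) i ((t + real k) / real N) (\<lambda>j\<in>{1..m}. (x j + real (w j)) / real N) j"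
      proof (cases "j \<in> {1..Suc m}")
        case True
        consider "j < i" | "j = i" | "i < j" by linarith
        then show ?thesis
        proof cases
          case 1
          then have "j \<in> {1..m}" using True i by auto
          then show ?thesis using 1 True by (simp add: cube_insert_def)
        next
          case 3
          then have "j - 1 \<in> {1..m}"
            using True i unfolding atLeastAtMost_iff by linarith
          then show ?thesis using 3 True by (simp add: cube_insert_def)
        qed (use True in \<open>simp add: cube_insert_def\<close>)
      next
        case False
        then show ?thesis unfolding cube_insert_def by (simp only: restrict_apply if_False)
      qed
    qed
    then show ?thesis
      using True 1
      by (simp only: cube_face_def grid_cell_def slice_cell_def pts_cube_space restrict_apply o_apply diff_Suc_1 if_True)
  next
    case False
    then show ?thesis
      unfolding cube_face_def slice_cell_def pts_cube_space diff_Suc_1 by (simp only: restrict_apply if_False)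
  qed
qed

lemma push_cube_face_id:
  assumes w: "w \<in> grid N m" and i: "i \<in> {1..Suc m}" and t: "0 \<le> t" "t \<le> 1"
  shows "push (cube_space m) (cube_face I_space (Suc m) i t (id_cell (cube_space (Suc m)))) (frag_of (grid_cell N m w)) =
    frag_of (slice_cell N m i t w)"
proof -
  have "restrict (cube_face I_space (Suc m) i t (id_cell (cube_space (Suc m))) \<circ> grid_cell N m w) (cube m) = slice_cell N m i t w"
  proof
    fix x
    have g: "grid_cell N m w x \<in> cube m" if "x \<in> cube m"
      using grid_cell_cells[OF w] that by (auto simp: cells_cube_space)
    show "restrict (cube_face I_space (Suc m) i t (id_cell (cube_space (Suc m))) \<circ> grid_cell N m w) (cube m) x = slice_cell N m i t w x"
      using g cube_insert_cube[OF g t i]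
      by (cases "x \<in> cube m") (simp_all add: cube_face_def id_cell_def slice_cell_def pts_cube_space del: pts_cl_power)
  qed
  then show ?thesis by (simp only: push_of pts_cube_space)
qed

text \<open>An inner wall is the upper face of one small cube and the lower face of the next, with
  opposite signs. Each row thus telescopes to its two outer walls, and these form the grids on the
  faces of the identity cube.\<close>

lemma cube_bdry_grid_chain:
  assumes N: "0 < N"
  shows "I_bdry n (grid_chain N n) =
    natop (cube_space (n - 1)) (grid_chain N (n - 1)) (I_bdry n (id_cube n))"
proof (cases n)
  case (Suc m)
  have key: "(\<Sum>v\<in>grid N (Suc m). I_cube.faces (Suc m) i (grid_cell N (Suc m) v)) =
      natop (cube_space m) (grid_chain N m) (I_cube.faces (Suc m) i (id_cell (cube_space (Suc m))))" if i: "i \<in> {1..Suc m}" for i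
  proof -
    have "(\<Sum>v\<in>grid N (Suc m). I_cube.faces (Suc m) i (grid_cell N (Suc m) v)) =
        (\<Sum>(w, k)\<in>grid N m \<times> {..<N}. I_cube.faces (Suc m) i (grid_cell N (Suc m) (cube_insert (Suc m) i k w)))"
      using sum.reindex_bij_betw[OF bij_betw_grid_insert[OF i], of "\<lambda>v. I_cube.faces (Suc m) i (grid_cell N (Suc m) v)" N]
      by (simp add: case_prod_unfold)
    also have "\<dots> = (\<Sum>w\<in>grid N m. \<Sum>k<N. frag_of (slice_cell N m i (real k / real N) w) - frag_of (slice_cell N m i (real (Suc k) / real N) w))"
      unfolding sum.cartesian_product[symmetric] I_cube.faces_def
      using cube_face_grid_cell[OF i, of 0] cube_face_grid_cell[OF i, of 1] by simp
    also have "\<dots> = (\<Sum>w\<in>grid N m. frag_of (slice_cell N m i 0 w) - frag_of (slice_cell N m i 1 w))"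
    proof (rule sum.cong[OF refl])
      fix w
      show "(\<Sum>k<N. frag_of (slice_cell N m i (real k / real N) w) - frag_of (slice_cell N m i (real (Suc k) / real N) w)) =
          frag_of (slice_cell N m i 0 w) - frag_of (slice_cell N m i 1 w)"
        using N sum_lessThan_telescope'[of "\<lambda>k. frag_of (slice_cell N m i (real k / real N) w)" N] by simp
    qed
    also have "\<dots> = natop (cube_space m) (grid_chain N m) (I_cube.faces (Suc m) i (id_cell (cube_space (Suc m))))"
      unfolding I_cube.faces_def natop_diff natop_of grid_chain_def push_sum[OF finite_grid] sum_subtractf
      by (intro arg_cong2[where f = "(-)"] sum.cong refl push_cube_face_id[symmetric] i) auto
    finally show ?thesis .
  qed
  have "I_bdry (Suc m) (grid_chain N (Suc m)) =
      (\<Sum>v\<in>grid N (Suc m). \<Sum>i=1..Suc m. frag_cmul ((-1) ^ i) (I_cube.faces (Suc m) i (grid_cell N (Suc m) v)))"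
    by (simp only: grid_chain_def I_cube.cube_bdry_sum[OF finite_grid] I_cube.cube_bdry_of)
  also have "\<dots> = (\<Sum>i=1..Suc m. frag_cmul ((-1) ^ i) (\<Sum>v\<in>grid N (Suc m). I_cube.faces (Suc m) i (grid_cell N (Suc m) v)))"
    unfolding frag_cmul_sum by (rule sum.swap)
  also have "\<dots> = natop (cube_space m) (grid_chain N m) (I_bdry (Suc m) (frag_of (id_cell (cube_space (Suc m)))))"
    unfolding I_cube.cube_bdry_of natop_sum[OF finite_atLeastAtMost] natop_cmul
    by (intro sum.cong refl) (simp only: key)
  finally show ?thesis by (simp add: Suc)
qed (simp add: I_cube.cube_bdry_0)

section \<open>The homotopy for the grid subdivision\<close>

text \<open>The retraction onto the face where coordinate \<open>i\<close> is 0. The cubes ignoring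
  that coordinate are those that factor through it.\<close>

definition coord_proj :: "nat \<Rightarrow> nat \<Rightarrow> (nat \<Rightarrow> real) \<Rightarrow> nat \<Rightarrow> real" where
  "coord_proj n i = (\<lambda>x\<in>cube n. \<lambda>k\<in>{1..n}. if k = i then 0 else x k)"

lemma coord_proj_cells: "coord_proj n i \<in> cube_maps n n"
  unfolding coord_proj_def
proof (rule cells_cubeI)
  show "0 \<le> (if k = i then 0 else x k) \<and> (if k = i then 0 else x k) \<le> 1" if "x \<in> cube n" "k \<in> {1..n}" for x k
    using cubeD[OF that] by simp
  show "continuous_on (cube n) (\<lambda>x. if k = i then 0 else x k)" for k
    by (cases "k = i") (simp_all add: continuous_coordinate)
qed

lemma coord_proj_degs:
  assumes i: "i \<in> {1..n}"
  shows "coord_proj n i \<in> degs n n"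
proof -
  have "degenerate_cube I_space n (coord_proj n i)"
    unfolding degenerate_cube_def pts_cube_space
  proof (intro bexI[OF _ i] ballI impI)
    fix x y assume xy: "x \<in> cube n" "y \<in> cube n" and eq: "\<forall>k\<in>{1..n}. k \<noteq> i \<longrightarrow> x k = y k"
    have "(\<lambda>k\<in>{1..n}. if k = i then 0 else x k) = (\<lambda>k\<in>{1..n}. if k = i then 0 else y k)"
      using eq by (intro restrict_ext) simp
    then show "coord_proj n i x = coord_proj n i y"
      using xy by (simp only: coord_proj_def restrict_apply if_True)
  qed
  then show ?thesis
    using coord_proj_cells by (simp add: deg_cells_def)
qed

lemma degenerate_coord_proj:
  assumes "\<sigma> \<in> deg_cells I_space X n"
  shows "\<exists>i\<in>{1..n}. restrict (\<sigma> \<circ> coord_proj n i) (cube n) = \<sigma>"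
proof -
  from assms obtain i where i: "i \<in> {1..n}" and cell: "\<sigma> \<in> cells (cube_space n) X"
    and eq: "\<And>x y. x \<in> cube n \<Longrightarrow> y \<in> cube n \<Longrightarrow> (\<forall>k\<in>{1..n}. k \<noteq> i \<longrightarrow> x k = y k) \<Longrightarrow> \<sigma> x = \<sigma> y"
    by (rule deg_cellsE) blast
  have "restrict (\<sigma> \<circ> coord_proj n i) (cube n) x = \<sigma> x" for x
  proof (cases "x \<in> cube n")
    case True
    have "\<sigma> (coord_proj n i x) = \<sigma> x"
    proof (rule eq)
      show "coord_proj n i x \<in> cube n" using coord_proj_cells True unfolding cells_cube_space by blast
    qed (use True in \<open>simp_all add: coord_proj_def\<close>)
    then show ?thesis using True by simp
  next
    case False
    have "\<sigma> \<in> extensional (cube n)" using cell by (simp add: cells_def pts_cube_space del: pts_cl_power)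
    then show ?thesis using False by (simp add: extensional_def)
  qed
  then show ?thesis using i by blast
qed

text \<open>The projection is linear and fixes the cone point, so it commutes with the scaling in
  the cone.\<close>

lemma push_coord_proj_coneop:
  assumes c: "c \<in> frags (cube_maps m n)"
  shows "push (cube_space (Suc m)) (coord_proj n i) (coneop m n c) = coneop m n (push (cube_space m) (coord_proj n i) c)"
  using c
proof (induction rule: frags_induct)
  case (one \<tau>)
  have "restrict (coord_proj n i \<circ> cone m n \<tau>) (cube (Suc m)) = cone m n (restrict (coord_proj n i \<circ> \<tau>) (cube m))"
  proof
    fix x
    show "restrict (coord_proj n i \<circ> cone m n \<tau>) (cube (Suc m)) x = cone m n (restrict (coord_proj n i \<circ> \<tau>) (cube m)) x"
    proof (cases "x \<in> cube (Suc m)")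
      case True
      have 1: "cone m n \<tau> x \<in> cube n"
        using cone_cells[OF one] True unfolding cells_cube_space by blast
      have 2: "\<tau> (restrict x {1..m}) \<in> cube n"
        using one restrict_cube[OF True] unfolding cells_cube_space by blast
      have "(\<lambda>k\<in>{1..n}. if k = i then 0 else cone m n \<tau> x k) =
          (\<lambda>k\<in>{1..n}. x (Suc m) * (\<lambda>k\<in>{1..n}. if k = i then 0 else \<tau> (restrict x {1..m}) k) k)"
        using True by (intro restrict_ext) (simp add: cone_def)
      then show ?thesis
        using True 1 2 restrict_cube[OF True]
        by (simp only: coord_proj_def cone_def[of m n "restrict _ _"] restrict_apply o_apply if_True)
    next
      case False
      then show ?thesis unfolding cone_def by (simp only: restrict_apply if_False)
    qed
  qed
  then show ?case by (simp only: coneop_of push_of pts_cube_space)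
qed (simp_all add: coneop_diff push_diff)

text \<open>
  The homotopy from the identity to the grid subdivision, evaluated on the identity cube: it cones
  off what the homotopy on the faces leaves over, which is a cycle modulo degenerate cubes.
\<close>

primrec grid_homotopy :: "nat \<Rightarrow> nat \<Rightarrow> ((nat \<Rightarrow> real) \<Rightarrow> nat \<Rightarrow> real) \<Rightarrow>\<^sub>0 int" where
  "grid_homotopy N 0 = 0"
| "grid_homotopy N (Suc n) = frag_cmul ((-1) ^ Suc n) (coneop (Suc n) (Suc n)
     (grid_chain N (Suc n) - id_cube (Suc n) -
      natop (cube_space (Suc n)) (grid_homotopy N n) (I_bdry (Suc n) (id_cube (Suc n)))))"

lemma id_cube_cells: "id_cube n \<in> frags (cube_maps n n)"
  using id_cell_in_cells[OF closure_cube_space] by simp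

lemma cube_bdry_id_cells:
  "I_bdry (Suc n) (id_cube (Suc n)) \<in> frags (cube_maps n (Suc n))"
  using I_cube.cube_bdry_cells[OF id_cube_cells[of "Suc n"]] by simp

lemma grid_homotopy_rest_cells:
  assumes "grid_homotopy N n \<in> frags (cube_maps (Suc n) n)"
  shows "grid_chain N (Suc n) - id_cube (Suc n) -
      natop (cube_space (Suc n)) (grid_homotopy N n) (I_bdry (Suc n) (id_cube (Suc n)))
    \<in> frags (cube_maps (Suc n) (Suc n))"
  by (intro frags_diff grid_chain_cells id_cube_cells natop_cells[OF closure_cube_space assms cube_bdry_id_cells])

lemma grid_homotopy_cells: "grid_homotopy N n \<in> frags (cube_maps (Suc n) n)"
proof (induction n)
  case (Suc n)
  show ?case
    unfolding grid_homotopy.simps by (intro frags_cmul coneop_cells grid_homotopy_rest_cells Suc)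
qed simp

lemma natop_grid_degenerate:
  assumes "c \<in> frags (deg_cells I_space X n)"
  shows "natop (cube_space n) (grid_chain N n) c \<in> frags (deg_cells I_space X n)"
  unfolding natop_def using assms by (rule frags_frag_extend) (rule push_grid_chain_degenerate)

text \<open>A degenerate cube equals its composite with some \<open>coord_proj n i\<close>, so by
  naturality it suffices to know the homotopy on these projections. The reduction is separate
  because the induction establishing \<open>proj\<close> uses it one dimension lower.\<close>

lemma natop_homotopy_degenerate_of_proj:
  assumes proj: "\<And>i. i \<in> {1..n} \<Longrightarrow> push (cube_space (Suc n)) (coord_proj n i) (grid_homotopy N n) \<in> frags (degs (Suc n) n)"
    and c: "c \<in> frags (deg_cells I_space X n)"
  shows "natop (cube_space (Suc n)) (grid_homotopy N n) c \<in> frags (deg_cells I_space X (Suc n))"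
  unfolding natop_def using c
proof (rule frags_frag_extend)
  fix \<sigma> assume \<sigma>: "\<sigma> \<in> deg_cells I_space X n"
  then obtain i where i: "i \<in> {1..n}" "restrict (\<sigma> \<circ> coord_proj n i) (cube n) = \<sigma>"
    using degenerate_coord_proj by blast
  then have "push (cube_space (Suc n)) \<sigma> (grid_homotopy N n) =
      push (cube_space (Suc n)) \<sigma> (push (cube_space (Suc n)) (coord_proj n i) (grid_homotopy N n))"
    using push_restrict_compose[OF grid_homotopy_cells, of n \<sigma> "coord_proj n i" N] by (simp only: pts_cube_space)
  also have "\<dots> \<in> frags (deg_cells I_space X (Suc n))"
    by (rule I_cube.push_degenerate[OF _ proj[OF i(1)]]) (use \<sigma> in \<open>simp add: deg_cells_def\<close>)
  finally show "push (cube_space (Suc n)) \<sigma> (grid_homotopy N n) \<in> frags (deg_cells I_space X (Suc n))" .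
qed

text \<open>Pushed along the projection, everything under the cone becomes degenerate: the grid and
  the identity because the projection itself is a degenerate cube, the lower homotopy by induction
  because the boundary of that cube is degenerate. Cones preserve degeneracy.\<close>

lemma push_coord_proj_homotopy:
  "i \<in> {1..n} \<Longrightarrow> push (cube_space (Suc n)) (coord_proj n i) (grid_homotopy N n) \<in> frags (degs (Suc n) n)"
proof (induction n arbitrary: i)
  case (Suc n)
  let ?K = "cube_space (Suc n)" and ?p = "coord_proj (Suc n) i"
  let ?i = "frag_of (id_cell ?K)"
  have p: "push ?K ?p ?i = frag_of ?p"
    using coord_proj_cells[of "Suc n" i] by (intro push_id_cell) (simp add: cells_def)
  have pd: "frag_of ?p \<in> frags (degs (Suc n) (Suc n))"
    using coord_proj_degs[OF Suc.prems] by simp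
  have "push ?K ?p (natop ?K (grid_homotopy N n) (I_bdry (Suc n) ?i)) =
      natop ?K (grid_homotopy N n) (I_bdry (Suc n) (frag_of ?p))"
    using I_cube.cube_bdry_push[of "Suc n" ?p ?i] natop_push[OF grid_homotopy_cells[of N n], of ?p] p
    by (simp del: pts_cl_power)
  also have "\<dots> \<in> frags (degs (Suc n) (Suc n))"
    using I_cube.cube_bdry_degenerate[OF pd] by (intro natop_homotopy_degenerate_of_proj[OF Suc.IH]) simp_all
  finally have "push ?K ?p (grid_chain N (Suc n) - ?i - natop ?K (grid_homotopy N n) (I_bdry (Suc n) ?i))
      \<in> frags (degs (Suc n) (Suc n))"
    unfolding push_diff p using push_grid_chain_degenerate coord_proj_degs[OF Suc.prems] pd by (intro frags_diff) auto
  then show ?case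
    unfolding grid_homotopy.simps push_cmul push_coord_proj_coneop[OF grid_homotopy_rest_cells[OF grid_homotopy_cells]]
    by (intro frags_cmul coneop_degs)
qed simp

lemma natop_grid_homotopy_degenerate:
  "c \<in> frags (deg_cells I_space X n) \<Longrightarrow>
    natop (cube_space (Suc n)) (grid_homotopy N n) c \<in> frags (deg_cells I_space X (Suc n))"
  by (rule natop_homotopy_degenerate_of_proj[OF push_coord_proj_homotopy])

lemma grid_homotopy_of_model:
  fixes X :: "'a clspace"
  assumes model: "grid_chain N n - id_cube n - I_bdry (Suc n) (grid_homotopy N n) -
      natop (cube_space n) (grid_homotopy N (n - 1)) (I_bdry n (id_cube n)) \<in> frags (degs n n)"
    and x: "x \<in> frags (cells (cube_space n) X)"
  shows "natop (cube_space n) (grid_chain N n) x - x - I_bdry (Suc n) (natop (cube_space (Suc n)) (grid_homotopy N n) x) -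
    natop (cube_space (Suc (n - 1))) (grid_homotopy N (n - 1)) (I_bdry n x) \<in> frags (deg_cells I_space X n)"
  by (rule natop_homotopy[where bd = "I_bdry" and bd' = "I_bdry" and K = cube_space
      and s = "grid_chain N" and t = "grid_homotopy N", OF I_cube.cube_bdry_diff I_cube.cube_bdry_0 I_cube.cube_bdry_0 I_cube.cube_bdry_push
      closure_cube_space grid_chain_cells grid_homotopy_cells model I_cube.push_degenerate x])

lemma grid_chain_map:
  assumes "0 < N" "x \<in> frags (cells (cube_space n) X)"
  shows "I_bdry n (natop (cube_space n) (grid_chain N n) x) =
    natop (cube_space (n - 1)) (grid_chain N (n - 1)) (I_bdry n x)"
  by (rule natop_chain_map[where bd = "I_bdry" and bd' = "I_bdry" and K = cube_space
      and s = "grid_chain N", OF I_cube.cube_bdry_diff I_cube.cube_bdry_push closure_cube_space grid_chain_cells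
      cube_bdry_grid_chain[OF assms(1)] assms(2)])

lemma grid_chain_0: "grid_chain N 0 = id_cube 0"
proof -
  have "grid_cell N 0 v = id_cell (cube_space 0)" for v
    by (auto simp: grid_cell_def id_cell_def pts_cube_space cube_def fun_eq_iff)
  then show ?thesis by (simp add: grid_chain_def)
qed

text \<open>Let \<open>z\<close> be the chain that is coned off. Its boundary is the error term of
  dimension \<open>n\<close>, evaluated on the boundary of the identity cube, and hence degenerate
  by induction. So the boundary of the cone over \<open>z\<close> is \<open>z\<close> up to sign and
  degenerate cubes.\<close>

lemma grid_homotopy_model:
  assumes N: "0 < N"
  shows "grid_chain N n - id_cube n - I_bdry (Suc n) (grid_homotopy N n) -
      natop (cube_space n) (grid_homotopy N (n - 1)) (I_bdry n (id_cube n)) \<in> frags (degs n n)"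
proof (induction n)
  case 0
  show ?case by (simp add: grid_chain_0 I_cube.cube_bdry_0 I_cube.cube_bdry_zero)
next
  case (Suc n)
  let ?K = "cube_space (Suc n)" and ?m = "Suc n"
  let ?i = "frag_of (id_cell ?K)"
  define b where "b = I_bdry ?m ?i"
  define z where "z = grid_chain N ?m - ?i - natop ?K (grid_homotopy N n) b"
  have b: "b \<in> frags (cells (cube_space n) ?K)"
    unfolding b_def by (rule cube_bdry_id_cells)
  have z: "z \<in> frags (cells ?K ?K)"
    unfolding z_def b_def by (rule grid_homotopy_rest_cells[OF grid_homotopy_cells])
  have "I_bdry n b = 0"
    unfolding b_def by (rule I_cube.cube_bdry_bdry)
  \<comment> \<open>The last summand is zero; it is written so that the right-hand side is the
    expression bounded by \<open>grid_homotopy_of_model\<close>.\<close>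
  then have "I_bdry ?m z = natop (cube_space n) (grid_chain N n) b - b -
      I_bdry ?m (natop ?K (grid_homotopy N n) b) -
      natop (cube_space (Suc (n - 1))) (grid_homotopy N (n - 1)) (I_bdry n b)"
    using cube_bdry_grid_chain[OF N, of ?m] by (simp add: z_def I_cube.cube_bdry_diff flip: b_def del: pts_cl_power)
  also have "\<dots> \<in> frags (degs n ?m)"
    by (rule grid_homotopy_of_model[OF Suc b])
  finally have bz: "coneop n ?m (I_bdry ?m z) \<in> frags (degs ?m ?m)"
    by (rule coneop_degs)
  obtain d where d: "d \<in> frags {zero_cell ?m ?m}"
    "I_bdry (Suc ?m) (coneop ?m ?m z) = coneop n ?m (I_bdry ?m z) + frag_cmul ((-1) ^ ?m) z + d"
    using cube_bdry_coneop[OF z] by auto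
  \<comment> \<open>The dimension \<open>?m\<close> is positive, so the bottom of the cone is
    degenerate.\<close>
  have d': "d \<in> frags (degs ?m ?m)"
    using d(1) by (rule frags_mono) (simp add: zero_cell_degs)
  have "I_bdry (Suc ?m) (grid_homotopy N ?m) =
      frag_cmul ((-1) ^ ?m) (coneop n ?m (I_bdry ?m z) + d) + z"
  proof -
    have "I_bdry (Suc ?m) (grid_homotopy N ?m) = frag_cmul ((-1) ^ ?m) (I_bdry (Suc ?m) (coneop ?m ?m z))"
      unfolding grid_homotopy.simps I_cube.cube_bdry_cmul z_def b_def ..
    also have "\<dots> = frag_cmul ((-1) ^ ?m) (coneop n ?m (I_bdry ?m z) + d) + frag_cmul ((-1) ^ ?m * (-1) ^ ?m) z"
      unfolding d(2) frag_cmul_distrib2 frag_cmul_cmul by (simp only: add.commute add.left_commute add.assoc)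
    \<comment> \<open>The sign in \<open>grid_homotopy\<close> is chosen to cancel the one that
      \<open>cube_bdry_coneop\<close> puts before \<open>z\<close>.\<close>
    also have "((-1::int) ^ ?m * (-1) ^ ?m) = 1"
      by (simp flip: power_mult_distrib)
    finally show ?thesis by simp
  qed
  then have "grid_chain N ?m - ?i - I_bdry (Suc ?m) (grid_homotopy N ?m) -
      natop ?K (grid_homotopy N (?m - 1)) (I_bdry ?m ?i) =
      - frag_cmul ((-1) ^ ?m) (coneop n ?m (I_bdry ?m z) + d)"
    by (simp only: diff_Suc_1 flip: b_def) (simp add: z_def)
  also have "\<dots> \<in> frags (degs ?m ?m)"
    by (intro frags_minus frags_cmul frags_add bz d')
  finally show ?case .
qed

text \<open>For one cell, the pulled back cover of the compact cube has a Lebesgue number, and the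
  small cubes eventually have smaller diameter. As for simplices, the claim for all large
  \<open>N\<close> lets the bounds of several cells be combined.\<close>

lemma grid_subdivision_small:
  assumes X: "closure_space X" and cov: "interior_cover X {A, B}"
    and c: "c \<in> frags (cells (cube_space n) X)"
  shows "\<exists>N0. \<forall>N\<ge>N0. natop (cube_space n) (grid_chain N n) c \<in>
    small_chains (cube_space n) X A B"
  using c
proof (induction rule: frags_induct)
  case (one \<sigma>)
  have AB: "A \<subseteq> pts X" "B \<subseteq> pts X"
    using cov by (auto simp: interior_cover_def)
  obtain U V where UV: "openin (top_of_set (cube n)) U" "openin (top_of_set (cube n)) V"
      "cube n \<subseteq> U \<union> V" "\<sigma> ` U \<subseteq> A" "\<sigma> ` V \<subseteq> B"
    using pullback_interior_cover[OF X cov, of \<sigma> "top_of_set (cube n)"] one[unfolded cube_space_eq] by auto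
  obtain U' V' where U': "open U'" "U = cube n \<inter> U'" and V': "open V'" "V = cube n \<inter> V'"
    using UV(1,2) unfolding openin_open by blast
  obtain \<delta> where \<delta>: "0 < \<delta>" "\<And>T. T \<subseteq> cube n \<Longrightarrow> diameter T < \<delta> \<Longrightarrow> \<exists>W\<in>{U', V'}. T \<subseteq> W"
    by (rule Lebesgue_number_lemma[OF compact_cube, of "{U', V'}" n]) (use U' V' UV(3) in auto)
  \<comment> \<open>The 2 is the constant of \<open>dist_fun_le\<close>: two points of a small cube
    differ by at most \<open>1 / N\<close> in each coordinate, so its diameter is at most
    \<open>2 / N\<close>.\<close>
  obtain N0 :: nat where N0: "2 / \<delta> < real N0"
    using reals_Archimedean2 by blast
  show ?case
  proof (intro exI allI impI)
    fix N assume N: "N0 \<le> N"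
    have N2: "0 < N" "2 / real N < \<delta>"
    proof -
      have 1: "2 / \<delta> < real N" using N0 N by linarith
      then have "0 < real N" using \<delta>(1) by (smt (verit) divide_pos_pos)
      then show "0 < N" "2 / real N < \<delta>" using 1 \<delta>(1) by (auto simp: field_simps)
    qed
    have "restrict (\<sigma> \<circ> grid_cell N n v) (pts (cube_space n)) \<in>
        cells (cube_space n) (cl_subspace X A) \<union> cells (cube_space n) (cl_subspace X B)" if v: "v \<in> grid N n" for v
    proof -
      note g = grid_cell_cells[OF v]
      have gc: "grid_cell N n v ` cube n \<subseteq> cube n" using g unfolding cells_cube_space by blast
      have dist: "dist y y' \<le> 2 / real N"
        if "y \<in> grid_cell N n v ` cube n" "y' \<in> grid_cell N n v ` cube n" for y y'
      proof -
        from that obtain x x' where x: "x \<in> cube n" "x' \<in> cube n" "y = grid_cell N n v x" "y' = grid_cell N n v x'"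
          by blast
        show "dist y y' \<le> 2 / real N"
        proof (rule order_trans[OF dist_fun_le[of _ _ "1 / real N"]])
          fix k
          show "dist (y k) (y' k) \<le> 1 / real N"
          proof (cases "k \<in> {1..n}")
            case True
            then have "dist (y k) (y' k) = \<bar>x k - x' k\<bar> / real N"
              using x N2(1) by (simp add: grid_cell_def dist_real_def flip: diff_divide_distrib)
            also have "\<dots> \<le> 1 / real N"
              using cubeD[OF x(1) True] cubeD[OF x(2) True] by (intro divide_right_mono) auto
            finally show ?thesis .
          next
            case False
            then show ?thesis
              unfolding x(3,4) grid_cell_def using x(1,2) by (simp only: restrict_apply if_True if_False dist_self) simp
          qed
        qed simp
      qed
      have "cube n \<noteq> {}" by (simp add: cube_def PiE_eq_empty_iff)
      then have "diameter (grid_cell N n v ` cube n) \<le> 2 / real N"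
        unfolding diameter_def using dist by (auto intro!: cSUP_least)
      then obtain W where "W \<in> {U', V'}" "grid_cell N n v ` cube n \<subseteq> W"
        using \<delta>(2)[OF gc] N2(2) by (meson order_le_less_trans)
      then have "grid_cell N n v ` cube n \<subseteq> U \<or> grid_cell N n v ` cube n \<subseteq> V"
        unfolding U'(2) V'(2) using gc by (simp only: Int_subset_iff) blast
      then have "\<sigma> ` grid_cell N n v ` cube n \<subseteq> A \<or> \<sigma> ` grid_cell N n v ` cube n \<subseteq> B"
        using UV(4,5) by (meson image_mono order_trans)
      moreover have "restrict (\<sigma> \<circ> grid_cell N n v) (cube n) ` cube n = \<sigma> ` grid_cell N n v ` cube n"
        by (simp add: image_comp)
      moreover have "restrict (\<sigma> \<circ> grid_cell N n v) (pts (cube_space n)) \<in> cells (cube_space n) X"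
        using g by (intro cells_compose[OF one _ closure_cube_space]) (simp add: cells_def)
      ultimately show ?thesis
        unfolding cells_subspace[OF closure_cube_space AB(1)] cells_subspace[OF closure_cube_space AB(2)] pts_cube_space
        by simp
    qed
    then show "natop (cube_space n) (grid_chain N n) (frag_of \<sigma>) \<in>
        small_chains (cube_space n) X A B"
      unfolding natop_of grid_chain_def push_sum[OF finite_grid] push_of by (intro frags_sum) (simp only: frags_frag_of)
  qed
next
  case (diff a b)
  then obtain k l where "\<forall>N\<ge>k. natop (cube_space n) (grid_chain N n) a \<in>
      small_chains (cube_space n) X A B"
    "\<forall>N\<ge>l. natop (cube_space n) (grid_chain N n) b \<in>
      small_chains (cube_space n) X A B"
    by blast
  then show ?case
    by (intro exI[of _ "max k l"]) (simp add: natop_diff frags_diff)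
qed simp

proposition cube_inclusion_iso_I:
  fixes X :: "'a clspace"
  assumes X: "closure_space X" and cov: "interior_cover X {A, B}"
  shows "cube_inclusion_iso I_space n (cl_subspace X B) (A \<inter> B) X A"
proof (rule cube_inclusion_iso_of_excisive[OF closure_cube_space])
  show AB: "A \<subseteq> pts X" "B \<subseteq> pts X"
    using cov by (auto simp: interior_cover_def)
  show "excisive_cells (\<lambda>n. cells (cube_space n) X) (\<lambda>n. cells (cube_space n) (cl_subspace X A))
     (\<lambda>n. cells (cube_space n) (cl_subspace X B)) (deg_cells I_space X) (I_bdry)"
  proof (rule I_cube.excisive_cellsI[OF AB])
    fix c n assume "c \<in> frags (cells (cube_space n) X)"
    from grid_subdivision_small[OF X cov this] obtain N0 where N0: "\<forall>N\<ge>N0. natop (cube_space n) (grid_chain N n) c \<in>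
        small_chains (cube_space n) X A B"
      by blast
    \<comment> \<open>The successor ensures \<open>0 < N\<close>, which the chain map property of
      the grid requires.\<close>
    define N where "N = Suc N0"
    have N: "0 < N" and small: "natop (cube_space n) (grid_chain N n) c \<in>
        small_chains (cube_space n) X A B"
      using N0 by (simp_all add: N_def)
    have "subdivision {\<lambda>n. cells (cube_space n) X, \<lambda>n. cells (cube_space n) (cl_subspace X A),
          \<lambda>n. cells (cube_space n) (cl_subspace X B), deg_cells I_space X}
        (\<lambda>n. cells (cube_space n) X) (deg_cells I_space X) (I_bdry)
        (\<lambda>m. natop (cube_space m) (grid_chain N m)) (\<lambda>m. natop (cube_space (Suc m)) (grid_homotopy N m))"
      unfolding subdivision_def
      by (intro conjI allI ballI natop_diff grid_chain_map[OF N] grid_homotopy_of_model[OF grid_homotopy_model[OF N]])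
        (auto intro: natop_cells[OF closure_cube_space grid_chain_cells]
          natop_cells[OF closure_cube_space grid_homotopy_cells]
          natop_grid_degenerate natop_grid_homotopy_degenerate)
    then show "\<exists>s t. subdivision {\<lambda>n. cells (cube_space n) X, \<lambda>n. cells (cube_space n) (cl_subspace X A),
          \<lambda>n. cells (cube_space n) (cl_subspace X B), deg_cells I_space X}
        (\<lambda>n. cells (cube_space n) X) (deg_cells I_space X) (I_bdry) s t \<and>
      s n c \<in> small_chains (cube_space n) X A B"
      using small by blast
  qed
qed

section \<open>The two forms of excision\<close>

theorem theorem1p5:
  fixes X :: "'a clspace"
  assumes "closure_space X"
  shows
    "(\<forall>Z A. Z \<subseteq> A \<and> A \<subseteq> pts X \<and> cl X Z \<subseteq> cl_interior X A \<longrightarrow>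
        (\<forall>n.
          sing_inclusion_iso I_simplices n (cl_subspace X (pts X - Z)) (A - Z) X A \<and>
          sing_inclusion_iso J1_simplices n (cl_subspace X (pts X - Z)) (A - Z) X A \<and>
          sing_inclusion_iso Jp_simplices n (cl_subspace X (pts X - Z)) (A - Z) X A \<and>
          cube_inclusion_iso I_space n (cl_subspace X (pts X - Z)) (A - Z) X A \<and>
          cube_inclusion_iso J1_space n (cl_subspace X (pts X - Z)) (A - Z) X A \<and>
          cube_inclusion_iso Jp_space n (cl_subspace X (pts X - Z)) (A - Z) X A)) \<and>
     (\<forall>A B. interior_cover X {A, B} \<longrightarrow>
        (\<forall>n.
          sing_inclusion_iso I_simplices n (cl_subspace X B) (A \<inter> B) X A \<and>
          sing_inclusion_iso J1_simplices n (cl_subspace X B) (A \<inter> B) X A \<and>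
          sing_inclusion_iso Jp_simplices n (cl_subspace X B) (A \<inter> B) X A \<and>
          cube_inclusion_iso I_space n (cl_subspace X B) (A \<inter> B) X A \<and>
          cube_inclusion_iso J1_space n (cl_subspace X B) (A \<inter> B) X A \<and>
          cube_inclusion_iso Jp_space n (cl_subspace X B) (A \<inter> B) X A))"
proof -
  note isos = sing_inclusion_iso_I[OF assms] sing_inclusion_iso_J1[OF assms] sing_inclusion_iso_Jp[OF assms]
    cube_inclusion_iso_I[OF assms] cube_inclusion_iso_J1[OF assms] cube_inclusion_iso_Jp[OF assms]
  \<comment> \<open>Excising \<open>Z\<close> is the cover form for the complement of
    \<open>Z\<close>: the interior of this complement is the complement of \<open>cl X Z\<close>,
    and what it misses lies in the interior of \<open>A\<close>.\<close>
  have "interior_cover X {A, pts X - Z} \<and> A \<inter> (pts X - Z) = A - Z"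
    if "Z \<subseteq> A" "A \<subseteq> pts X" "cl X Z \<subseteq> cl_interior X A" for Z A
  proof -
    have "pts X - (pts X - Z) = Z" using that by blast
    then have "cl_interior X (pts X - Z) = pts X - cl X Z" by (simp add: cl_interior_def)
    moreover have "cl_interior X A \<subseteq> pts X" by (auto simp: cl_interior_def)
    ultimately show ?thesis using that by (auto simp: interior_cover_def)
  qed
  then show ?thesis
    using isos by metis
qed

end
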